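(* Let $\rho_1,\rho_2>0$ be sufficiently large penalty parameters. There exists a unique solution $(\mathbf{u}_h,p_h)\in \mathbf{V}_h\times Q_h$ to the standard enriched Galerkin (ST-EG) method: $$\nu\,\mathbf{a}(\mathbf{u}_h,\mathbf{v})+\mathbf{c}(\mathbf{u}_h,\mathbf{v})-\mathbf{b}(\mathbf{v},p_h)=(\mathbf{f},\mathbf{v})\quad\forall \mathbf{v}\in\mathbf{V}_h,\qquad \mathbf{b}(\mathbf{u}_h,q)=0\quad\forall q\in Q_h.$$
   Context: Setting. $\Omega\subset\mathbb{R}^d$, $d\in\{2,3\}$, is a bounded domain with simply connected Lipschitz boundary, $\nu\in[0,1]$, and $\mathbf{f}\in[L^2(\Omega)]^d$. $\mathcal{T}_h$ is a shape-regular triangulation of $\Omega$ into triangles ($d=2$) or tetrahedra ($d=3$); $h_T$ is the diameter of $T\in\mathcal{T}_h$ and $h=\max_T h_T$. $\mathcal{E}_h=\mathcal{E}_h^o\cup\mathcal{E}_h^b$ is the set of all edges/faces (interior and boundary ones). For $e\in\mathcal{E}_h^o$ shared by $T^+,T^-$, $\mathbf{n}_e$ is the unit normal from $T^+$ to $T^-$; for $e\in\mathcal{E}_h^b$ it is the outward unit normal on $\partial\Omega$. $h_e=|e|^{1/(d-1)}$. Jump and average: $[v]=v^+-v^-$, $\{v\}=(v^++v^-)/2$ on interior $e$, and $[v]=\{v\}=v$ on boundary $e$ (componentwise for vectors and tensors). $(\cdot,\cdot)$ is the $L^2(\Omega)$ inner product; $(\cdot,\cdot)_{\mathcal{T}_h}=\sum_T(\cdot,\cdot)_{L^2(T)}$;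 $\langle\cdot,\cdot\rangle_{\mathcal{E}_h}=\sum_e(\cdot,\cdot)_{L^2(e)}$. Spaces. $\mathbf{C}_h=\{\mathbf{v}\in[H_0^1(\Omega)]^d:\mathbf{v}|_T\in[P_1(T)]^d\ \forall T\in\mathcal{T}_h\}$; $\mathbf{D}_h=\{\mathbf{v}\in[L^2(\Omega)]^d:\mathbf{v}|_T=c_T(\mathbf{x}-\mathbf{x}_T),\ c_T\in\mathbb{R},\ \forall T\in\mathcal{T}_h\}$, with $\mathbf{x}_T$ the barycenter of $T$; $\mathbf{V}_h=\mathbf{C}_h\oplus\mathbf{D}_h$; $Q_h=\{q\in L_0^2(\Omega):q|_T\in P_0(T)\ \forall T\in\mathcal{T}_h\}$, where $L_0^2(\Omega)$ is the space of mean-zero $L^2$ functions. Bilinear forms (derivatives taken elementwise), with penalty parameters $\rho_1,\rho_2>0$: $\mathbf{a}(\mathbf{v},\mathbf{w})=(\nabla\mathbf{v},\nabla\mathbf{w})_{\mathcal{T}_h}-\langle\{\nabla\mathbf{v}\}\mathbf{n}_e,[\mathbf{w}]\rangle_{\mathcal{E}_h}-\langle\{\nabla\mathbf{w}\}\mathbf{n}_e,[\mathbf{v}]\rangle_{\mathcal{E}_h}+\rho_1\langle h_e^{-1}[\mathbf{w}],[\mathbf{v}]\rangle_{\mathcal{E}_h}$, $\mathbf{c}(\mathbf{v},\mathbf{w})=(\mathbf{v},\mathbf{w})_{\mathcal{T}_h}+\rho_2\langle h_e[\mathbf{w}],[\mathbf{v}]\rangle_{\mathcal{E}_h}$, $\mathbf{b}(\mathbf{w},q)=(\nabla\cdot\mathbf{w},q)_{\mathcal{T}_h}-\langle[\mathbf{w}]\cdot\mathbf{n}_e,\{q\}\rangle_{\mathcal{E}_h}$.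 "Sufficiently large" means larger than a threshold independent of $\nu$ and $h$. *)

theory Defs
  imports "HOL-Analysis.Analysis"
begin

text \<open>
  The ambient space is \<open>real ^ 'n\<close>, with \<open>d = CARD('n)\<close>. Elements of \<open>L\<^sup>2\<close>-type spaces are
  represented by functions on the whole space, of which only the almost-everywhere class on the
  domain matters: all function spaces below are closed under modification on null sets and outside
  the domain.
\<close>

section \<open>Domains\<close>

text \<open>Near each boundary point, after a rotation taking \<open>n\<close> to the last coordinate direction, the
  domain is the region strictly above the graph of a Lipschitz function \<open>\<phi>\<close>. The function \<open>\<phi>\<close> is
  only ever evaluated on the hyperplane orthogonal to \<open>n\<close>.\<close>

definition lipschitz_boundary :: "(real ^ 'n) set \<Rightarrow> bool" where
  "lipschitz_boundary \<Omega> \<longleftrightarrow>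
     (\<forall>x0 \<in> frontier \<Omega>. \<exists>U n \<phi> L.
        open U \<and> x0 \<in> U \<and> norm n = 1 \<and> lipschitz_on L {y. y \<bullet> n = 0} (\<phi> :: real ^ 'n \<Rightarrow> real) \<and>
        U \<inter> \<Omega> = {x \<in> U. x \<bullet> n > \<phi> (x - (x \<bullet> n) *\<^sub>R n)})"

definition bounded_lipschitz_domain :: "(real ^ 'n) set \<Rightarrow> bool" where
  "bounded_lipschitz_domain \<Omega> \<longleftrightarrow>
     open \<Omega> \<and> connected \<Omega> \<and> \<Omega> \<noteq> {} \<and> bounded \<Omega> \<and> lipschitz_boundary \<Omega>"

section \<open>Lebesgue and Sobolev spaces\<close>

definition L2 :: "(real ^ 'n) set \<Rightarrow> (real ^ 'n \<Rightarrow> 'b::euclidean_space) set" where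
  "L2 \<Omega> = {v \<in> borel_measurable (lebesgue_on \<Omega>). integrable (lebesgue_on \<Omega>) (\<lambda>x. (norm (v x))\<^sup>2)}"

definition L20 :: "(real ^ 'n) set \<Rightarrow> (real ^ 'n \<Rightarrow> real) set" where
  "L20 \<Omega> = {q \<in> L2 \<Omega>. (LINT x|lebesgue_on \<Omega>. q x) = 0}"

definition partial :: "'n \<Rightarrow> (real ^ 'n \<Rightarrow> real) \<Rightarrow> real ^ 'n \<Rightarrow> real" where
  "partial i \<phi> x = frechet_derivative \<phi> (at x) (axis i 1)"

definition gradient :: "(real ^ 'n \<Rightarrow> real) \<Rightarrow> real ^ 'n \<Rightarrow> real ^ 'n" where
  "gradient \<phi> x = (\<chi> i. partial i \<phi> x)"

fun C_diff :: "nat \<Rightarrow> (real ^ 'n \<Rightarrow> real) \<Rightarrow> bool" where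
  "C_diff 0 \<phi> \<longleftrightarrow> continuous_on UNIV \<phi>"
| "C_diff (Suc k) \<phi> \<longleftrightarrow> (\<forall>x. \<phi> differentiable (at x)) \<and> (\<forall>i. C_diff k (partial i \<phi>))"

definition test_functions :: "(real ^ 'n) set \<Rightarrow> (real ^ 'n \<Rightarrow> real) set" where
  "test_functions \<Omega> =
     {\<phi>. (\<forall>k. C_diff k \<phi>) \<and> compact (closure {x. \<phi> x \<noteq> 0}) \<and> closure {x. \<phi> x \<noteq> 0} \<subseteq> \<Omega>}"

definition weak_gradient ::
  "(real ^ 'n) set \<Rightarrow> (real ^ 'n \<Rightarrow> real) \<Rightarrow> (real ^ 'n \<Rightarrow> real ^ 'n) \<Rightarrow> bool" where
  "weak_gradient \<Omega> v G \<longleftrightarrow>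
     (\<forall>\<phi> \<in> test_functions \<Omega>. \<forall>i.
        (LINT x|lebesgue_on \<Omega>. v x * partial i \<phi> x) = - (LINT x|lebesgue_on \<Omega>. G x $ i * \<phi> x))"

text \<open>\<open>H\<^sup>1\<^sub>0\<close> is the closure of the test functions in the \<open>H\<^sup>1\<close> norm.\<close>

definition H10 :: "(real ^ 'n) set \<Rightarrow> (real ^ 'n \<Rightarrow> real) set" where
  "H10 \<Omega> = {v \<in> L2 \<Omega>. \<exists>G \<in> L2 \<Omega>. weak_gradient \<Omega> v G \<and>
     (\<exists>\<phi>. (\<forall>k. \<phi> k \<in> test_functions \<Omega>) \<and>
        (\<lambda>k::nat. (LINT x|lebesgue_on \<Omega>. (\<phi> k x - v x)\<^sup>2)
              + (LINT x|lebesgue_on \<Omega>. (norm (gradient (\<phi> k) x - G x))\<^sup>2)) \<longlonglongrightarrow> 0)}"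

section \<open>Meshes\<close>

definition mesh :: "(real ^ 'n) set \<Rightarrow> (real ^ 'n) set set \<Rightarrow> bool" where
  "mesh \<Omega> \<T> \<longleftrightarrow> triangulation \<T> \<and> (\<forall>T \<in> \<T>. int CARD('n) simplex T) \<and> \<Union>\<T> = closure \<Omega>"

definition inball_diameter :: "(real ^ 'n) set \<Rightarrow> real" where
  "inball_diameter T = Sup {2 * r | r. r \<ge> 0 \<and> (\<exists>x. cball x r \<subseteq> T)}"

definition shape_regular :: "real \<Rightarrow> (real ^ 'n) set set \<Rightarrow> bool" where
  "shape_regular \<sigma> \<T> \<longleftrightarrow> (\<forall>T \<in> \<T>. diameter T \<le> \<sigma> * inball_diameter T)"

definition barycenter :: "(real ^ 'n) set \<Rightarrow> real ^ 'n" where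
  "barycenter T = (1 / (real CARD('n) + 1)) *\<^sub>R (\<Sum>v | v extreme_point_of T. v)"

definition faces :: "(real ^ 'n) set set \<Rightarrow> (real ^ 'n) set set" where
  "faces \<T> = {e. \<exists>T \<in> \<T>. e facet_of T}"

definition interior_faces :: "(real ^ 'n) set set \<Rightarrow> (real ^ 'n) set set" where
  "interior_faces \<T> = {e. \<exists>T \<in> \<T>. \<exists>T' \<in> \<T>. T \<noteq> T' \<and> e facet_of T \<and> e facet_of T'}"

text \<open>A choice, for every face \<open>e\<close>, of the elements \<open>T\<^sup>+ = Tp e\<close> and \<open>T\<^sup>- = Tm e\<close>. On a boundary face
  \<open>Tp e\<close> is the unique adjacent element and \<open>Tm e\<close> is irrelevant.\<close>

definition face_sides ::
  "(real ^ 'n) set set \<Rightarrow> ((real ^ 'n) set \<Rightarrow> (real ^ 'n) set) \<Rightarrow>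
   ((real ^ 'n) set \<Rightarrow> (real ^ 'n) set) \<Rightarrow> bool" where
  "face_sides \<T> Tp Tm \<longleftrightarrow>
     (\<forall>e \<in> faces \<T>. Tp e \<in> \<T> \<and> e facet_of Tp e) \<and>
     (\<forall>e \<in> interior_faces \<T>. Tm e \<in> \<T> \<and> e facet_of Tm e \<and> Tm e \<noteq> Tp e)"

text \<open>The unit normal to the facet \<open>e\<close> of \<open>T\<close> pointing out of \<open>T\<close>. For \<open>T = Tp e\<close> this is
  \<open>n\<^sub>e\<close>: it points from \<open>T\<^sup>+\<close> to \<open>T\<^sup>-\<close> on interior faces and out of the domain on boundary faces.\<close>

definition outward_normal :: "(real ^ 'n) set \<Rightarrow> (real ^ 'n) set \<Rightarrow> real ^ 'n" where
  "outward_normal T e = (THE n. norm n = 1 \<and> (\<forall>x \<in> e. \<forall>y \<in> e. (y - x) \<bullet> n = 0) \<and>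
                                (\<forall>x \<in> e. \<forall>y \<in> T. (y - x) \<bullet> n \<le> 0))"

text \<open>The \<open>(d - 1)\<close>-dimensional Lebesgue measure on a face \<open>e\<close>: the image, under orthogonal
  projection onto the hyperplane spanned by \<open>e\<close>, of \<open>d\<close>-dimensional Lebesgue measure on the right
  prism of thickness 1 over \<open>e\<close>.\<close>

definition face_prism :: "(real ^ 'n) set \<Rightarrow> (real ^ 'n) set" where
  "face_prism e = {x. closest_point (affine hull e) x \<in> e \<and>
                      dist x (closest_point (affine hull e) x) \<le> 1 / 2}"

definition face_measure :: "(real ^ 'n) set \<Rightarrow> (real ^ 'n) measure" where
  "face_measure e = distr (lebesgue_on (face_prism e)) borel (closest_point (affine hull e))"

definition face_size :: "(real ^ 'n) set \<Rightarrow> real" where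
  "face_size e = measure (face_measure e) UNIV powr (1 / (real CARD('n) - 1))"

section \<open>Finite element spaces\<close>

definition P0 :: "(real ^ 'n \<Rightarrow> 'b::euclidean_space) set" where
  "P0 = {\<lambda>x. b | b. True}"

definition P1 :: "(real ^ 'n \<Rightarrow> 'b::euclidean_space) set" where
  "P1 = {\<lambda>x. A x + b | A b. linear A}"

definition restricts_to ::
  "(real ^ 'n \<Rightarrow> 'b::euclidean_space) \<Rightarrow> (real ^ 'n) set \<Rightarrow> (real ^ 'n \<Rightarrow> 'b) \<Rightarrow> bool" where
  "restricts_to v T g \<longleftrightarrow> (AE x in lebesgue_on T. v x = g x)"

definition Ch :: "(real ^ 'n) set \<Rightarrow> (real ^ 'n) set set \<Rightarrow> (real ^ 'n \<Rightarrow> real ^ 'n) set" where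
  "Ch \<Omega> \<T> = {v. (\<forall>i. (\<lambda>x. v x $ i) \<in> H10 \<Omega>) \<and> (\<forall>T \<in> \<T>. \<exists>g \<in> P1. restricts_to v T g)}"

definition Dh :: "(real ^ 'n) set \<Rightarrow> (real ^ 'n) set set \<Rightarrow> (real ^ 'n \<Rightarrow> real ^ 'n) set" where
  "Dh \<Omega> \<T> = {v \<in> L2 \<Omega>. \<forall>T \<in> \<T>. \<exists>c. restricts_to v T (\<lambda>x. c *\<^sub>R (x - barycenter T))}"

definition Vh :: "(real ^ 'n) set \<Rightarrow> (real ^ 'n) set set \<Rightarrow> (real ^ 'n \<Rightarrow> real ^ 'n) set" where
  "Vh \<Omega> \<T> = {\<lambda>x. v x + w x | v w. v \<in> Ch \<Omega> \<T> \<and> w \<in> Dh \<Omega> \<T>}"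

definition Qh :: "(real ^ 'n) set \<Rightarrow> (real ^ 'n) set set \<Rightarrow> (real ^ 'n \<Rightarrow> real) set" where
  "Qh \<Omega> \<T> = {q \<in> L20 \<Omega>. \<forall>T \<in> \<T>. \<exists>g \<in> P0. restricts_to q T g}"

section \<open>Traces, jumps and averages\<close>

text \<open>The polynomial with which \<open>v\<close> agrees almost everywhere on the element \<open>T\<close>. Its values on the
  boundary of \<open>T\<close> are the traces of \<open>v\<close> taken from inside \<open>T\<close>.\<close>

definition piece :: "(real ^ 'n \<Rightarrow> 'b::euclidean_space) \<Rightarrow> (real ^ 'n) set \<Rightarrow> real ^ 'n \<Rightarrow> 'b" where
  "piece v T = (THE g. g \<in> P1 \<and> restricts_to v T g)"

text \<open>The gradient tensor has entries \<open>(\<nabla>v)\<^sub>i\<^sub>j = \<partial>v\<^sub>i / \<partial>x\<^sub>j\<close>.\<close>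

definition grad_piece :: "(real ^ 'n \<Rightarrow> real ^ 'n) \<Rightarrow> (real ^ 'n) set \<Rightarrow> real ^ 'n \<Rightarrow> real ^ 'n ^ 'n" where
  "grad_piece v T x = jacobian (piece v T) (at x)"

definition div_piece :: "(real ^ 'n \<Rightarrow> real ^ 'n) \<Rightarrow> (real ^ 'n) set \<Rightarrow> real ^ 'n \<Rightarrow> real" where
  "div_piece v T x = trace (grad_piece v T x)"

text \<open>Here \<open>W T\<close> is the part of a piecewise defined field belonging to the element \<open>T\<close>.\<close>

definition jump ::
  "(real ^ 'n) set set \<Rightarrow> ((real ^ 'n) set \<Rightarrow> (real ^ 'n) set) \<Rightarrow> ((real ^ 'n) set \<Rightarrow> (real ^ 'n) set) \<Rightarrow>
   ((real ^ 'n) set \<Rightarrow> real ^ 'n \<Rightarrow> 'b::euclidean_space) \<Rightarrow> (real ^ 'n) set \<Rightarrow> real ^ 'n \<Rightarrow> 'b" where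
  "jump \<T> Tp Tm W e x =
     (if e \<in> interior_faces \<T> then W (Tp e) x - W (Tm e) x else W (Tp e) x)"

definition average ::
  "(real ^ 'n) set set \<Rightarrow> ((real ^ 'n) set \<Rightarrow> (real ^ 'n) set) \<Rightarrow> ((real ^ 'n) set \<Rightarrow> (real ^ 'n) set) \<Rightarrow>
   ((real ^ 'n) set \<Rightarrow> real ^ 'n \<Rightarrow> 'b::euclidean_space) \<Rightarrow> (real ^ 'n) set \<Rightarrow> real ^ 'n \<Rightarrow> 'b" where
  "average \<T> Tp Tm W e x =
     (if e \<in> interior_faces \<T> then (1 / 2) *\<^sub>R (W (Tp e) x + W (Tm e) x) else W (Tp e) x)"

section \<open>Bilinear forms and the method\<close>

definition form_a ::
  "(real ^ 'n) set set \<Rightarrow> ((real ^ 'n) set \<Rightarrow> (real ^ 'n) set) \<Rightarrow> ((real ^ 'n) set \<Rightarrow> (real ^ 'n) set) \<Rightarrow>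
   real \<Rightarrow> (real ^ 'n \<Rightarrow> real ^ 'n) \<Rightarrow> (real ^ 'n \<Rightarrow> real ^ 'n) \<Rightarrow> real" where
  "form_a \<T> Tp Tm \<rho>\<^sub>1 v w =
     (\<Sum>T\<in>\<T>. LINT x|lebesgue_on T. grad_piece v T x \<bullet> grad_piece w T x)
     - (\<Sum>e\<in>faces \<T>. LINT x|face_measure e.
          (average \<T> Tp Tm (grad_piece v) e x *v outward_normal (Tp e) e) \<bullet> jump \<T> Tp Tm (piece w) e x)
     - (\<Sum>e\<in>faces \<T>. LINT x|face_measure e.
          (average \<T> Tp Tm (grad_piece w) e x *v outward_normal (Tp e) e) \<bullet> jump \<T> Tp Tm (piece v) e x)
     + \<rho>\<^sub>1 * (\<Sum>e\<in>faces \<T>. LINT x|face_measure e.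
          inverse (face_size e) * (jump \<T> Tp Tm (piece w) e x \<bullet> jump \<T> Tp Tm (piece v) e x))"

definition form_c ::
  "(real ^ 'n) set set \<Rightarrow> ((real ^ 'n) set \<Rightarrow> (real ^ 'n) set) \<Rightarrow> ((real ^ 'n) set \<Rightarrow> (real ^ 'n) set) \<Rightarrow>
   real \<Rightarrow> (real ^ 'n \<Rightarrow> real ^ 'n) \<Rightarrow> (real ^ 'n \<Rightarrow> real ^ 'n) \<Rightarrow> real" where
  "form_c \<T> Tp Tm \<rho>\<^sub>2 v w =
     (\<Sum>T\<in>\<T>. LINT x|lebesgue_on T. v x \<bullet> w x)
     + \<rho>\<^sub>2 * (\<Sum>e\<in>faces \<T>. LINT x|face_measure e.
          face_size e * (jump \<T> Tp Tm (piece w) e x \<bullet> jump \<T> Tp Tm (piece v) e x))"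

definition form_b ::
  "(real ^ 'n) set set \<Rightarrow> ((real ^ 'n) set \<Rightarrow> (real ^ 'n) set) \<Rightarrow> ((real ^ 'n) set \<Rightarrow> (real ^ 'n) set) \<Rightarrow>
   (real ^ 'n \<Rightarrow> real ^ 'n) \<Rightarrow> (real ^ 'n \<Rightarrow> real) \<Rightarrow> real" where
  "form_b \<T> Tp Tm w q =
     (\<Sum>T\<in>\<T>. LINT x|lebesgue_on T. div_piece w T x * q x)
     - (\<Sum>e\<in>faces \<T>. LINT x|face_measure e.
          (jump \<T> Tp Tm (piece w) e x \<bullet> outward_normal (Tp e) e) * average \<T> Tp Tm (piece q) e x)"

definition steg_solution ::
  "(real ^ 'n) set \<Rightarrow> (real ^ 'n) set set \<Rightarrow>
   ((real ^ 'n) set \<Rightarrow> (real ^ 'n) set) \<Rightarrow> ((real ^ 'n) set \<Rightarrow> (real ^ 'n) set) \<Rightarrow>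
   real \<Rightarrow> real \<Rightarrow> real \<Rightarrow> (real ^ 'n \<Rightarrow> real ^ 'n) \<Rightarrow>
   (real ^ 'n \<Rightarrow> real ^ 'n) \<Rightarrow> (real ^ 'n \<Rightarrow> real) \<Rightarrow> bool" where
  "steg_solution \<Omega> \<T> Tp Tm \<rho>\<^sub>1 \<rho>\<^sub>2 \<nu> f u p \<longleftrightarrow>
     u \<in> Vh \<Omega> \<T> \<and> p \<in> Qh \<Omega> \<T> \<and>
     (\<forall>v \<in> Vh \<Omega> \<T>. \<nu> * form_a \<T> Tp Tm \<rho>\<^sub>1 u v + form_c \<T> Tp Tm \<rho>\<^sub>2 u v - form_b \<T> Tp Tm v p
                     = (LINT x|lebesgue_on \<Omega>. f x \<bullet> v x)) \<and>
     (\<forall>q \<in> Qh \<Omega> \<T>. form_b \<T> Tp Tm u q = 0)"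

end

theory Submission
  imports Defs
begin

text \<open>
  The method is a linear saddle point problem on spaces which, modulo null sets, have finite dimension: a
  function in \<open>Vh\<close> or \<open>Qh\<close> is determined almost everywhere by one affine function on each element. So unique
  solvability reduces to injectivity (\<open>symmetric_form_Riesz\<close>): if \<open>\<nu> a(u, v) + c(u, v) = b(v, p)\<close> for all
  \<open>v\<close> and \<open>b(u, q) = 0\<close> for all \<open>q\<close>, then \<open>u\<close> and \<open>p\<close> vanish almost everywhere (\<open>saddle_point_injective\<close>).

  Velocity. With \<open>v = u\<close> and \<open>q = p\<close> the pressure drops out and \<open>\<nu> a(u, u) + c(u, u) = 0\<close>. As \<open>c(u, u)\<close>
  dominates the square of the \<open>L\<^sup>2\<close> norm, it is enough that \<open>a(u, u) \<ge> 0\<close> (\<open>form_a_nonneg\<close>). Young's inequality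
  moves the indefinite terms \<open>2 {\<nabla>u}n \<bullet> [u]\<close> into the penalty, up to the trace term
  \<open>|e| h\<^sub>e |\<nabla>u|\<^sup>2 / \<rho>\<^sub>1\<close>. The latter is controlled by the gradient on the adjacent elements because
  \<open>|e| h\<^sub>e \<le> d\<^sup>2 |\<sigma>| |T|\<close> for every facet \<open>e\<close> of \<open>T\<close> (\<open>facet_area_size_le\<close>). This is where \<open>\<rho>\<^sub>1\<close> has to be
  large, with a threshold that involves \<open>d\<close> and \<open>\<sigma>\<close> only.

  Pressure. Now \<open>b(v, p) = 0\<close> for all \<open>v\<close>, and the fields in \<open>Dh\<close> already force \<open>p\<close> to vanish. Let \<open>c\<^sub>T\<close> be the value of
  \<open>p\<close> on \<open>T\<close>. The cones from the barycenter over the facets of \<open>T\<close> all have the volume \<open>|T| / (d + 1)\<close>, so the field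
  equal to \<open>(c\<^sub>T / |T|) (x - x\<^sub>T)\<close> on \<open>T\<close> has flux \<open>c\<^sub>T d / (d + 1)\<close> through every facet of \<open>T\<close>, whatever the shape
  of \<open>T\<close>. For this field, \<open>b\<close> is a positive multiple of the sum of \<open>(c\<^sub>T - c\<^sub>S)\<^sup>2\<close> over the interior faces,
  with \<open>T\<close> and \<open>S\<close> the two adjacent elements (\<open>form_b_bubbles\<close>): the quadratic form of the Laplacian of the dual graph of the mesh. So \<open>c\<close> is constant on the
  components of that graph. The graph is connected, as \<open>\<Omega>\<close> is connected and cannot be disconnected by a set
  of codimension two (\<open>mesh_facet_connected\<close>). The constant is \<open>0\<close> since \<open>p\<close> has mean zero.

  The geometric input, \<open>d |T| = h |e|\<close> for the height \<open>h\<close> over \<open>e\<close> (\<open>simplex_volume\<close>), is obtained by comparing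
  two determinants which differ in a single row.
\<close>

section \<open>Volumes of linear images\<close>

text \<open>A wellordered copy of a finite index type. Lebesgue measure does not depend on the order of the coordinates, but
  row reduction of a matrix, and with it the determinant formula for the volume of a linear image, refers to one.\<close>

typedef (overloaded) ('n::finite) ordered_index = "{..<CARD('n)}"
  using zero_less_card_finite by blast

instance ordered_index :: (finite) finite
proof
  show "finite (UNIV :: 'a ordered_index set)"
    using type_definition.univ[OF type_definition_ordered_index] by (metis finite_imageI finite_lessThan)
qed

instantiation ordered_index :: (finite) wellorder
begin

definition less_eq_ordered_index :: "'a ordered_index \<Rightarrow> 'a ordered_index \<Rightarrow> bool" where
  "i \<le> j \<longleftrightarrow> Rep_ordered_index i \<le> Rep_ordered_index j"

definition less_ordered_index :: "'a ordered_index \<Rightarrow> 'a ordered_index \<Rightarrow> bool" where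
  "i < j \<longleftrightarrow> Rep_ordered_index i < Rep_ordered_index j"

instance
proof
  fix P :: "'a ordered_index \<Rightarrow> bool" and a
  assume *: "\<And>x. (\<And>y. y < x \<Longrightarrow> P y) \<Longrightarrow> P x"
  show "P a"
    by (induction a rule: measure_induct_rule[of Rep_ordered_index]) (auto intro: * simp: less_ordered_index_def)
qed (auto simp: less_eq_ordered_index_def less_ordered_index_def Rep_ordered_index_inject)

end

lemma card_ordered_index: "CARD('n::finite ordered_index) = CARD('n)"
  by (metis card_lessThan type_definition.card[OF type_definition_ordered_index])

definition index_of :: "'n::finite \<Rightarrow> 'n ordered_index" where
  "index_of = (SOME g. bij g)"

lemma bij_index_of: "bij (index_of :: 'n::finite \<Rightarrow> 'n ordered_index)"
proof -
  have "\<exists>g :: 'n \<Rightarrow> 'n ordered_index. bij g"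
    using finite_same_card_bij[of "UNIV :: 'n set" "UNIV :: 'n ordered_index set"]
    by (simp add: card_ordered_index)
  then show ?thesis
    unfolding index_of_def by (rule someI_ex)
qed

definition relabel :: "real ^ 'n ordered_index \<Rightarrow> real ^ 'n" where
  "relabel x = (\<chi> i. x $ index_of i)"

definition unlabel :: "real ^ 'n \<Rightarrow> real ^ 'n ordered_index" where
  "unlabel y = (\<chi> j. y $ inv index_of j)"

lemma relabel_unlabel [simp]: "relabel (unlabel y) = y"
  by (simp add: relabel_def unlabel_def vec_eq_iff bij_is_inj[OF bij_index_of])

lemma unlabel_relabel [simp]: "unlabel (relabel x) = x"
  by (simp add: relabel_def unlabel_def vec_eq_iff surj_f_inv_f[OF bij_is_surj[OF bij_index_of]])

lemma linear_relabel: "linear relabel" and linear_unlabel: "linear unlabel"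
  by (auto intro!: linearI simp: relabel_def unlabel_def vec_eq_iff)

text \<open>Both measures assign to a box the product of its side lengths.\<close>

lemma lborel_eq_distr_relabel: "lborel = distr lborel borel (relabel :: _ \<Rightarrow> real ^ 'n)"
proof (rule lborel_eqI)
  have [measurable]: "relabel \<in> borel_measurable borel"
    by (intro borel_measurable_continuous_onI linear_continuous_on linear_conv_bounded_linear[THEN iffD1] linear_relabel)
  fix l u :: "real ^ 'n"
  assume lu: "\<And>b. b \<in> Basis \<Longrightarrow> l \<bullet> b \<le> u \<bullet> b"
  then have lu': "l $ i \<le> u $ i" for i
    by (metis axis_in_Basis_iff cart_eq_inner_axis Basis_real_def insertI1)
  have vimage: "relabel -` box l u = box (unlabel l) (unlabel u)"
  proof -
    have "(\<forall>i. l $ i < x $ index_of i \<and> x $ index_of i < u $ i) \<longleftrightarrow>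
          (\<forall>j. l $ inv index_of j < x $ j \<and> x $ j < u $ inv index_of j)" for x :: "real ^ 'n ordered_index"
      using bij_index_of[where 'n='n] by (metis bij_inv_eq_iff)
    then show ?thesis
      by (auto simp: mem_box_cart relabel_def unlabel_def)
  qed
  have "emeasure (distr lborel borel relabel) (box l u) = emeasure lborel (box (unlabel l) (unlabel u))"
    by (subst emeasure_distr) (auto simp: vimage)
  also have "\<dots> = ennreal (\<Prod>b\<in>Basis. (unlabel u - unlabel l) \<bullet> b)"
    using lu' by (subst emeasure_lborel_box) (auto simp: unlabel_def Basis_vec_def inner_axis)
  also have "(\<Prod>b\<in>Basis. (unlabel u - unlabel l) \<bullet> b) = (\<Prod>j\<in>UNIV. (u - l) $ inv index_of j)"
    unfolding Basis_vec_def
    by (subst prod.UNION_disjoint) (auto simp: unlabel_def inner_axis axis_eq_axis)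
  also have "\<dots> = (\<Prod>i\<in>UNIV. (u - l) $ i)"
    by (rule prod.reindex_bij_betw[OF bij_betw_inv_into]) (rule bij_index_of)
  also have "\<dots> = (\<Prod>b\<in>Basis. (u - l) \<bullet> b)"
    unfolding Basis_vec_def
    by (subst prod.UNION_disjoint) (auto simp: inner_axis axis_eq_axis)
  finally show "emeasure (distr lborel borel relabel) (box l u) = ennreal (\<Prod>b\<in>Basis. (u - l) \<bullet> b)" .
qed simp

lemma compact_linear_image: "linear (f :: 'a::euclidean_space \<Rightarrow> 'b::euclidean_space) \<Longrightarrow> compact A \<Longrightarrow> compact (f ` A)"
  by (intro compact_continuous_image linear_continuous_on) (auto simp: linear_conv_bounded_linear)

lemma measure_relabel:
  assumes "compact (A :: (real ^ 'n::finite ordered_index) set)"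
  shows "measure lebesgue (relabel ` A) = measure lebesgue A"
proof -
  have [measurable]: "relabel \<in> borel_measurable (borel :: (real ^ 'n::finite ordered_index) measure)"
    by (intro borel_measurable_continuous_onI linear_continuous_on linear_conv_bounded_linear[THEN iffD1] linear_relabel)
  have c: "compact (relabel ` A)"
    by (rule compact_linear_image[OF linear_relabel assms])
  then have "measure lebesgue (relabel ` A) = measure lborel (relabel ` A)"
    by (simp add: borel_compact measure_completion)
  also have "\<dots> = measure lborel (relabel -` relabel ` A)"
    using c by (subst lborel_eq_distr_relabel) (simp add: measure_distr borel_compact)
  also have "relabel -` relabel ` A = A"
    by (auto simp: image_iff) (metis unlabel_relabel)
  finally show ?thesis
    using assms by (simp add: borel_compact measure_completion)
qed

definition column_map :: "('n::finite ordered_index \<Rightarrow> real ^ 'n) \<Rightarrow> real ^ 'n ordered_index \<Rightarrow> real ^ 'n" where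
  "column_map w x = (\<Sum>j\<in>UNIV. (x $ j) *\<^sub>R w j)"

text \<open>The vectors \<open>w j\<close> are the columns of the map \<open>column_map w\<close> but the rows of this matrix, so that a change of a
  single vector is a row operation.\<close>

definition column_det :: "('n::finite ordered_index \<Rightarrow> real ^ 'n) \<Rightarrow> real" where
  "column_det w = det (\<chi> j. unlabel (w j))"

lemma linear_column_map: "linear (column_map w)"
  by (auto intro!: linearI simp: column_map_def algebra_simps sum.distrib scaleR_sum_right)

lemma column_map_axis [simp]: "column_map w (axis j 1) = w j"
proof -
  have "(\<Sum>i\<in>UNIV. (axis j 1 $ i) *\<^sub>R w i) = (\<Sum>i\<in>UNIV. if i = j then w i else 0)"
    by (intro sum.cong) (auto simp: axis_def)
  then show ?thesis
    by (simp add: column_map_def)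
qed

lemma measure_column_map:
  assumes "compact A"
  shows "measure lebesgue (column_map w ` A) = \<bar>column_det w\<bar> * measure lebesgue A"
proof -
  define g where "g = unlabel \<circ> column_map w"
  have lin: "linear g"
    unfolding g_def by (rule linear_compose[OF linear_column_map linear_unlabel])
  have "matrix g = transpose (\<chi> j. unlabel (w j))"
    by (simp add: matrix_def transpose_def g_def vec_eq_iff)
  then have det: "det (matrix g) = column_det w"
    by (simp add: column_det_def)
  have "column_map w ` A = relabel ` g ` A"
    by (auto simp: g_def image_image)
  then have "measure lebesgue (column_map w ` A) = measure lebesgue (g ` A)"
    using measure_relabel[OF compact_linear_image[OF lin assms]] by simp
  also have "\<dots> = \<bar>column_det w\<bar> * measure lebesgue A"
    using measure_linear_image[OF lin lmeasurable_compact[OF assms]] by (simp add: det)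
  finally show ?thesis .
qed

text \<open>A vector in the span of the other rows can be added to a row for free, and a scalar factors out of it.\<close>

lemma column_det_update:
  fixes w :: "'n::finite ordered_index \<Rightarrow> real ^ 'n"
  assumes "x \<in> span (w ` (UNIV - {k}))"
  shows "column_det (w(k := c *\<^sub>R n + x)) = c * column_det (w(k := n))"
proof -
  define A :: "real ^ 'n ordered_index ^ 'n ordered_index"
    where "A = (\<chi> j. if j = k then c *\<^sub>R unlabel n else unlabel (w j))"
  have row: "row j A = (if j = k then c *\<^sub>R unlabel n else unlabel (w j))" for j
    by (simp add: A_def row_def vec_eq_iff)
  have "unlabel x \<in> unlabel ` span (w ` (UNIV - {k}))"
    using assms by blast
  also have "\<dots> = span (unlabel ` w ` (UNIV - {k}))"
    by (rule linear_span_image[OF linear_unlabel, symmetric])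
  also have "unlabel ` w ` (UNIV - {k}) = {row j A | j. j \<noteq> k}"
    by (auto simp: row image_iff)
  finally have "unlabel x \<in> vec.span {row j A | j. j \<noteq> k}"
    by (simp add: span_vec_eq)
  from det_row_span[OF this]
  have "det (\<chi> j. if j = k then row k A + unlabel x else row j A) = det A" .
  moreover have "(\<chi> j. if j = k then row k A + unlabel x else row j A) =
     (\<chi> j. unlabel ((w(k := c *\<^sub>R n + x)) j))"
    by (simp add: row vec_eq_iff linear_add[OF linear_unlabel] linear_scale[OF linear_unlabel])
  moreover have "det A = c * det (\<chi> j. if j = k then unlabel n else unlabel (w j))"
    using det_row_mul[of k c "\<lambda>_. unlabel n" "\<lambda>j. unlabel (w j)"]
    unfolding A_def scalar_mult_eq_scaleR .
  moreover have "(\<chi> j. if j = k then unlabel n else unlabel (w j)) = (\<chi> j. unlabel ((w(k := n)) j))"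
    by (simp add: vec_eq_iff)
  ultimately show ?thesis
    by (simp add: column_det_def)
qed

text \<open>A crude form of Hadamard's inequality: in the Leibniz formula every entry is at most the norm of its row.\<close>

lemma abs_column_det_le:
  fixes w :: "'n::finite ordered_index \<Rightarrow> real ^ 'n"
  shows "\<bar>column_det w\<bar> \<le> fact CARD('n) * (\<Prod>j\<in>UNIV. norm (w j))"
proof -
  let ?A = "\<chi> j. unlabel (w j)"
  let ?P = "{p. p permutes (UNIV :: 'n ordered_index set)}"
  have entry: "\<bar>?A $ j $ i\<bar> \<le> norm (w j)" for i j
    by (simp add: unlabel_def component_le_norm_cart)
  have "\<bar>column_det w\<bar> \<le> (\<Sum>p\<in>?P. \<bar>of_int (sign p) * (\<Prod>j\<in>UNIV. ?A $ j $ p j)\<bar>)"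
    unfolding column_det_def det_def by (rule sum_abs)
  also have "\<dots> \<le> (\<Sum>p\<in>?P. (\<Prod>j\<in>UNIV. norm (w j)))"
  proof (rule sum_mono)
    fix p :: "'n ordered_index \<Rightarrow> 'n ordered_index"
    have "\<bar>of_int (sign p) * (\<Prod>j\<in>UNIV. ?A $ j $ p j)\<bar> = (\<Prod>j\<in>UNIV. \<bar>?A $ j $ p j\<bar>)"
      by (simp add: abs_mult abs_prod sign_def)
    also have "\<dots> \<le> (\<Prod>j\<in>UNIV. norm (w j))"
      by (intro prod_mono) (use entry in auto)
    finally show "\<bar>of_int (sign p) * (\<Prod>j\<in>UNIV. ?A $ j $ p j)\<bar> \<le> (\<Prod>j\<in>UNIV. norm (w j))" .
  qed
  also have "\<dots> = fact CARD('n) * (\<Prod>j\<in>UNIV. norm (w j))"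
    using card_permutations[of "UNIV :: 'n ordered_index set", OF refl] by (simp add: card_ordered_index)
  finally show ?thesis .
qed

section \<open>The standard simplex and the prism over its facet\<close>

definition std_simplex :: "(real ^ 'n) set" where
  "std_simplex = convex hull (insert 0 Basis)"

text \<open>The counterpart of \<open>face_prism\<close> for the standard simplex: thickness \<open>1\<close> over the facet opposite to the vertex
  \<open>axis k 1\<close>.\<close>

definition std_prism :: "'n \<Rightarrow> (real ^ 'n) set" where
  "std_prism k = {x + t *\<^sub>R axis k 1 | x t. x \<in> convex hull (insert 0 (Basis - {axis k 1})) \<and> \<bar>t\<bar> \<le> 1 / 2}"

lemma compact_std_simplex: "compact (std_simplex :: (real ^ 'n) set)"
  by (simp add: std_simplex_def finite_imp_compact_convex_hull)

lemma measure_std_simplex: "measure lebesgue (std_simplex :: (real ^ 'n) set) = 1 / fact CARD('n)"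
  using content_std_simplex[where 'a="real ^ 'n"] compact_std_simplex[where 'n='n]
  by (simp add: std_simplex_def borel_compact del: content_std_simplex)

lemma compact_std_prism: "compact (std_prism k)"
proof -
  have "std_prism k = (\<lambda>(x, t). x + t *\<^sub>R axis k 1) ` ((convex hull (insert 0 (Basis - {axis k 1}))) \<times> cball 0 (1 / 2))"
    (is "_ = ?g ` ?D")
  proof (intro set_eqI iffI)
    fix y assume "y \<in> std_prism k"
    then obtain x t where "y = x + t *\<^sub>R axis k 1" "x \<in> convex hull (insert 0 (Basis - {axis k 1}))" "\<bar>t\<bar> \<le> 1 / 2"
      unfolding std_prism_def by blast
    then have "y = ?g (x, t)" "(x, t) \<in> ?D"
      by (simp_all add: dist_norm)
    then show "y \<in> ?g ` ?D"
      by blast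
  qed (auto simp: std_prism_def, blast)
  also have "compact \<dots>"
    by (intro compact_continuous_image compact_Times finite_imp_compact_convex_hull)
      (auto intro!: continuous_intros simp: case_prod_unfold)
  finally show ?thesis .
qed

lemma mem_std_prism:
  fixes x :: "real ^ 'n"
  shows "x \<in> std_prism k \<longleftrightarrow> \<bar>x \<bullet> axis k 1\<bar> \<le> 1 / 2 \<and> (\<forall>b\<in>Basis - {axis k 1}. 0 \<le> x \<bullet> b) \<and> (\<Sum>b\<in>Basis - {axis k 1}. x \<bullet> b) \<le> 1"
    (is "_ \<longleftrightarrow> ?R x")
proof -
  let ?a = "axis k 1 :: real ^ 'n"
  have a: "?a \<in> Basis" "?a \<bullet> ?a = 1" "\<And>b. b \<in> Basis \<Longrightarrow> b \<noteq> ?a \<Longrightarrow> ?a \<bullet> b = 0"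
    by (auto simp: inner_Basis)
  have hull: "convex hull (insert 0 (Basis - {?a})) =
    {x. (\<forall>i\<in>Basis. 0 \<le> x\<bullet>i) \<and> (\<Sum>i\<in>Basis - {?a}. x\<bullet>i) \<le> 1 \<and> x \<bullet> ?a = 0}"
    using a(1) by (subst substd_simplex) auto
  show ?thesis
  proof
    assume "x \<in> std_prism k"
    then obtain y t where y: "y \<in> convex hull (insert 0 (Basis - {?a}))" "\<bar>t\<bar> \<le> 1 / 2" "x = y + t *\<^sub>R ?a"
      by (auto simp: std_prism_def)
    have "x \<bullet> b = y \<bullet> b" if "b \<in> Basis - {?a}" for b
      using that a by (simp add: y(3) inner_left_distrib)
    moreover have "x \<bullet> ?a = t"
      using y a by (simp add: hull inner_left_distrib)
    ultimately show "?R x"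
      using y by (simp add: hull)
  next
    assume R: "?R x"
    define y where "y = x - (x \<bullet> ?a) *\<^sub>R ?a"
    have "y \<bullet> b = x \<bullet> b" if "b \<in> Basis - {?a}" for b
      using that a by (simp add: y_def inner_diff_left)
    moreover have "y \<bullet> ?a = 0"
      using a by (simp add: y_def inner_diff_left)
    ultimately have "y \<in> convex hull (insert 0 (Basis - {?a}))"
      using R unfolding hull by (smt (verit, best) Diff_iff mem_Collect_eq singletonD sum.cong)
    moreover have "x = y + (x \<bullet> ?a) *\<^sub>R ?a"
      by (simp add: y_def)
    ultimately show "x \<in> std_prism k"
      using R unfolding std_prism_def by blast
  qed
qed

text \<open>By Fubini: an interval of length \<open>1\<close> times the standard simplex in one dimension less.\<close>

lemma measure_std_prism: "measure lebesgue (std_prism k :: (real ^ 'n) set) = 1 / fact (CARD('n) - 1)"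
proof -
  let ?a = "axis k 1 :: real ^ 'n"
  let ?B = "Basis - {?a}"
  let ?M = "\<lambda>A :: (real ^ 'n) set. (\<Pi>\<^sub>M b\<in>A. (lborel :: real measure))"
  let ?Q = "{y :: real ^ 'n \<Rightarrow> real. \<bar>y ?a\<bar> \<le> 1 / 2 \<and> (\<forall>b\<in>?B. 0 \<le> y b) \<and> sum y ?B \<le> 1} \<inter> space (?M Basis)"
  let ?S = "{y :: real ^ 'n \<Rightarrow> real. (\<forall>b\<in>?B. 0 \<le> y b) \<and> sum y ?B \<le> 1} \<inter> space (?M ?B)"
  interpret product_sigma_finite "\<lambda>_ :: real ^ 'n. lborel :: real measure"
    by standard
  have a: "?a \<in> Basis" by simp
  then have Basis: "insert ?a ?B = Basis" by blast
  have card: "card ?B = CARD('n) - 1"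
    using a by (simp add: card_Diff_singleton)
  have sums [measurable]: "(\<lambda>y. sum y ?B) \<in> borel_measurable (?M ?B)" "(\<lambda>y. sum y ?B) \<in> borel_measurable (?M Basis)"
    by measurable
  have S [measurable]: "?S \<in> sets (?M ?B)"
  proof -
    have "?S = Pi\<^sub>E ?B (\<lambda>_. {0..}) \<inter> ((\<lambda>y. sum y ?B) -` {..1} \<inter> space (?M ?B))"
      by (auto simp: space_PiM)
    also have "\<dots> \<in> sets (?M ?B)" by measurable
    finally show ?thesis .
  qed
  have Q [measurable]: "?Q \<in> sets (?M Basis)"
  proof -
    have *: "(\<forall>b\<in>Basis. y b \<in> (if b = ?a then {-1/2..1/2} else {0..})) \<longleftrightarrow> \<bar>y ?a\<bar> \<le> 1 / 2 \<and> (\<forall>b\<in>?B. 0 \<le> y b)"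
      for y :: "real ^ 'n \<Rightarrow> real"
      by (subst Basis[symmetric]) (auto simp: abs_le_iff)
    have "?Q = Pi\<^sub>E Basis (\<lambda>b. if b = ?a then {-1/2..1/2} else {0..}) \<inter> ((\<lambda>y. sum y ?B) -` {..1} \<inter> space (?M Basis))"
      by (intro set_eqI) (simp only: Int_iff mem_Collect_eq vimage_eq space_PiM PiE_iff space_lborel space_borel * atMost_iff, blast)
    also have "\<dots> \<in> sets (?M Basis)"
      by (intro sets.Int measurable_sets[OF sums(2)] sets_PiM_I_finite) auto
    finally show ?thesis .
  qed
  have "emeasure lborel (std_prism k) = emeasure (distr (?M Basis) borel (\<lambda>f. \<Sum>b\<in>Basis. f b *\<^sub>R b)) (std_prism k)"
    by (subst lborel_eq) simp
  also have "\<dots> = emeasure (?M Basis) ?Q"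
  proof (subst emeasure_distr)
    have "(\<Sum>b\<in>?B. (\<Sum>c\<in>Basis. f c *\<^sub>R c) \<bullet> b) = sum f ?B" for f
      by (rule sum.cong) auto
    moreover have "(\<Sum>c\<in>Basis. f c *\<^sub>R c) \<bullet> b = f b" if "b \<in> Basis" for f and b :: "real ^ 'n"
      using that by simp
    ultimately have "(\<lambda>f. \<Sum>b\<in>Basis. f b *\<^sub>R b) -` std_prism k \<inter> space (?M Basis) = ?Q"
      using a unfolding vimage_def mem_std_prism by simp
    then show "emeasure (?M Basis) ((\<lambda>f. \<Sum>b\<in>Basis. f b *\<^sub>R b) -` std_prism k \<inter> space (?M Basis)) = emeasure (?M Basis) ?Q"
      by simp
  qed (auto simp: borel_compact compact_std_prism)
  also have "\<dots> = (\<integral>\<^sup>+ y. indicator ?Q y \<partial>?M (insert ?a ?B))"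
    unfolding Basis using Q by (rule nn_integral_indicator[symmetric])
  also have "\<dots> = (\<integral>\<^sup>+ t. \<integral>\<^sup>+ y. indicator ?Q (y(?a := t)) \<partial>?M ?B \<partial>lborel)"
  proof (rule product_nn_integral_insert_rev)
    show "indicator ?Q \<in> borel_measurable (?M (insert ?a ?B))"
      unfolding Basis using Q by (rule borel_measurable_indicator)
  qed auto
  also have "\<dots> = (\<integral>\<^sup>+ t. \<integral>\<^sup>+ y. indicator {-1/2..1/2} t * indicator ?S y \<partial>?M ?B \<partial>(lborel :: real measure))"
  proof (intro nn_integral_cong)
    fix t :: real and y assume y: "y \<in> space (?M ?B)"
    have "sum (y(?a := t)) ?B = sum y ?B"
      by (intro sum.cong) auto
    then have "y(?a := t) \<in> ?Q \<longleftrightarrow> t \<in> {-1/2..1/2} \<and> y \<in> ?S"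
      using y a by (auto simp: space_PiM PiE_iff extensional_def abs_le_iff)
    then show "(indicator ?Q (y(?a := t)) :: ennreal) = indicator {-1/2..1/2} t * indicator ?S y"
      by (auto simp: indicator_def)
  qed
  also have "\<dots> = (\<integral>\<^sup>+ t. indicator {-1/2..1/2} t * emeasure (?M ?B) ?S \<partial>(lborel :: real measure))"
    by (intro nn_integral_cong) (simp only: nn_integral_cmult[OF borel_measurable_indicator[OF S]] nn_integral_indicator[OF S])
  also have "\<dots> = emeasure (?M ?B) ?S"
    by (subst nn_integral_multc) (auto)
  also have "\<dots> = ennreal (1 / fact (CARD('n) - 1))"
    using emeasure_std_simplex_aux[of ?B 1] card by simp
  finally show ?thesis
    by (simp add: measure_completion borel_compact compact_std_prism measure_def)
qed

section \<open>The geometry of a simplex and its facets\<close>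

lemma interior_full_simplex:
  assumes "int CARD('n) simplex (T :: (real ^ 'n) set)"
  shows "interior T \<noteq> {}"
proof -
  have "aff_dim T = CARD('n)"
    using aff_dim_simplex[OF assms] by simp
  then show ?thesis
    using aff_dim_eq_full[of T] rel_interior_interior[of T] rel_interior_eq_empty[OF convex_simplex[OF assms]]
      aff_dim_empty[of T] by auto
qed

lemma simplex_measure_pos:
  assumes T: "int CARD('n) simplex (T :: (real ^ 'n) set)"
  shows "measure lebesgue T > 0"
proof -
  have "\<not> negligible T"
    using negligible_convex_interior[OF convex_simplex[OF T]] interior_full_simplex[OF T] by simp
  then show ?thesis
    using lmeasurable_compact[OF compact_simplex[OF T]] negligible_iff_measure[of T]
    by (simp add: zero_less_measure_iff)
qed

text \<open>The orthogonal part of \<open>m\<close> with respect to \<open>n\<close> is a direction of the hyperplane spanned by \<open>e\<close>, hence orthogonal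
  to \<open>m\<close>; so \<open>m\<close> is a multiple of \<open>n\<close>.\<close>

lemma hyperplane_normal_unique:
  fixes n :: "'a::euclidean_space"
  assumes e: "e \<noteq> {}" "affine hull e = {x. x \<bullet> n = \<beta>}" and n: "norm n = 1"
    and m: "norm m = 1" "\<forall>x\<in>e. \<forall>y\<in>e. (y - x) \<bullet> m = 0"
  shows "m = n \<or> m = - n"
proof -
  obtain x0 where x0: "x0 \<in> e"
    using e by blast
  have nn: "n \<bullet> n = 1" "m \<bullet> m = 1"
    using n m by (simp_all add: dot_square_norm)
  have "e \<subseteq> {x. m \<bullet> x = m \<bullet> x0}"
    using m(2) x0 by (auto simp: inner_diff_left inner_diff_right inner_commute)
  then have sub: "affine hull e \<subseteq> {x. m \<bullet> x = m \<bullet> x0}"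
    by (intro hull_minimal affine_hyperplane)
  define c where "c = m \<bullet> n"
  have "x0 \<bullet> n = \<beta>"
    using e x0 hull_inc[of x0 e] by auto
  then have "x0 + (m - c *\<^sub>R n) \<in> affine hull e"
    using nn by (simp add: e(2) c_def inner_left_distrib inner_diff_left)
  then have "m \<bullet> (m - c *\<^sub>R n) = 0"
    using sub by (auto simp: inner_right_distrib)
  then have c2: "c * c = 1"
    using nn by (simp add: c_def inner_diff_right)
  have "(m - c *\<^sub>R n) \<bullet> (m - c *\<^sub>R n) = 0"
    using nn c2 by (simp add: c_def inner_diff_right inner_diff_left inner_commute)
  then have "m = c *\<^sub>R n"
    by simp
  moreover have "c = 1 \<or> c = -1"
    using c2 by (metis square_eq_1_iff)
  ultimately show ?thesis
    by auto
qed

lemma outward_normal_eqI: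
  assumes e: "e \<noteq> {}" "affine hull e = {x. x \<bullet> n = \<beta>}" and n: "norm n = 1"
    and T: "\<forall>y\<in>T. y \<bullet> n \<le> \<beta>" and u: "u \<in> T" "u \<bullet> n < \<beta>"
  shows "outward_normal T e = n"
  unfolding outward_normal_def
proof (rule the_equality)
  have const: "x \<bullet> n = \<beta>" if "x \<in> e" for x
    using that hull_inc[of x e] e(2) by auto
  show "norm n = 1 \<and> (\<forall>x\<in>e. \<forall>y\<in>e. (y - x) \<bullet> n = 0) \<and> (\<forall>x\<in>e. \<forall>y\<in>T. (y - x) \<bullet> n \<le> 0)"
    using const T n by (auto simp: inner_diff_left)
  fix m assume m: "norm m = 1 \<and> (\<forall>x\<in>e. \<forall>y\<in>e. (y - x) \<bullet> m = 0) \<and> (\<forall>x\<in>e. \<forall>y\<in>T. (y - x) \<bullet> m \<le> 0)"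
  then have "m = n \<or> m = - n"
    using hyperplane_normal_unique[OF e n] by blast
  moreover have "m \<noteq> - n"
  proof
    assume "m = - n"
    obtain x where "x \<in> e"
      using e by blast
    then have "(u - x) \<bullet> (- n) \<le> 0"
      using m u \<open>m = - n\<close> by blast
    then show False
      using const[OF \<open>x \<in> e\<close>] u by (simp add: inner_diff_left)
  qed
  ultimately show "m = n"
    by blast
qed

text \<open>A simplex with its vertex set \<open>C\<close>, and the facet opposite to the vertex \<open>u\<close>. The unit vector \<open>n\<close> is the normal
  pointing out of \<open>T\<close>, since \<open>u\<close> lies on its negative side, and \<open>h\<close> is the height of \<open>T\<close> over the facet. The linear
  functional \<open>x \<bullet> n\<close> thus takes one value at all vertices but \<open>u\<close>, which makes it easy to average and to bound.\<close>

definition vertex_facet ::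
  "(real ^ 'n) set \<Rightarrow> real ^ 'n \<Rightarrow> (real ^ 'n) set \<Rightarrow> (real ^ 'n) set \<Rightarrow> real ^ 'n \<Rightarrow> real \<Rightarrow> real \<Rightarrow> bool" where
  "vertex_facet C u T e n \<beta> h \<longleftrightarrow>
     \<not> affine_dependent C \<and> card C = CARD('n) + 1 \<and> T = convex hull C \<and> u \<in> C \<and>
     e = convex hull (C - {u}) \<and> norm n = 1 \<and> affine hull e = {x. x \<bullet> n = \<beta>} \<and> u \<bullet> n = \<beta> - h \<and> h > 0"

lemma vertex_facet_exists:
  assumes T: "int CARD('n) simplex (T :: (real ^ 'n) set)" and e: "e facet_of T"
  obtains C u n \<beta> h where "vertex_facet C u T e n \<beta> h"
proof -
  obtain C where C: "\<not> affine_dependent C" "int (card C) = int CARD('n) + 1" "T = convex hull C"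
    using T unfolding simplex_def by blast
  obtain u where u: "u \<in> C" "e = convex hull (C - {u})"
    using e C facet_of_convex_hull_affine_independent by blast
  have "aff_dim e = int CARD('n) - 1"
    using e aff_dim_simplex[OF T] by (simp add: facet_of_def)
  then obtain a b where a: "a \<noteq> 0" "affine hull e = {x. a \<bullet> x = b}"
    using aff_dim_eq_hyperplane[of e] by auto
  have "u \<notin> affine hull e"
    using C u unfolding u(2) affine_hull_convex_hull by (auto simp: affine_dependent_def)
  then have ne: "a \<bullet> u \<noteq> b"
    using a by auto
  \<comment> \<open>The sign that makes the normal point away from \<open>u\<close>.\<close>
  define s where "s = (if a \<bullet> u < b then 1 else -1 :: real)"
  have s: "s * s = 1" "s * (a \<bullet> u) < s * b" "s \<noteq> 0" "\<bar>s\<bar> = 1"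
    using ne by (auto simp: s_def)
  define n where "n = (s / norm a) *\<^sub>R a"
  have "vertex_facet C u T e n (s * b / norm a) (s * b / norm a - u \<bullet> n)"
    unfolding vertex_facet_def
  proof (intro conjI)
    show "norm n = 1"
      using a s by (simp add: n_def)
    show "affine hull e = {x. x \<bullet> n = s * b / norm a}"
      using a s by (auto simp: n_def inner_commute)
    show "s * b / norm a - u \<bullet> n > 0"
      using s a by (simp add: n_def inner_commute divide_strict_right_mono)
  qed (use C u in auto)
  then show thesis
    by (rule that)
qed

context
  fixes C u T e n \<beta> h
  assumes vf: "vertex_facet C u (T :: (real ^ 'n) set) e n \<beta> h"
begin

lemma vertex_facet_facts:
  "\<not> affine_dependent C" "card C = CARD('n) + 1" "T = convex hull C" "u \<in> C"
  "e = convex hull (C - {u})" "norm n = 1" "affine hull e = {x. x \<bullet> n = \<beta>}" "u \<bullet> n = \<beta> - h" "h > 0" "finite C"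
  using vf aff_independent_finite unfolding vertex_facet_def by blast+

lemma vertex_facet_nonempty: "e \<noteq> {}"
proof
  assume "e = {}"
  then have "C \<subseteq> {u}"
    using vertex_facet_facts by auto
  then have "card C \<le> 1"
    by (metis card_mono card.empty card_insert_disjoint empty_iff finite.emptyI finite_insert One_nat_def)
  then show False
    using vertex_facet_facts(2) by simp
qed

lemma vertex_facet_const: "x \<in> e \<Longrightarrow> x \<bullet> n = \<beta>"
  using vertex_facet_facts(7) hull_inc[of x e] by auto

lemma vertex_facet_vertex: "w \<in> C - {u} \<Longrightarrow> w \<bullet> n = \<beta>"
  using vertex_facet_const vertex_facet_facts(5) hull_inc by metis

lemma vertex_facet_slab: "T \<subseteq> {x. \<beta> - h \<le> x \<bullet> n \<and> x \<bullet> n \<le> \<beta>}"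
proof -
  have "convex ({x. n \<bullet> x \<ge> \<beta> - h} \<inter> {x. n \<bullet> x \<le> \<beta>})"
    by (intro convex_Int convex_halfspace_le convex_halfspace_ge)
  moreover have "C \<subseteq> {x. n \<bullet> x \<ge> \<beta> - h} \<inter> {x. n \<bullet> x \<le> \<beta>}"
  proof
    fix w assume "w \<in> C"
    then show "w \<in> {x. n \<bullet> x \<ge> \<beta> - h} \<inter> {x. n \<bullet> x \<le> \<beta>}"
      using vertex_facet_vertex[of w] vertex_facet_facts(8,9) by (cases "w = u") (auto simp: inner_commute)
  qed
  ultimately have "convex hull C \<subseteq> {x. n \<bullet> x \<ge> \<beta> - h} \<inter> {x. n \<bullet> x \<le> \<beta>}"
    by (rule hull_minimal[rotated])
  then show ?thesis
    using vertex_facet_facts(3) by (auto simp: inner_commute)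
qed

lemma vertex_facet_normal: "outward_normal T e = n"
proof (rule outward_normal_eqI[OF vertex_facet_nonempty vertex_facet_facts(7,6)])
  show "\<forall>y\<in>T. y \<bullet> n \<le> \<beta>"
    using vertex_facet_slab by auto
  show "u \<in> T" "u \<bullet> n < \<beta>"
    using vertex_facet_facts hull_inc by auto
qed

text \<open>All vertices but one are at height \<open>0\<close> over the facet, the last one is at height \<open>h\<close>.\<close>

lemma vertex_facet_barycenter:
  assumes "x \<in> e"
  shows "(x - barycenter T) \<bullet> n = h / (CARD('n) + 1)"
proof -
  have "{v. v extreme_point_of T} = C"
    using extreme_point_of_convex_hull_affine_independent[OF vertex_facet_facts(1)] vertex_facet_facts(3) by auto
  then have "barycenter T \<bullet> n = (\<Sum>v\<in>C. v \<bullet> n) / (real CARD('n) + 1)"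
    by (simp add: barycenter_def inner_sum_left)
  also have "(\<Sum>v\<in>C. v \<bullet> n) = u \<bullet> n + (\<Sum>v\<in>C - {u}. v \<bullet> n)"
    using vertex_facet_facts by (simp add: sum.remove)
  also have "(\<Sum>v\<in>C - {u}. v \<bullet> n) = CARD('n) * \<beta>"
    using vertex_facet_vertex vertex_facet_facts by simp
  also have "u \<bullet> n = \<beta> - h"
    by (rule vertex_facet_facts)
  finally show ?thesis
    using vertex_facet_const[OF assms] by (simp add: inner_diff_left field_simps)
qed

text \<open>The simplex lies in a slab of width \<open>h\<close>.\<close>

lemma inball_diameter_le_height: "inball_diameter T \<le> h"
  unfolding inball_diameter_def
proof (rule cSup_least)
  have "u \<in> T"
    using vertex_facet_facts hull_inc by auto
  then have "2 * 0 \<in> {2 * r |r. 0 \<le> r \<and> (\<exists>x. cball x r \<subseteq> T)}"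
    by (intro CollectI exI[of _ 0]) auto
  then show "{2 * r |r. 0 \<le> r \<and> (\<exists>x. cball x r \<subseteq> T)} \<noteq> {}"
    by blast
  fix s assume "s \<in> {2 * r |r. 0 \<le> r \<and> (\<exists>x. cball x r \<subseteq> T)}"
  then obtain r x where r: "s = 2 * r" "0 \<le> r" "cball x r \<subseteq> T"
    by blast
  have n: "norm n = 1" "n \<bullet> n = 1"
    using vertex_facet_facts(6) by (simp_all add: dot_square_norm)
  have "x + r *\<^sub>R n \<in> T" "x - r *\<^sub>R n \<in> T"
    using r n by (auto intro!: subsetD[OF r(3)] simp: dist_norm)
  then have "(x + r *\<^sub>R n) \<bullet> n \<le> \<beta>" "\<beta> - h \<le> (x - r *\<^sub>R n) \<bullet> n"
    using vertex_facet_slab by auto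
  then show "s \<le> h"
    using n r by (simp add: inner_diff_left inner_left_distrib)
qed

lemma vertex_facet_prism: "face_prism e = {y + t *\<^sub>R n | y t. y \<in> e \<and> \<bar>t\<bar> \<le> 1 / 2}"
proof -
  have n: "norm n = 1" "n \<bullet> n = 1"
    using vertex_facet_facts(6) by (simp_all add: dot_square_norm)
  have cp: "closest_point (affine hull e) x = x - (x \<bullet> n - \<beta>) *\<^sub>R n" for x
  proof (rule closest_point_unique[symmetric])
    show "x - (x \<bullet> n - \<beta>) *\<^sub>R n \<in> affine hull e"
      using n by (simp add: vertex_facet_facts(7) inner_diff_left)
    show "\<forall>z\<in>affine hull e. dist x (x - (x \<bullet> n - \<beta>) *\<^sub>R n) \<le> dist x z"
    proof
      fix z assume "z \<in> affine hull e"
      then have "x \<bullet> n - \<beta> = (x - z) \<bullet> n"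
        by (simp add: vertex_facet_facts(7) inner_diff_left)
      moreover have "\<bar>(x - z) \<bullet> n\<bar> \<le> norm (x - z) * norm n"
        by (rule Cauchy_Schwarz_ineq2)
      ultimately show "dist x (x - (x \<bullet> n - \<beta>) *\<^sub>R n) \<le> dist x z"
        using n by (simp add: dist_norm)
    qed
  qed (auto intro: affine_imp_convex)
  show ?thesis
  proof (intro set_eqI iffI)
    fix x assume "x \<in> face_prism e"
    then have "x - (x \<bullet> n - \<beta>) *\<^sub>R n \<in> e" "\<bar>x \<bullet> n - \<beta>\<bar> \<le> 1 / 2"
      using n by (auto simp: face_prism_def cp dist_norm)
    moreover have "x = (x - (x \<bullet> n - \<beta>) *\<^sub>R n) + (x \<bullet> n - \<beta>) *\<^sub>R n"
      by simp
    ultimately show "x \<in> {y + t *\<^sub>R n | y t. y \<in> e \<and> \<bar>t\<bar> \<le> 1 / 2}"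
      by blast
  next
    fix x assume "x \<in> {y + t *\<^sub>R n | y t. y \<in> e \<and> \<bar>t\<bar> \<le> 1 / 2}"
    then obtain y t where yt: "x = y + t *\<^sub>R n" "y \<in> e" "\<bar>t\<bar> \<le> 1 / 2"
      by blast
    then have "x \<bullet> n - \<beta> = t"
      using n vertex_facet_const by (simp add: inner_left_distrib)
    then show "x \<in> face_prism e"
      using yt n by (simp add: face_prism_def cp dist_norm)
  qed
qed

text \<open>Both the simplex and the prism over its facet are affine images of reference bodies, under
  maps that differ in a single column only: \<open>u - w0\<close> on the one hand, the unit normal on the other.
  Modulo the span of the other columns \<open>u - w0\<close> equals \<open>- h n\<close>.\<close>

lemma vertex_facet_volume_aux:
  obtains w w' and k :: "'n ordered_index" and w0 where
    "T = (+) w0 ` column_map w ` std_simplex"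
    "face_prism e = (+) w0 ` column_map w' ` std_prism k"
    "column_det w = - h * column_det w'"
    "w0 \<in> C" "\<forall>j. j \<noteq> k \<longrightarrow> w' j + w0 \<in> C" "w' k = n"
proof -
  have "C - {u} \<noteq> {}"
    using vertex_facet_nonempty vertex_facet_facts(5) by auto
  then obtain w0 where w0: "w0 \<in> C" "w0 \<noteq> u"
    by blast
  have "card (C - {w0}) = CARD('n ordered_index)"
    using w0 vertex_facet_facts by (simp add: card_ordered_index)
  then obtain g :: "'n ordered_index \<Rightarrow> real ^ 'n" where g: "bij_betw g UNIV (C - {w0})"
    using finite_same_card_bij[of "UNIV :: 'n ordered_index set" "C - {w0}"] vertex_facet_facts by auto
  then have g_range: "range g = C - {w0}" and g_inj: "inj g"
    by (auto simp: bij_betw_def)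
  then obtain k where k: "g k = u"
    using w0 vertex_facet_facts by (metis Diff_iff imageE singletonD)
  define w where "w = (\<lambda>j. g j - w0)"
  define w' where "w' = w(k := n)"
  have Basis: "Basis = range (\<lambda>j :: 'n ordered_index. axis j (1::real))"
    by (auto simp: Basis_vec_def)
  show thesis
  proof (rule that)
    have "(+) w0 ` column_map w ` insert 0 Basis = C"
    proof -
      have "(+) w0 ` column_map w ` insert 0 Basis = insert w0 (range g)"
        by (auto simp: Basis image_image w_def linear_0[OF linear_column_map])
      then show ?thesis
        using g_range w0 by auto
    qed
    then show "T = (+) w0 ` column_map w ` std_simplex"
      unfolding std_simplex_def vertex_facet_facts(3) convex_hull_linear_image[OF linear_column_map]
        convex_hull_translation[symmetric] by simp
    have "(+) w0 ` column_map w' ` insert 0 (Basis - {axis k 1}) = C - {u}"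
    proof -
      have "Basis - {axis k 1} = (\<lambda>j :: 'n ordered_index. axis j (1::real)) ` (UNIV - {k})"
        by (auto simp: Basis axis_eq_axis)
      then have "(+) w0 ` column_map w' ` insert 0 (Basis - {axis k 1}) = insert w0 (g ` (UNIV - {k}))"
        by (auto simp: image_image w_def w'_def linear_0[OF linear_column_map])
      also have "g ` (UNIV - {k}) = C - {w0} - {u}"
        using g_range g_inj k by (auto simp: image_set_diff)
      finally show ?thesis
        using w0 by auto
    qed
    then have e: "e = (+) w0 ` column_map w' ` (convex hull (insert 0 (Basis - {axis k 1})))"
      unfolding vertex_facet_facts(5) convex_hull_linear_image[OF linear_column_map]
        convex_hull_translation[symmetric] by simp
    have shift: "w0 + column_map w' (x + t *\<^sub>R axis k 1) = (w0 + column_map w' x) + t *\<^sub>R n" for x t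
      by (simp add: linear_add[OF linear_column_map] linear_scale[OF linear_column_map] w'_def)
    show "face_prism e = (+) w0 ` column_map w' ` std_prism k"
    proof (intro set_eqI iffI)
      fix x assume "x \<in> face_prism e"
      then obtain y t where "x = (w0 + column_map w' y) + t *\<^sub>R n" "y \<in> convex hull (insert 0 (Basis - {axis k 1}))" "\<bar>t\<bar> \<le> 1 / 2"
        unfolding vertex_facet_prism by (auto simp: e)
      then show "x \<in> (+) w0 ` column_map w' ` std_prism k"
        unfolding shift[symmetric] std_prism_def by blast
    next
      fix x assume "x \<in> (+) w0 ` column_map w' ` std_prism k"
      then obtain y t where "x = w0 + column_map w' (y + t *\<^sub>R axis k 1)" "y \<in> convex hull (insert 0 (Basis - {axis k 1}))" "\<bar>t\<bar> \<le> 1 / 2"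
        unfolding std_prism_def by blast
      then have "x = (w0 + column_map w' y) + t *\<^sub>R n" "w0 + column_map w' y \<in> e" "\<bar>t\<bar> \<le> 1 / 2"
        by (auto simp: shift e)
      then show "x \<in> face_prism e"
        unfolding vertex_facet_prism by blast
    qed
    have "u + h *\<^sub>R n \<in> affine hull e"
      using vertex_facet_facts(6,8) by (simp add: vertex_facet_facts(7) inner_left_distrib dot_square_norm)
    then have "u + h *\<^sub>R n \<in> affine hull (C - {u})"
      by (simp add: vertex_facet_facts(5) affine_hull_convex_hull)
    then obtain v where v: "u + h *\<^sub>R n = w0 + v" "v \<in> span {x - w0 |x. x \<in> (C - {u}) - {w0}}"
      using affine_hull_span[of w0 "C - {u}"] w0 by auto
    have "(C - {u}) - {w0} = g ` (UNIV - {k})"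
      using g_range g_inj k by (auto simp: image_set_diff)
    then have "{x - w0 |x. x \<in> (C - {u}) - {w0}} = w ` (UNIV - {k})"
      by (auto simp: w_def)
    then have span: "v \<in> span (w ` (UNIV - {k}))"
      using v by simp
    have "w k = (- h) *\<^sub>R n + v"
      using v(1) by (simp add: w_def k algebra_simps)
    then have "w = w(k := (- h) *\<^sub>R n + v)"
      by (metis fun_upd_triv)
    then show "column_det w = - h * column_det w'"
      using column_det_update[OF span, of "- h" n] by (simp add: w'_def)
    show "\<forall>j. j \<noteq> k \<longrightarrow> w' j + w0 \<in> C"
      using g_range by (auto simp: w'_def w_def)
  qed (use w0 in \<open>auto simp: w'_def\<close>)
qed

lemma compact_face_prism: "compact (face_prism e)"
proof -
  obtain w w' and k :: "'n ordered_index" and w0 where "face_prism e = (+) w0 ` column_map w' ` std_prism k"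
    using vertex_facet_volume_aux by metis
  then show ?thesis
    by (simp add: compact_translation compact_linear_image[OF linear_column_map] compact_std_prism)
qed

text \<open>The ratio of the volumes of the reference bodies is \<open>1 / d\<close>, that of the determinants is \<open>h\<close>.\<close>

lemma simplex_volume: "CARD('n) * measure lebesgue T = h * measure lebesgue (face_prism e)"
proof -
  obtain w w' and k :: "'n ordered_index" and w0 where *:
    "T = (+) w0 ` column_map w ` std_simplex" "face_prism e = (+) w0 ` column_map w' ` std_prism k"
    "column_det w = - h * column_det w'"
    using vertex_facet_volume_aux by metis
  have T: "measure lebesgue T = \<bar>column_det w\<bar> / fact CARD('n)"
    by (simp add: *(1) measure_translation measure_column_map compact_std_simplex measure_std_simplex card_ordered_index)
  have P: "measure lebesgue (face_prism e) = \<bar>column_det w'\<bar> / fact (CARD('n) - 1)"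
    by (simp add: *(2) measure_translation measure_column_map compact_std_prism measure_std_prism card_ordered_index)
  have "fact CARD('n) = real CARD('n) * fact (CARD('n) - 1)"
    by (simp add: fact_reduce)
  then show ?thesis
    using vertex_facet_facts(9) by (simp add: T P *(3) abs_mult)
qed

text \<open>The prism is spanned by edges of \<open>T\<close> and one unit vector.\<close>

lemma face_prism_measure_le: "measure lebesgue (face_prism e) \<le> CARD('n) * diameter T ^ (CARD('n) - 1)"
proof -
  obtain w w' and k :: "'n ordered_index" and w0 where *:
    "face_prism e = (+) w0 ` column_map w' ` std_prism k" "w0 \<in> C" "\<forall>j. j \<noteq> k \<longrightarrow> w' j + w0 \<in> C" "w' k = n"
    using vertex_facet_volume_aux by metis
  have P: "measure lebesgue (face_prism e) = \<bar>column_det w'\<bar> / fact (CARD('n) - 1)"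
    by (simp add: *(1) measure_translation measure_column_map compact_std_prism measure_std_prism card_ordered_index)
  have bdd: "bounded T"
    using vertex_facet_facts by (simp add: finite_imp_bounded_convex_hull)
  have "norm (w' j) \<le> diameter T" if "j \<noteq> k" for j
  proof -
    have "dist (w' j + w0) w0 \<le> diameter T"
      using * that vertex_facet_facts(3) by (intro diameter_bounded_bound[OF bdd]) (auto intro: hull_inc)
    then show ?thesis
      by (simp add: dist_norm)
  qed
  then have "(\<Prod>j\<in>UNIV - {k}. norm (w' j)) \<le> (\<Prod>j\<in>UNIV - {k}. diameter T)"
    by (intro prod_mono) auto
  moreover have "(\<Prod>j\<in>UNIV. norm (w' j)) = norm (w' k) * (\<Prod>j\<in>UNIV - {k}. norm (w' j))"
    by (rule prod.remove) auto
  ultimately have "(\<Prod>j\<in>UNIV. norm (w' j)) \<le> diameter T ^ (CARD('n) - 1)"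
    using vertex_facet_facts(6) by (simp add: *(4) card_Diff_singleton card_ordered_index)
  then have "\<bar>column_det w'\<bar> \<le> fact CARD('n) * diameter T ^ (CARD('n) - 1)"
    using abs_column_det_le[of w'] by (meson order_trans mult_left_mono fact_ge_zero)
  moreover have "fact CARD('n) = real CARD('n) * fact (CARD('n) - 1)"
    by (simp add: fact_reduce)
  ultimately show ?thesis
    by (simp add: P divide_le_eq mult_ac)
qed

end

section \<open>Integration over facets\<close>

lemma vertex_facet_area:
  assumes "vertex_facet C u (T :: (real ^ 'n) set) e n \<beta> h"
  shows "measure (face_measure e) UNIV = measure lebesgue (face_prism e)"
    and "finite_measure (face_measure e)"
    and "AE x in face_measure e. x \<in> e"
proof -
  have P: "face_prism e \<in> sets lebesgue"
    using lmeasurable_compact[OF compact_face_prism[OF assms]] by (rule fmeasurableD)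
  have ae: "affine hull e \<noteq> {}"
    using vertex_facet_nonempty[OF assms] by simp
  have cp [measurable]: "closest_point (affine hull e) \<in> borel_measurable (lebesgue_on (face_prism e))"
    by (intro continuous_imp_measurable_on_sets_lebesgue continuous_on_closest_point P)
      (use ae in \<open>auto intro: affine_imp_convex\<close>)
  have em: "emeasure (face_measure e) UNIV = emeasure lebesgue (face_prism e)"
    unfolding face_measure_def using P
    by (subst emeasure_distr) (auto simp: emeasure_restrict_space)
  then show "measure (face_measure e) UNIV = measure lebesgue (face_prism e)"
    by (simp add: measure_def)
  have "emeasure lebesgue (face_prism e) < \<infinity>"
    using lmeasurable_compact[OF compact_face_prism[OF assms]] by (auto dest: fmeasurableD2 simp: less_top simp del: emeasure_completion)
  then show "finite_measure (face_measure e)"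
    using em by (intro finite_measureI) (simp add: face_measure_def)
  have "closed e"
    using vertex_facet_facts(5,10)[OF assms] by (simp add: compact_imp_closed finite_imp_compact_convex_hull)
  then show "AE x in face_measure e. x \<in> e"
    unfolding face_measure_def
    by (subst AE_distr_iff[OF cp]) (auto simp: face_prism_def intro!: AE_I2)
qed

context
  fixes T e :: "(real ^ 'n) set"
  assumes T: "int CARD('n) simplex T" and e: "e facet_of T"
begin

lemma facet_compact: "compact e"
proof -
  obtain C u n \<beta> h where vf: "vertex_facet C u T e n \<beta> h"
    using vertex_facet_exists[OF T e] .
  then show ?thesis
    using vertex_facet_facts(5,10)[OF vf] by (simp add: finite_imp_compact_convex_hull)
qed

lemma facet_AE: "AE x in face_measure e. x \<in> e"
  and facet_finite_measure: "finite_measure (face_measure e)"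
proof -
  obtain C u n \<beta> h where vf: "vertex_facet C u T e n \<beta> h"
    using vertex_facet_exists[OF T e] .
  show "AE x in face_measure e. x \<in> e" "finite_measure (face_measure e)"
    by (rule vertex_facet_area[OF vf])+
qed

lemma facet_integrable:
  fixes g :: "real ^ 'n \<Rightarrow> real"
  assumes "continuous_on UNIV g"
  shows "integrable (face_measure e) g"
proof -
  interpret finite_measure "face_measure e"
    by (rule facet_finite_measure)
  have "bounded (g ` e)"
    by (intro compact_imp_bounded compact_continuous_image facet_compact) (rule continuous_on_subset[OF assms], simp)
  then obtain B where "\<forall>x\<in>e. norm (g x) \<le> B"
    by (auto simp: bounded_iff)
  then have "AE x in face_measure e. norm (g x) \<le> B"
    using facet_AE by auto
  moreover have "g \<in> borel_measurable (face_measure e)"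
    using borel_measurable_continuous_onI[OF assms] by (simp add: face_measure_def)
  ultimately show ?thesis
    by (rule integrable_const_bound)
qed

lemma facet_normal_norm: "norm (outward_normal T e) = 1"
proof -
  obtain C u n \<beta> h where vf: "vertex_facet C u T e n \<beta> h"
    using vertex_facet_exists[OF T e] .
  show ?thesis
    using vertex_facet_facts(6)[OF vf] by (simp add: vertex_facet_normal[OF vf])
qed

lemma facet_area_pos: "measure (face_measure e) UNIV > 0"
proof -
  obtain C u n \<beta> h where vf: "vertex_facet C u T e n \<beta> h"
    using vertex_facet_exists[OF T e] .
  have "0 < h * measure lebesgue (face_prism e)"
    unfolding simplex_volume[OF vf, symmetric] using simplex_measure_pos[OF T] by simp
  then show ?thesis
    using vertex_facet_facts(9)[OF vf] by (simp add: vertex_facet_area(1)[OF vf] zero_less_mult_iff)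
qed

text \<open>The barycenter lies at the fraction \<open>1 / (d + 1)\<close> of the height over each facet, and the height times the area of
  the facet is \<open>d |T|\<close>; so all facets contribute the same amount to the flux of \<open>x - x\<^sub>T\<close> out of \<open>T\<close>.\<close>

lemma facet_flux:
  assumes "x \<in> e"
  shows "measure (face_measure e) UNIV * ((x - barycenter T) \<bullet> outward_normal T e) =
    CARD('n) / (CARD('n) + 1) * measure lebesgue T"
proof -
  obtain C u n \<beta> h where vf: "vertex_facet C u T e n \<beta> h"
    using vertex_facet_exists[OF T e] .
  have "h * measure lebesgue (face_prism e) = CARD('n) * measure lebesgue T"
    by (rule simplex_volume[OF vf, symmetric])
  then show ?thesis
    unfolding vertex_facet_normal[OF vf] vertex_facet_area(1)[OF vf] vertex_facet_barycenter[OF vf assms]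
    by (simp add: mult_ac)
qed

text \<open>The discrete trace inequality for constants. Since \<open>h |e| = d |T|\<close>, it asks for \<open>h\<^sub>e\<close> to be bounded by the height
  \<open>h\<close>. The size \<open>h\<^sub>e\<close> is at most \<open>d\<close> times the diameter of \<open>T\<close>, and by shape regularity the diameter is at most
  \<open>|\<sigma>|\<close> times that of an inscribed ball, which fits between \<open>e\<close> and the opposite vertex.\<close>

lemma facet_area_size_le:
  assumes d: "CARD('n) \<ge> 2" and reg: "diameter T \<le> \<sigma> * inball_diameter T"
  shows "measure (face_measure e) UNIV * face_size e \<le> (real CARD('n))\<^sup>2 * \<bar>\<sigma>\<bar> * measure lebesgue T"
proof -
  obtain C u n \<beta> h where vf: "vertex_facet C u T e n \<beta> h"
    using vertex_facet_exists[OF T e] .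
  let ?d = "CARD('n)" and ?D = "diameter T" and ?m = "measure lebesgue (face_prism e)"
  have D: "?D \<ge> 0"
    using compact_imp_bounded[OF compact_simplex[OF T]] by (rule diameter_ge_0)
  have h: "h > 0"
    using vertex_facet_facts(9)[OF vf] .
  have "0 \<le> inball_diameter T"
    unfolding inball_diameter_def
  proof (rule cSup_upper)
    have "u \<in> T"
      using vertex_facet_facts[OF vf] hull_inc by auto
    then show "0 \<in> {2 * r |r. 0 \<le> r \<and> (\<exists>x. cball x r \<subseteq> T)}"
      by (intro CollectI exI[of _ 0]) auto
    show "bdd_above {2 * r |r. 0 \<le> r \<and> (\<exists>x. cball x r \<subseteq> T)}"
    proof (rule bdd_aboveI)
      fix s assume "s \<in> {2 * r |r. 0 \<le> r \<and> (\<exists>x. cball x r \<subseteq> T)}"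
      then obtain r x where r: "s = 2 * r" "0 \<le> r" "cball x r \<subseteq> T"
        by blast
      have "diameter (cball x r) \<le> ?D"
        using r compact_imp_bounded[OF compact_simplex[OF T]] by (intro diameter_subset)
      then show "s \<le> ?D"
        using r by simp
    qed
  qed
  then have "\<sigma> * inball_diameter T \<le> \<bar>\<sigma>\<bar> * h"
    using inball_diameter_le_height[OF vf] by (intro mult_mono) auto
  with reg have Dh: "?D \<le> \<bar>\<sigma>\<bar> * h"
    by linarith
  have "face_size e = ?m powr (1 / (?d - 1))"
    using d by (simp add: face_size_def vertex_facet_area(1)[OF vf])
  also have "\<dots> \<le> ((?d * ?D) ^ (?d - 1)) powr (1 / (?d - 1))"
  proof (rule powr_mono2)
    have "real ?d ^ 1 \<le> real ?d ^ (?d - 1)"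
      using d by (intro power_increasing) auto
    then have "real ?d * ?D ^ (?d - 1) \<le> (?d * ?D) ^ (?d - 1)"
      using D by (simp add: power_mult_distrib mult_right_mono)
    then show "?m \<le> (?d * ?D) ^ (?d - 1)"
      using face_prism_measure_le[OF vf] by linarith
  qed (use d in auto)
  also have "\<dots> = ?d * ?D"
  proof (cases "?D = 0")
    case False
    then have "(?d * ?D) ^ (?d - 1) = (?d * ?D) powr real (?d - 1)"
      using D d by (subst powr_realpow) auto
    moreover have "real (?d - 1) * (1 / (?d - 1)) = 1"
      using d by simp
    ultimately show ?thesis
      using D by (simp add: powr_powr)
  qed (use d in \<open>simp add: power_0_left\<close>)
  finally have "face_size e \<le> ?d * (\<bar>\<sigma>\<bar> * h)"
    using mult_left_mono[OF Dh, of "real ?d"] by (meson of_nat_0_le_iff order_trans)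
  then have "?m * face_size e \<le> ?m * (?d * (\<bar>\<sigma>\<bar> * h))"
    by (intro mult_left_mono) auto
  also have "\<dots> = ?d * \<bar>\<sigma>\<bar> * (h * ?m)"
    by simp
  also have "\<dots> = (real ?d)\<^sup>2 * \<bar>\<sigma>\<bar> * measure lebesgue T"
    by (simp add: simplex_volume[OF vf, symmetric] power2_eq_square)
  finally show ?thesis
    by (simp add: vertex_facet_area(1)[OF vf])
qed

end

lemma simplex_facets:
  assumes T: "int CARD('n) simplex (T :: (real ^ 'n) set)"
  shows "finite {e. e facet_of T}" "card {e. e facet_of T} = CARD('n) + 1"
proof -
  obtain C where C: "\<not> affine_dependent C" "int (card C) = int CARD('n) + 1" "T = convex hull C"
    using T unfolding simplex_def by blast
  have fin: "finite C"
    using C aff_independent_finite by blast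
  have "{e. e facet_of T} = (\<lambda>u. convex hull (C - {u})) ` C"
  proof -
    have "2 \<le> card C"
      using C(2) zero_less_card_finite[where 'a='n] by linarith
    then show ?thesis
      by (auto simp: C(3) facet_of_convex_hull_affine_independent_alt[OF C(1)])
  qed
  moreover have "inj_on (\<lambda>u. convex hull (C - {u})) C"
  proof (rule inj_onI)
    fix u v assume uv: "u \<in> C" "v \<in> C" "convex hull (C - {u}) = convex hull (C - {v})"
    have "{x. x extreme_point_of (convex hull (C - {w}))} = C - {w}" for w
      using extreme_point_of_convex_hull_affine_independent[OF affine_independent_Diff[OF C(1)]] by auto
    with uv have "C - {u} = C - {v}"
      by metis
    with uv show "u = v"
      by blast
  qed
  ultimately show "finite {e. e facet_of T}" "card {e. e facet_of T} = CARD('n) + 1"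
    using fin C(2) by (simp_all add: card_image)
qed

section \<open>The dual graph of a mesh\<close>

text \<open>If \<open>T'\<close> met the interior of \<open>T\<close>, the common face would be all of \<open>T\<close>, and the elements would be equal. So some
  hyperplane separates them; it contains the common facet, and its normal is outward for one element and inward for
  the other.\<close>

lemma opposite_normals:
  fixes T T' :: "(real ^ 'n) set"
  assumes T: "int CARD('n) simplex T" and T': "int CARD('n) simplex T'" and ne: "T \<noteq> T'"
    and face: "(T \<inter> T') face_of T" "(T \<inter> T') face_of T'" and e: "e facet_of T" "e facet_of T'"
  shows "outward_normal T' e = - outward_normal T e"
proof -
  obtain C u n \<beta> h where vf: "vertex_facet C u T e n \<beta> h"
    using vertex_facet_exists[OF T e(1)] .
  obtain C' u' n' \<beta>' h' where vf': "vertex_facet C' u' T' e n' \<beta>' h'"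
    using vertex_facet_exists[OF T' e(2)] .
  note facts = vertex_facet_facts[OF vf] and facts' = vertex_facet_facts[OF vf']
  obtain x0 where x0: "x0 \<in> e"
    using vertex_facet_nonempty[OF vf] by blast
  have "T \<inter> T' \<noteq> T"
  proof
    assume "T \<inter> T' = T"
    then have "T face_of T'"
      using face by simp
    with ne have "aff_dim T < aff_dim T'"
      using face_of_aff_dim_lt convex_simplex[OF T'] by blast
    then show False
      using aff_dim_simplex[OF T] aff_dim_simplex[OF T'] by simp
  qed
  then have "(T \<inter> T') \<inter> interior T = {}"
    using face_of_disjoint_interior[OF face(1)] by blast
  then have disj: "interior T \<inter> T' = {}"
    using interior_subset by blast
  have "T' \<noteq> {}"
    using interior_full_simplex[OF T'] by auto
  from separating_hyperplane_sets[OF convex_interior[OF convex_simplex[OF T]] convex_simplex[OF T']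
      interior_full_simplex[OF T] this disj]
  obtain a b where a: "a \<noteq> 0" "\<forall>x\<in>interior T. a \<bullet> x \<le> b" "\<forall>x\<in>T'. a \<bullet> x \<ge> b"
    by blast
  have "closure (interior T) \<subseteq> {x. a \<bullet> x \<le> b}"
    using a(2) by (intro closure_minimal closed_halfspace_le) auto
  moreover have "closure (interior T) = T"
    using convex_closure_interior[OF convex_simplex[OF T] interior_full_simplex[OF T]] closed_simplex[OF T] by simp
  ultimately have aT: "\<forall>x\<in>T. a \<bullet> x \<le> b"
    by auto
  have sub: "e \<subseteq> T" "e \<subseteq> T'"
    using e facet_of_imp_subset by blast+
  then have ae: "\<forall>x\<in>e. a \<bullet> x = b"
    using aT a(3) by (meson order_antisym subsetD)
  define m where "m = a /\<^sub>R norm a"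
  have m: "norm m = 1" "\<forall>x\<in>e. \<forall>y\<in>e. (y - x) \<bullet> m = 0"
    using a ae by (simp_all add: m_def inner_diff_left inner_diff_right inner_commute)
  have mT: "x \<bullet> m \<le> x0 \<bullet> m" if "x \<in> T" for x
    using aT ae x0 that by (simp add: m_def inner_commute[of _ a] mult_left_mono)
  have mT': "x \<bullet> m \<ge> x0 \<bullet> m" if "x \<in> T'" for x
    using a(3) ae x0 that by (simp add: m_def inner_commute[of _ a] mult_left_mono)
  have u: "u \<in> T" "u' \<in> T'"
    using facts facts' hull_inc by auto
  have "m = n"
    using hyperplane_normal_unique[OF vertex_facet_nonempty[OF vf] facts(7,6) m] mT[OF u(1)] facts(8,9)
      vertex_facet_const[OF vf x0] by auto
  moreover have "m = - n'"
    using hyperplane_normal_unique[OF vertex_facet_nonempty[OF vf'] facts'(7,6) m] mT'[OF u(2)] facts'(8,9)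
      vertex_facet_const[OF vf' x0] by auto
  ultimately have "n' = - n"
    by (metis add.inverse_inverse)
  then show ?thesis
    by (simp add: vertex_facet_normal[OF vf] vertex_facet_normal[OF vf'])
qed

text \<open>Two points outside the sets are joined through a generic third point: the points hidden from one of them behind a
  set of codimension two lie in a set of codimension one.\<close>

lemma connected_ball_minus_codim2:
  fixes K :: "'i \<Rightarrow> 'a::euclidean_space set"
  assumes I: "finite I" and dim: "\<And>i. i \<in> I \<Longrightarrow> aff_dim (K i) \<le> int DIM('a) - 2"
  shows "connected (ball x r - (\<Union>i\<in>I. K i))"
proof (cases "r > 0")
  case True
  let ?S = "\<Union>i\<in>I. K i"
  have small: "negligible (\<Union>i\<in>I. affine hull (insert p (K i)))" for p
  proof (rule negligible_Union)
    fix A assume "A \<in> (\<lambda>i. affine hull (insert p (K i))) ` I"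
    then obtain i where i: "i \<in> I" "A = affine hull (insert p (K i))"
      by blast
    have "aff_dim A \<le> int DIM('a) - 1"
      using dim[OF i(1)] by (auto simp: i(2) aff_dim_insert)
    then have "interior A = {}"
      by (intro low_dim_interior) auto
    moreover have "convex A"
      by (simp add: i(2) affine_imp_convex)
    ultimately show "negligible A"
      by (simp add: negligible_convex_interior)
  qed (use I in auto)
  show ?thesis
  proof (rule connected_iff_connected_component[THEN iffD2], intro ballI)
    fix p q assume p: "p \<in> ball x r - ?S" and q: "q \<in> ball x r - ?S"
    let ?N = "(\<Union>i\<in>I. affine hull (insert p (K i))) \<union> (\<Union>i\<in>I. affine hull (insert q (K i)))"
    have "\<not> ball x r \<subseteq> ?N"
    proof
      assume "ball x r \<subseteq> ?N"
      then have "negligible (ball x r)"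
        by (rule negligible_subset[OF negligible_Un[OF small small]])
      then show False
        using open_not_negligible[OF open_ball, of x r] True by simp
    qed
    then obtain z where z: "z \<in> ball x r" "z \<notin> ?N"
      by blast
    have seg: "closed_segment c z \<subseteq> ball x r - ?S"
      if c: "c \<in> ball x r - ?S" "z \<notin> (\<Union>i\<in>I. affine hull (insert c (K i)))" for c
    proof
      fix s assume s: "s \<in> closed_segment c z"
      then have "s \<in> ball x r"
        using c z closed_segment_subset[OF _ _ convex_ball, of c x r z] by auto
      moreover have "s \<notin> K i" if i: "i \<in> I" for i
      proof
        assume sK: "s \<in> K i"
        obtain t where t: "0 \<le> t" "t \<le> 1" "s = (1 - t) *\<^sub>R c + t *\<^sub>R z"
          using s by (auto simp: in_segment)
        have "s \<noteq> c"
          using sK i c by auto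
        then have "t \<noteq> 0"
          using t by auto
        then have "z = (1 - 1 / t) *\<^sub>R c + (1 / t) *\<^sub>R s"
          by (simp add: t(3) scaleR_add_right scaleR_diff_left algebra_simps)
        moreover have "c \<in> affine hull (insert c (K i))" "s \<in> affine hull (insert c (K i))"
          using sK by (simp_all add: hull_inc)
        ultimately have "z \<in> affine hull (insert c (K i))"
          using mem_affine[OF affine_affine_hull, of c "insert c (K i)" s "1 - 1 / t" "1 / t"] by simp
        then show False
          using c(2) i by blast
      qed
      ultimately show "s \<in> ball x r - ?S"
        by blast
    qed
    have "connected (closed_segment p z \<union> closed_segment q z)"
      by (intro connected_Un connected_segment) auto
    moreover have "closed_segment p z \<union> closed_segment q z \<subseteq> ball x r - ?S"
      using seg[OF p] seg[OF q] z by blast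
    ultimately show "connected_component (ball x r - ?S) p q"
      unfolding connected_component_def by (intro exI[of _ "closed_segment p z \<union> closed_segment q z"]) auto
  qed
next
  case False
  then have "ball x r = {}"
    by simp
  then have "ball x r - (\<Union>i\<in>I. K i) = {}"
    by blast
  then show ?thesis
    by (metis connected_empty)
qed

lemma mesh_facts:
  fixes \<T> :: "(real ^ 'n) set set"
  assumes "mesh \<Omega> \<T>"
  shows "finite \<T>" "\<And>T. T \<in> \<T> \<Longrightarrow> int CARD('n) simplex T" "\<Union>\<T> = closure \<Omega>"
    "\<And>T T'. T \<in> \<T> \<Longrightarrow> T' \<in> \<T> \<Longrightarrow> (T \<inter> T') face_of T"
    "\<And>T T'. T \<in> \<T> \<Longrightarrow> T' \<in> \<T> \<Longrightarrow> (T \<inter> T') face_of T'"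
proof -
  have face: "(T \<inter> T') face_of T" if "T \<in> \<T>" "T' \<in> \<T>" for T T'
    using assms that by (simp add: mesh_def triangulation_def)
  show "\<And>T T'. T \<in> \<T> \<Longrightarrow> T' \<in> \<T> \<Longrightarrow> (T \<inter> T') face_of T'"
    using face by (subst Int_commute) simp
qed (use assms in \<open>auto simp: mesh_def triangulation_def\<close>)

lemma mesh_Int_aff_dim:
  fixes \<T> :: "(real ^ 'n) set set"
  assumes "mesh \<Omega> \<T>" "T \<in> \<T>" "T' \<in> \<T>" "T \<noteq> T'"
  shows "aff_dim (T \<inter> T') < int CARD('n)"
proof -
  have dims: "aff_dim T = int CARD('n)" "aff_dim T' = int CARD('n)"
    using mesh_facts(2)[OF assms(1)] assms aff_dim_simplex by auto
  have face: "(T \<inter> T') face_of T" "(T \<inter> T') face_of T'"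
    using mesh_facts(4,5)[OF assms(1)] assms by simp_all
  have "T \<inter> T' \<noteq> T"
  proof
    assume "T \<inter> T' = T"
    with face have "T face_of T'" by simp
    with assms dims show False
      using face_of_aff_dim_lt[of T' T] convex_simplex mesh_facts(2)[OF assms(1)] by force
  qed
  then show ?thesis
    using face_of_aff_dim_lt[of T "T \<inter> T'"] face(1) dims convex_simplex mesh_facts(2)[OF assms(1)] assms by force
qed

lemma mesh_Int_negligible:
  fixes \<T> :: "(real ^ 'n) set set"
  assumes "mesh \<Omega> \<T>" "T \<in> \<T>" "T' \<in> \<T>" "T \<noteq> T'"
  shows "negligible (T \<inter> T')"
proof -
  have "interior (T \<inter> T') = {}"
    using mesh_Int_aff_dim[OF assms] by (intro low_dim_interior) auto
  moreover have "convex (T \<inter> T')"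
    using mesh_facts(2)[OF assms(1)] assms convex_simplex by (intro convex_Int) auto
  ultimately show ?thesis
    by (simp add: negligible_convex_interior)
qed

text \<open>With \<open>Q\<close> read as the component in the dual graph, elements from different components would meet only in
  codimension two, and such a set cannot separate the connected open set \<open>\<Omega>\<close>.\<close>

lemma mesh_facet_connected:
  fixes \<T> :: "(real ^ 'n) set set"
  assumes mesh: "mesh \<Omega> \<T>" and \<Omega>: "open \<Omega>" "connected \<Omega>"
    and step: "\<And>T T' e. T \<in> \<T> \<Longrightarrow> T' \<in> \<T> \<Longrightarrow> e facet_of T \<Longrightarrow> e facet_of T' \<Longrightarrow> Q T = Q T'"
    and T1: "T1 \<in> \<T>" and T2: "T2 \<in> \<T>"
  shows "Q T1 = Q T2"
proof (rule ccontr)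
  assume ne: "Q T1 \<noteq> Q T2"
  define \<A> \<B> where "\<A> = {T\<in>\<T>. Q T = Q T1}" and "\<B> = {T\<in>\<T>. Q T \<noteq> Q T1}"
  define S where "S = (\<Union>(T, T')\<in>\<A> \<times> \<B>. T \<inter> T')"
  have fin: "finite \<A>" "finite \<B>"
    using mesh_facts(1)[OF mesh] by (auto simp: \<A>_def \<B>_def)
  have closed: "closed (\<Union>\<A>)" "closed (\<Union>\<B>)"
    using fin mesh_facts(2)[OF mesh] closed_simplex by (auto intro!: closed_Union simp: \<A>_def \<B>_def)
  have S: "S = \<Union>\<A> \<inter> \<Union>\<B>"
    by (auto simp: S_def)
  have cover: "\<Omega> \<subseteq> \<Union>\<A> \<union> \<Union>\<B>"
  proof -
    have "\<Union>\<A> \<union> \<Union>\<B> = \<Union>\<T>"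
      unfolding \<A>_def \<B>_def by blast
    then show ?thesis
      using mesh_facts(3)[OF mesh] closure_subset[of \<Omega>] by simp
  qed
  have dim: "aff_dim (T \<inter> T') \<le> int CARD('n) - 2" if T: "T \<in> \<A>" "T' \<in> \<B>" for T T'
  proof (rule ccontr)
    assume "\<not> aff_dim (T \<inter> T') \<le> int CARD('n) - 2"
    moreover have TT: "T \<in> \<T>" "T' \<in> \<T>" "T \<noteq> T'"
      using T by (auto simp: \<A>_def \<B>_def)
    ultimately have d: "aff_dim (T \<inter> T') = int CARD('n) - 1"
      using mesh_Int_aff_dim[OF mesh TT] by simp
    then have "T \<inter> T' \<noteq> {}"
      using aff_dim_empty[of "T \<inter> T'"] zero_less_card_finite[where 'a='n] by auto
    then have "(T \<inter> T') facet_of T" "(T \<inter> T') facet_of T'"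
      using d mesh_facts(4,5)[OF mesh] TT aff_dim_simplex[OF mesh_facts(2)[OF mesh]] by (simp_all add: facet_of_def)
    then have "Q T = Q T'"
      using step TT by blast
    then show False
      using T by (auto simp: \<A>_def \<B>_def)
  qed
  have "negligible S"
    unfolding S_def
    by (intro negligible_Union) (use fin mesh_Int_negligible[OF mesh] in \<open>auto simp: \<A>_def \<B>_def\<close>)
  then have no_open: "U = {}" if "open U" "U \<subseteq> S" for U
    using that negligible_subset open_not_negligible by blast
  have "\<Omega> \<subseteq> interior (\<Union>\<A>) \<union> interior (\<Union>\<B>)"
  proof
    fix x assume "x \<in> \<Omega>"
    then obtain r where r: "r > 0" "ball x r \<subseteq> \<Omega>"
      using \<Omega>(1) open_contains_ball by blast
    have "connected (ball x r - S)"
      unfolding S_def case_prod_unfold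
      by (rule connected_ball_minus_codim2) (use fin dim in auto)
    moreover have "ball x r - S \<subseteq> \<Union>\<A> \<union> \<Union>\<B>" "\<Union>\<A> \<inter> \<Union>\<B> \<inter> (ball x r - S) = {}"
      using r cover S by auto
    ultimately have "\<Union>\<A> \<inter> (ball x r - S) = {} \<or> \<Union>\<B> \<inter> (ball x r - S) = {}"
      using closed by (metis connected_closed)
    then have "ball x r - S \<subseteq> \<Union>\<A> \<or> ball x r - S \<subseteq> \<Union>\<B>"
      using r cover by blast
    moreover have "ball x r \<subseteq> F" if F: "closed F" "ball x r - S \<subseteq> F" for F
    proof -
      have "ball x r - F = {}"
        using F by (intro no_open) auto
      then show ?thesis by blast
    qed
    ultimately have "ball x r \<subseteq> \<Union>\<A> \<or> ball x r \<subseteq> \<Union>\<B>"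
      using closed by blast
    then show "x \<in> interior (\<Union>\<A>) \<union> interior (\<Union>\<B>)"
      using r by (metis Un_iff centre_in_ball interior_maximal open_ball subsetD)
  qed
  moreover have "interior (\<Union>\<A>) \<inter> interior (\<Union>\<B>) = {}"
    using S interior_subset by (intro no_open) blast+
  ultimately have "interior (\<Union>\<A>) \<inter> \<Omega> = {} \<or> interior (\<Union>\<B>) \<inter> \<Omega> = {}"
    using \<Omega>(2) by (metis connectedD inf_bot_left open_interior)
  moreover have meet: "interior F \<inter> \<Omega> \<noteq> {}" if T: "T \<in> \<T>" "T \<subseteq> F" for T F
  proof -
    have "interior T \<subseteq> closure \<Omega>"
      using T mesh_facts(3)[OF mesh] interior_subset by blast
    moreover have "interior T \<noteq> {}"
      using interior_full_simplex mesh_facts(2)[OF mesh] T by blast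
    ultimately have "interior T \<inter> \<Omega> \<noteq> {}"
      by (metis inf.absorb_iff1 open_Int_closure_eq_empty open_interior)
    then show ?thesis
      using interior_mono[OF T(2)] by blast
  qed
  moreover have "T1 \<subseteq> \<Union>\<A>" "T2 \<subseteq> \<Union>\<B>"
    using T1 T2 ne by (auto simp: \<A>_def \<B>_def)
  ultimately show False
    using meet[OF T1] meet[OF T2] by blast
qed

text \<open>Any two elements with facet \<open>e\<close> have opposite outward normals there, and three unit vectors cannot be pairwise
  opposite.\<close>

lemma face_adjacent_elements:
  fixes \<T> :: "(real ^ 'n) set set"
  assumes mesh: "mesh \<Omega> \<T>" and sides: "face_sides \<T> Tp Tm" and e: "e \<in> faces \<T>"
  shows "{T\<in>\<T>. e facet_of T} = (if e \<in> interior_faces \<T> then {Tp e, Tm e} else {Tp e})"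
proof -
  have Tp: "Tp e \<in> \<T>" "e facet_of Tp e"
    using sides e by (auto simp: face_sides_def)
  have opp: "outward_normal T' e = - outward_normal T e"
    if "T \<in> \<T>" "T' \<in> \<T>" "T \<noteq> T'" "e facet_of T" "e facet_of T'" for T T'
    using that by (intro opposite_normals mesh_facts[OF mesh]) auto
  show ?thesis
  proof (cases "e \<in> interior_faces \<T>")
    case True
    then have Tm: "Tm e \<in> \<T>" "e facet_of Tm e" "Tm e \<noteq> Tp e"
      using sides by (auto simp: face_sides_def)
    have "T = Tp e \<or> T = Tm e" if T: "T \<in> \<T>" "e facet_of T" for T
    proof (rule ccontr)
      assume "\<not> ?thesis"
      then have "outward_normal (Tp e) e = - outward_normal T e" "outward_normal (Tm e) e = - outward_normal T e"
        "outward_normal (Tm e) e = - outward_normal (Tp e) e"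
        using opp[of T "Tp e"] opp[of T "Tm e"] opp[of "Tp e" "Tm e"] T Tp Tm by simp_all
      then have "outward_normal T e + outward_normal T e = 0"
        by (metis add.inverse_inverse add.right_inverse)
      then have "outward_normal T e = 0"
        by (metis scaleR_2 scaleR_eq_0_iff zero_neq_numeral)
      then show False
        using facet_normal_norm[OF mesh_facts(2)[OF mesh T(1)] T(2)] by simp
    qed
    then show ?thesis
      using Tp Tm True by auto
  next
    case False
    then show ?thesis
      using Tp unfolding interior_faces_def by auto
  qed
qed

section \<open>Piecewise affine functions\<close>

lemma P1I: "linear A \<Longrightarrow> g = (\<lambda>x. A x + c) \<Longrightarrow> g \<in> P1"
  by (auto simp: P1_def)

lemma P1_lincomb:
  assumes "g \<in> P1" "g' \<in> P1"
  shows "(\<lambda>x. a *\<^sub>R g x + b *\<^sub>R g' x) \<in> P1"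
proof -
  obtain A c A' c' where *: "linear A" "g = (\<lambda>x. A x + c)" "linear A'" "g' = (\<lambda>x. A' x + c')"
    using assms by (auto simp: P1_def)
  have "linear (\<lambda>x. a *\<^sub>R A x + b *\<^sub>R A' x)"
    using * by (intro linear_compose_add linear_compose_scale_right)
  moreover have "(\<lambda>x. a *\<^sub>R g x + b *\<^sub>R g' x) = (\<lambda>x. (a *\<^sub>R A x + b *\<^sub>R A' x) + (a *\<^sub>R c + b *\<^sub>R c'))"
    by (simp add: * algebra_simps)
  ultimately show ?thesis
    by (rule P1I)
qed

lemma P0_subset_P1: "P0 \<subseteq> P1"
  by (auto simp: P0_def intro: P1I[OF linear_zero])

lemma P1_const: "(\<lambda>x. c) \<in> P1"
  using P0_subset_P1 unfolding P0_def by blast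

lemma P1_scaled_shift: "(\<lambda>x. c *\<^sub>R (x - p)) \<in> (P1 :: (real ^ 'n \<Rightarrow> real ^ 'n) set)"
proof -
  have "linear (\<lambda>x :: real ^ 'n. c *\<^sub>R x)"
    by simp
  moreover have "(\<lambda>x. c *\<^sub>R (x - p)) = (\<lambda>x. c *\<^sub>R x + (- c *\<^sub>R p))"
    by (simp add: algebra_simps)
  ultimately show ?thesis
    by (rule P1I)
qed

lemma P1_continuous:
  assumes "g \<in> P1"
  shows "continuous_on S g"
proof -
  obtain A c where "linear A" "g = (\<lambda>x. A x + c)"
    using assms by (auto simp: P1_def)
  moreover have "continuous_on S A"
    using \<open>linear A\<close> by (intro linear_continuous_on) (simp add: linear_linear)
  ultimately show ?thesis
    by (simp add: continuous_intros)
qed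

lemma P1_eq_0I:
  fixes g :: "real ^ 'n \<Rightarrow> 'b::euclidean_space"
  assumes "g \<in> P1" "g 0 = 0" "\<And>j. g (axis j 1) = 0"
  shows "g = (\<lambda>x. 0)"
proof -
  obtain A c where *: "linear A" "g = (\<lambda>x. A x + c)"
    using assms by (auto simp: P1_def)
  have c: "c = 0"
    using assms(2) by (simp add: * linear_0)
  have "A b = 0" if "b \<in> Basis" for b
    using that assms(3) by (auto simp: * c Basis_vec_def)
  then have "A x = 0" for x
    using linear_eq_on_span[OF *(1) linear_zero, of Basis x] by simp
  then show ?thesis
    by (simp add: * c)
qed

text \<open>By continuity the difference vanishes on the interior of \<open>T\<close>, and an affine function that vanishes on a ball is zero.\<close>

lemma P1_eq_if_AE:
  fixes g g' :: "real ^ 'n \<Rightarrow> 'b::euclidean_space"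
  assumes T: "int CARD('n) simplex T" and g: "g \<in> P1" "g' \<in> P1" and AE: "AE x in lebesgue_on T. g x = g' x"
  shows "g = g'"
proof -
  define d where "d = (\<lambda>x. 1 *\<^sub>R g x + (- 1) *\<^sub>R g' x)"
  have "d \<in> P1"
    unfolding d_def by (rule P1_lincomb[OF g])
  then obtain A c where *: "linear A" "d = (\<lambda>x. A x + c)"
    by (auto simp: P1_def)
  have T': "T \<in> sets lebesgue"
    using lmeasurable_compact[OF compact_simplex[OF T]] by (rule fmeasurableD)
  have "AE x in lebesgue. x \<in> T \<longrightarrow> g x = g' x"
    using AE T' by (simp add: AE_restrict_space_iff)
  then have "negligible {x \<in> T. g x \<noteq> g' x}"
    using completion.AE_iff_null_sets[of "\<lambda>x. x \<in> T \<longrightarrow> g x = g' x" lborel]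
    by (simp add: negligible_iff_null_sets)
  moreover have "{x \<in> interior T. d x \<noteq> 0} \<subseteq> {x \<in> T. g x \<noteq> g' x}"
    using interior_subset by (auto simp: d_def)
  moreover have "open {x \<in> interior T. d x \<noteq> 0}"
  proof -
    have "{x \<in> interior T. d x \<noteq> 0} = interior T \<inter> d -` (- {0})"
      by auto
    moreover have "open (d -` (- {0}))"
      using P1_continuous[OF \<open>d \<in> P1\<close>, of UNIV] by (intro open_vimage) auto
    ultimately show ?thesis
      by auto
  qed
  ultimately have d0: "d x = 0" if "x \<in> interior T" for x
    using that negligible_subset open_not_negligible by blast
  obtain x0 r where x0: "r > 0" "ball x0 r \<subseteq> interior T"
    using interior_full_simplex[OF T] open_contains_ball[of "interior T"] open_interior[of T] by blast
  have Ax: "A x = 0" for x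
  proof (cases "x = 0")
    case False
    define t where "t = r / (2 * norm x)"
    have "x0 + t *\<^sub>R x \<in> ball x0 r" "x0 \<in> ball x0 r"
      using False x0 by (auto simp: t_def dist_norm)
    then have "d (x0 + t *\<^sub>R x) = 0" "d x0 = 0"
      using d0 x0 by blast+
    then have "A x0 + t *\<^sub>R A x + c = A x0 + c"
      by (simp add: * linear_add linear_scale)
    then have "t *\<^sub>R A x = 0"
      by simp
    then show ?thesis
      using False x0 by (simp add: t_def)
  qed (use * in \<open>simp add: linear_0\<close>)
  have "d x0 = 0"
    using d0 x0 centre_in_ball by blast
  then have "c = 0"
    by (simp add: * Ax)
  then have "d x = 0" for x
    by (simp add: * Ax)
  then show ?thesis
    by (auto simp: d_def)
qed

text \<open>By completeness of Lebesgue measure.\<close>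

lemma measurable_if_AE_eq:
  fixes f g :: "real ^ 'n \<Rightarrow> 'b::euclidean_space"
  assumes S: "S \<in> sets lebesgue" and g: "g \<in> borel_measurable (lebesgue_on S)"
    and AE: "AE x in lebesgue_on S. f x = g x"
  shows "f \<in> borel_measurable (lebesgue_on S)"
proof (rule measurableI)
  let ?N = "{x \<in> S. f x \<noteq> g x}"
  have "AE x in lebesgue. x \<in> S \<longrightarrow> f x = g x"
    using AE S by (simp add: AE_restrict_space_iff)
  then have N: "?N \<in> null_sets lebesgue"
    using completion.AE_iff_null_sets[of "\<lambda>x. x \<in> S \<longrightarrow> f x = g x" lborel] by simp
  fix B :: "'b set" assume B: "B \<in> sets borel"
  have "g -` B \<inter> S \<in> sets lebesgue"
    using measurable_sets[OF g B] S by (simp add: sets_restrict_space_iff)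
  moreover have "f -` B \<inter> ?N \<in> null_sets lebesgue"
    by (rule completion.complete2[OF _ N]) blast
  ultimately have "(g -` B \<inter> S - ?N) \<union> (f -` B \<inter> ?N) \<in> sets lebesgue"
    using N by blast
  also have "(g -` B \<inter> S - ?N) \<union> (f -` B \<inter> ?N) = f -` B \<inter> S"
    by auto
  finally show "f -` B \<inter> space (lebesgue_on S) \<in> sets (lebesgue_on S)"
    using S by (simp add: sets_restrict_space_iff)
qed simp

text \<open>Membership is up to null sets, like for the discrete spaces, so that only \<open>piece\<close> is meaningful on the faces.\<close>

definition piecewise :: "(real ^ 'n \<Rightarrow> 'b::euclidean_space) set \<Rightarrow> (real ^ 'n) set set \<Rightarrow> (real ^ 'n \<Rightarrow> 'b) set" where
  "piecewise P \<T> = {v. \<forall>T\<in>\<T>. \<exists>g\<in>P. restricts_to v T g}"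

lemma restricts_to_lincomb:
  assumes "restricts_to v T g" "restricts_to w T g'"
  shows "restricts_to (\<lambda>x. a *\<^sub>R v x + b *\<^sub>R w x) T (\<lambda>x. a *\<^sub>R g x + b *\<^sub>R g' x)"
  using assms unfolding restricts_to_def by eventually_elim simp

lemma piece_eqI:
  assumes "int CARD('n) simplex (T :: (real ^ 'n) set)" "g \<in> P1" "restricts_to v T g"
  shows "piece v T = g"
  unfolding piece_def
proof (rule the_equality)
  fix g' assume g': "g' \<in> P1 \<and> restricts_to v T g'"
  have "AE x in lebesgue_on T. v x = g x" "AE x in lebesgue_on T. v x = g' x"
    using g' assms(3) by (simp_all add: restricts_to_def)
  then have "AE x in lebesgue_on T. g' x = g x"
    by eventually_elim simp
  then show "g' = g"
    using P1_eq_if_AE[OF assms(1)] g' assms(2) by blast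
qed (use assms in simp)

lemma P1_jacobian:
  fixes A :: "real ^ 'n \<Rightarrow> real ^ 'n"
  assumes "linear A"
  shows "jacobian (\<lambda>x. A x + c) (at x) = matrix A"
proof -
  have "bounded_linear A"
    using assms by (simp add: linear_linear)
  then have "((\<lambda>x. A x + c) has_derivative A) (at x)"
    by (intro has_derivative_add_const bounded_linear_imp_has_derivative)
  then show ?thesis
    by (simp add: jacobian_def frechet_derivative_at[symmetric])
qed

lemma sum_lincomb:
  fixes f g h :: "'i \<Rightarrow> real"
  assumes "\<And>i. i \<in> I \<Longrightarrow> f i = a * g i + b * h i"
  shows "sum f I = a * sum g I + b * sum h I"
  using assms by (simp add: sum.distrib sum_distrib_left)

locale sided_mesh =
  fixes \<Omega> :: "(real ^ 'n) set" and \<T> Tp Tm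
  assumes mesh: "mesh \<Omega> \<T>" and sides: "face_sides \<T> Tp Tm"
begin

lemma fin: "finite \<T>" and simplex: "T \<in> \<T> \<Longrightarrow> int CARD('n) simplex T"
  using mesh_facts[OF mesh] by blast+

lemma faces_eq: "faces \<T> = (\<Union>T\<in>\<T>. {e. e facet_of T})"
  by (auto simp: faces_def)

lemma finite_faces: "finite (faces \<T>)"
  unfolding faces_eq using fin simplex_facets(1)[OF simplex] by auto

lemma Tp: "e \<in> faces \<T> \<Longrightarrow> Tp e \<in> \<T>" "e \<in> faces \<T> \<Longrightarrow> e facet_of Tp e"
  using sides by (auto simp: face_sides_def)

lemma Tm: "e \<in> interior_faces \<T> \<Longrightarrow> Tm e \<in> \<T>" "e \<in> interior_faces \<T> \<Longrightarrow> e facet_of Tm e"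
  "e \<in> interior_faces \<T> \<Longrightarrow> Tm e \<noteq> Tp e"
  using sides by (auto simp: face_sides_def)

lemma piece_piecewise:
  assumes "v \<in> piecewise P1 \<T>" "T \<in> \<T>"
  shows "piece v T \<in> P1" "AE x in lebesgue_on T. v x = piece v T x"
proof -
  obtain g where "g \<in> P1" "restricts_to v T g"
    using assms by (auto simp: piecewise_def)
  moreover from this have "piece v T = g"
    by (rule piece_eqI[OF simplex[OF assms(2)]])
  ultimately show "piece v T \<in> P1" "AE x in lebesgue_on T. v x = piece v T x"
    by (simp_all add: restricts_to_def)
qed

lemma piece_continuous: "v \<in> piecewise P1 \<T> \<Longrightarrow> T \<in> \<T> \<Longrightarrow> continuous_on S (piece v T)"
  by (intro P1_continuous piece_piecewise(1))

lemma piecewise_lincomb: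
  assumes "v \<in> piecewise P1 \<T>" "w \<in> piecewise P1 \<T>"
  shows "(\<lambda>x. a *\<^sub>R v x + b *\<^sub>R w x) \<in> piecewise P1 \<T>"
  using assms restricts_to_lincomb P1_lincomb unfolding piecewise_def by fast

lemma piece_lincomb:
  assumes "v \<in> piecewise P1 \<T>" "w \<in> piecewise P1 \<T>" "T \<in> \<T>"
  shows "piece (\<lambda>x. a *\<^sub>R v x + b *\<^sub>R w x) T = (\<lambda>x. a *\<^sub>R piece v T x + b *\<^sub>R piece w T x)"
proof (rule piece_eqI[OF simplex[OF assms(3)]])
  show "(\<lambda>x. a *\<^sub>R piece v T x + b *\<^sub>R piece w T x) \<in> P1"
    by (intro P1_lincomb piece_piecewise assms)
  show "restricts_to (\<lambda>x. a *\<^sub>R v x + b *\<^sub>R w x) T (\<lambda>x. a *\<^sub>R piece v T x + b *\<^sub>R piece w T x)"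
    by (intro restricts_to_lincomb) (auto simp: restricts_to_def intro!: piece_piecewise assms)
qed

lemma grad_piece_const:
  assumes "v \<in> piecewise P1 \<T>" "T \<in> \<T>"
  shows "grad_piece v T x = grad_piece v T 0"
  using piece_piecewise(1)[OF assms] by (auto simp: P1_def grad_piece_def P1_jacobian)

lemma grad_piece_lincomb:
  assumes v: "v \<in> piecewise P1 \<T>" and w: "w \<in> piecewise P1 \<T>" and T: "T \<in> \<T>"
  shows "grad_piece (\<lambda>x. a *\<^sub>R v x + b *\<^sub>R w x) T x = a *\<^sub>R grad_piece v T x + b *\<^sub>R grad_piece w T x"
proof -
  obtain A c where A: "linear A" "piece v T = (\<lambda>x. A x + c)"
    using piece_piecewise(1)[OF v T] by (auto simp: P1_def)
  obtain B d where B: "linear B" "piece w T = (\<lambda>x. B x + d)"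
    using piece_piecewise(1)[OF w T] by (auto simp: P1_def)
  have "linear (\<lambda>x. a *\<^sub>R A x + b *\<^sub>R B x)"
    using A B by (intro linear_compose_add linear_compose_scale_right)
  moreover have "piece (\<lambda>x. a *\<^sub>R v x + b *\<^sub>R w x) T = (\<lambda>x. (a *\<^sub>R A x + b *\<^sub>R B x) + (a *\<^sub>R c + b *\<^sub>R d))"
    by (simp add: piece_lincomb[OF v w T] A B algebra_simps)
  ultimately have "grad_piece (\<lambda>x. a *\<^sub>R v x + b *\<^sub>R w x) T x = matrix (\<lambda>x. a *\<^sub>R A x + b *\<^sub>R B x)"
    by (simp add: grad_piece_def P1_jacobian)
  then show ?thesis
    by (simp add: grad_piece_def A B P1_jacobian matrix_def vec_eq_iff)
qed

lemma jump_continuous: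
  assumes "v \<in> piecewise P1 \<T>" "e \<in> faces \<T>"
  shows "continuous_on S (jump \<T> Tp Tm (piece v) e)"
  unfolding jump_def using assms Tp Tm
  by (cases "e \<in> interior_faces \<T>") (simp_all add: piece_continuous continuous_intros)

lemma jump_lincomb:
  assumes "v \<in> piecewise P1 \<T>" "w \<in> piecewise P1 \<T>" "e \<in> faces \<T>"
  shows "jump \<T> Tp Tm (piece (\<lambda>x. a *\<^sub>R v x + b *\<^sub>R w x)) e x =
    a *\<^sub>R jump \<T> Tp Tm (piece v) e x + b *\<^sub>R jump \<T> Tp Tm (piece w) e x"
  using assms Tp Tm by (simp add: jump_def piece_lincomb algebra_simps)

lemma average_continuous:
  assumes "v \<in> piecewise P1 \<T>" "e \<in> faces \<T>"
  shows "continuous_on S (average \<T> Tp Tm (piece v) e)"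
  unfolding average_def using assms Tp Tm
  by (cases "e \<in> interior_faces \<T>") (simp_all add: piece_continuous continuous_intros)

lemma average_lincomb:
  assumes "v \<in> piecewise P1 \<T>" "w \<in> piecewise P1 \<T>" "e \<in> faces \<T>"
  shows "average \<T> Tp Tm (piece (\<lambda>x. a *\<^sub>R v x + b *\<^sub>R w x)) e x =
    a *\<^sub>R average \<T> Tp Tm (piece v) e x + b *\<^sub>R average \<T> Tp Tm (piece w) e x"
  using assms Tp Tm by (simp add: average_def piece_lincomb algebra_simps)

lemma average_grad_const:
  assumes "v \<in> piecewise P1 \<T>" "e \<in> faces \<T>"
  shows "average \<T> Tp Tm (grad_piece v) e x = average \<T> Tp Tm (grad_piece v) e 0"
  using assms Tp Tm grad_piece_const[of v "Tp e" x] grad_piece_const[of v "Tm e" x] by (simp add: average_def)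

lemma average_grad_lincomb:
  assumes "v \<in> piecewise P1 \<T>" "w \<in> piecewise P1 \<T>" "e \<in> faces \<T>"
  shows "average \<T> Tp Tm (grad_piece (\<lambda>x. a *\<^sub>R v x + b *\<^sub>R w x)) e x =
    a *\<^sub>R average \<T> Tp Tm (grad_piece v) e x + b *\<^sub>R average \<T> Tp Tm (grad_piece w) e x"
  using assms Tp Tm by (simp add: average_def grad_piece_lincomb algebra_simps)

lemma face_integrable: "e \<in> faces \<T> \<Longrightarrow> continuous_on UNIV g \<Longrightarrow> integrable (face_measure e) (g :: _ \<Rightarrow> real)"
  using facet_integrable[OF simplex Tp(2)] Tp(1) by blast

lemma face_integral_lincomb:
  fixes f g :: "real ^ 'n \<Rightarrow> real"
  assumes "e \<in> faces \<T>" "continuous_on UNIV f" "continuous_on UNIV g"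
  shows "(LINT x|face_measure e. a * f x + b * g x) = a * (LINT x|face_measure e. f x) + b * (LINT x|face_measure e. g x)"
  using face_integrable[OF assms(1)] assms(2,3) by simp

lemma element_integrable:
  fixes g :: "real ^ 'n \<Rightarrow> real"
  assumes "T \<in> \<T>" "continuous_on UNIV g"
  shows "integrable (lebesgue_on T) g"
proof -
  have T: "compact T" "T \<in> lmeasurable"
    using compact_simplex[OF simplex[OF assms(1)]] lmeasurable_compact by auto
  interpret finite_measure "lebesgue_on T"
    using T(2) by (rule finite_measure_lebesgue_on)
  have cont: "continuous_on T g"
    using assms(2) continuous_on_subset by blast
  then obtain B where "\<forall>x\<in>T. norm (g x) \<le> B"
    using compact_imp_bounded[OF compact_continuous_image[OF cont T(1)]] by (auto simp: bounded_iff)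
  then have "AE x in lebesgue_on T. norm (g x) \<le> B"
    by (intro AE_I2) simp
  moreover have "g \<in> borel_measurable (lebesgue_on T)"
    using T(2) by (intro continuous_imp_measurable_on_sets_lebesgue cont fmeasurableD)
  ultimately show ?thesis
    by (rule integrable_const_bound)
qed

lemma element_integral_lincomb:
  fixes f g :: "real ^ 'n \<Rightarrow> real"
  assumes "T \<in> \<T>" "continuous_on UNIV f" "continuous_on UNIV g"
  shows "(LINT x|lebesgue_on T. a * f x + b * g x) = a * (LINT x|lebesgue_on T. f x) + b * (LINT x|lebesgue_on T. g x)"
  using element_integrable[OF assms(1)] assms(2,3) by simp

lemma element_sets: "T \<in> \<T> \<Longrightarrow> T \<in> sets lebesgue"
  using lmeasurable_compact[OF compact_simplex[OF simplex]] fmeasurableD by blast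

text \<open>Measurability passes from \<open>g\<close> to \<open>f\<close>. Integrands are turned into polynomials in this way, which are integrable
  on the compact elements.\<close>

lemma element_integral_cong:
  fixes f g :: "real ^ 'n \<Rightarrow> real"
  assumes T: "T \<in> \<T>" and g: "continuous_on UNIV g" and AE: "AE x in lebesgue_on T. f x = g x"
  shows "(LINT x|lebesgue_on T. f x) = (LINT x|lebesgue_on T. g x)"
proof -
  have "g \<in> borel_measurable (lebesgue_on T)"
    using element_integrable[OF T g] by blast
  then show ?thesis
    by (intro integral_cong_AE measurable_if_AE_eq[OF element_sets[OF T] _ AE] AE)
qed

section \<open>The bilinear forms\<close>

abbreviation "form_A \<rho>\<^sub>1 \<rho>\<^sub>2 \<nu> v w \<equiv> \<nu> * form_a \<T> Tp Tm \<rho>\<^sub>1 v w + form_c \<T> Tp Tm \<rho>\<^sub>2 v w"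

lemma form_a_commute: "form_a \<T> Tp Tm \<rho>\<^sub>1 v w = form_a \<T> Tp Tm \<rho>\<^sub>1 w v"
  by (simp add: form_a_def inner_commute)

lemma form_c_commute: "form_c \<T> Tp Tm \<rho>\<^sub>2 v w = form_c \<T> Tp Tm \<rho>\<^sub>2 w v"
  by (simp add: form_c_def inner_commute)

lemma continuous_on_grad_piece:
  assumes "v \<in> piecewise P1 \<T>" "T \<in> \<T>"
  shows "continuous_on S (grad_piece v T)"
proof -
  have "grad_piece v T = (\<lambda>x. grad_piece v T 0)"
    by (rule ext) (rule grad_piece_const[OF assms])
  then show ?thesis
    by (rule ssubst) (rule continuous_on_const)
qed

lemma continuous_on_average_grad:
  assumes "v \<in> piecewise P1 \<T>" "e \<in> faces \<T>"
  shows "continuous_on S (\<lambda>x. average \<T> Tp Tm (grad_piece v) e x *v n)"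
proof -
  have "average \<T> Tp Tm (grad_piece v) e = (\<lambda>x. average \<T> Tp Tm (grad_piece v) e 0)"
    by (rule ext) (rule average_grad_const[OF assms])
  then show ?thesis
    by (rule ssubst) (rule continuous_on_const)
qed

lemma form_a_lincomb:
  assumes v: "v \<in> piecewise P1 \<T>" and w: "w \<in> piecewise P1 \<T>" and z: "z \<in> piecewise P1 \<T>"
  shows "form_a \<T> Tp Tm \<rho>\<^sub>1 (\<lambda>x. a *\<^sub>R v x + b *\<^sub>R w x) z = a * form_a \<T> Tp Tm \<rho>\<^sub>1 v z + b * form_a \<T> Tp Tm \<rho>\<^sub>1 w z"
proof -
  let ?vw = "\<lambda>x. a *\<^sub>R v x + b *\<^sub>R w x"
  have 1: "(LINT x|lebesgue_on T. grad_piece ?vw T x \<bullet> grad_piece z T x) =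
    a * (LINT x|lebesgue_on T. grad_piece v T x \<bullet> grad_piece z T x) +
    b * (LINT x|lebesgue_on T. grad_piece w T x \<bullet> grad_piece z T x)" if T: "T \<in> \<T>" for T
    unfolding grad_piece_lincomb[OF v w T] inner_left_distrib inner_scaleR_left
    by (intro element_integral_lincomb T continuous_intros continuous_on_grad_piece v w z)
  have 2: "(LINT x|face_measure e. (average \<T> Tp Tm (grad_piece ?vw) e x *v outward_normal (Tp e) e) \<bullet> jump \<T> Tp Tm (piece z) e x) =
    a * (LINT x|face_measure e. (average \<T> Tp Tm (grad_piece v) e x *v outward_normal (Tp e) e) \<bullet> jump \<T> Tp Tm (piece z) e x) +
    b * (LINT x|face_measure e. (average \<T> Tp Tm (grad_piece w) e x *v outward_normal (Tp e) e) \<bullet> jump \<T> Tp Tm (piece z) e x)"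
    if e: "e \<in> faces \<T>" for e
    unfolding average_grad_lincomb[OF v w e] matrix_vector_mult_add_rdistrib scaleR_matrix_vector_assoc[symmetric] inner_left_distrib inner_scaleR_left
    by (intro face_integral_lincomb e continuous_intros continuous_on_average_grad jump_continuous v w z)
  have 3: "(LINT x|face_measure e. (average \<T> Tp Tm (grad_piece z) e x *v outward_normal (Tp e) e) \<bullet> jump \<T> Tp Tm (piece ?vw) e x) =
    a * (LINT x|face_measure e. (average \<T> Tp Tm (grad_piece z) e x *v outward_normal (Tp e) e) \<bullet> jump \<T> Tp Tm (piece v) e x) +
    b * (LINT x|face_measure e. (average \<T> Tp Tm (grad_piece z) e x *v outward_normal (Tp e) e) \<bullet> jump \<T> Tp Tm (piece w) e x)"
    if e: "e \<in> faces \<T>" for e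
    unfolding jump_lincomb[OF v w e] inner_right_distrib inner_scaleR_right
    by (intro face_integral_lincomb e continuous_intros continuous_on_average_grad jump_continuous v w z)
  have 4: "(LINT x|face_measure e. inverse (face_size e) * (jump \<T> Tp Tm (piece z) e x \<bullet> jump \<T> Tp Tm (piece ?vw) e x)) =
    a * (LINT x|face_measure e. inverse (face_size e) * (jump \<T> Tp Tm (piece z) e x \<bullet> jump \<T> Tp Tm (piece v) e x)) +
    b * (LINT x|face_measure e. inverse (face_size e) * (jump \<T> Tp Tm (piece z) e x \<bullet> jump \<T> Tp Tm (piece w) e x))"
    if e: "e \<in> faces \<T>" for e
    unfolding jump_lincomb[OF v w e] inner_right_distrib inner_scaleR_right distrib_left mult.left_commute[of "inverse (face_size e)"]
    by (intro face_integral_lincomb e continuous_intros jump_continuous v w z)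
  show ?thesis
    unfolding form_a_def by (simp only: sum_lincomb[of \<T>, OF 1] sum_lincomb[of "faces \<T>", OF 2] sum_lincomb[of "faces \<T>", OF 3] sum_lincomb[of "faces \<T>", OF 4], algebra)
qed

lemma element_inner_integral:
  assumes T: "T \<in> \<T>" and v: "v \<in> piecewise P1 \<T>" and w: "w \<in> piecewise P1 \<T>"
  shows "(LINT x|lebesgue_on T. v x \<bullet> w x) = (LINT x|lebesgue_on T. piece v T x \<bullet> piece w T x)"
proof (rule element_integral_cong[OF T])
  show "AE x in lebesgue_on T. v x \<bullet> w x = piece v T x \<bullet> piece w T x"
    using piece_piecewise(2)[OF v T] piece_piecewise(2)[OF w T] by eventually_elim simp
qed (intro continuous_intros piece_continuous T v w)

lemma form_c_lincomb:
  assumes v: "v \<in> piecewise P1 \<T>" and w: "w \<in> piecewise P1 \<T>" and z: "z \<in> piecewise P1 \<T>"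
  shows "form_c \<T> Tp Tm \<rho>\<^sub>2 (\<lambda>x. a *\<^sub>R v x + b *\<^sub>R w x) z = a * form_c \<T> Tp Tm \<rho>\<^sub>2 v z + b * form_c \<T> Tp Tm \<rho>\<^sub>2 w z"
proof -
  let ?vw = "\<lambda>x. a *\<^sub>R v x + b *\<^sub>R w x"
  have 1: "(LINT x|lebesgue_on T. ?vw x \<bullet> z x) = a * (LINT x|lebesgue_on T. v x \<bullet> z x) + b * (LINT x|lebesgue_on T. w x \<bullet> z x)"
    if T: "T \<in> \<T>" for T
    unfolding element_inner_integral[OF T piecewise_lincomb[OF v w] z] element_inner_integral[OF T v z] element_inner_integral[OF T w z]
    unfolding piece_lincomb[OF v w T] inner_left_distrib inner_scaleR_left
    by (intro element_integral_lincomb T continuous_intros piece_continuous v w z)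
  have 4: "(LINT x|face_measure e. face_size e * (jump \<T> Tp Tm (piece z) e x \<bullet> jump \<T> Tp Tm (piece ?vw) e x)) =
    a * (LINT x|face_measure e. face_size e * (jump \<T> Tp Tm (piece z) e x \<bullet> jump \<T> Tp Tm (piece v) e x)) +
    b * (LINT x|face_measure e. face_size e * (jump \<T> Tp Tm (piece z) e x \<bullet> jump \<T> Tp Tm (piece w) e x))"
    if e: "e \<in> faces \<T>" for e
    unfolding jump_lincomb[OF v w e] inner_right_distrib inner_scaleR_right distrib_left mult.left_commute[of "face_size e"]
    by (intro face_integral_lincomb e continuous_intros jump_continuous v w z)
  show ?thesis
    unfolding form_c_def by (simp only: sum_lincomb[of \<T>, OF 1] sum_lincomb[of "faces \<T>", OF 4], algebra)
qed

lemma div_piece_lincomb: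
  assumes "v \<in> piecewise P1 \<T>" "w \<in> piecewise P1 \<T>" "T \<in> \<T>"
  shows "div_piece (\<lambda>x. a *\<^sub>R v x + b *\<^sub>R w x) T x = a * div_piece v T x + b * div_piece w T x"
  by (simp add: div_piece_def grad_piece_lincomb[OF assms] trace_def sum.distrib sum_distrib_left)

lemma continuous_on_div_piece:
  assumes "v \<in> piecewise P1 \<T>" "T \<in> \<T>"
  shows "continuous_on S (div_piece v T)"
proof -
  have "div_piece v T = (\<lambda>x. trace (grad_piece v T 0))"
    unfolding div_piece_def by (rule ext) (rule arg_cong[OF grad_piece_const[OF assms]])
  then show ?thesis
    by (rule ssubst) (rule continuous_on_const)
qed

lemma form_b_element_integral:
  assumes w: "w \<in> piecewise P1 \<T>" and q: "q \<in> piecewise P1 \<T>" and T: "T \<in> \<T>"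
  shows "(LINT x|lebesgue_on T. div_piece w T x * q x) = (LINT x|lebesgue_on T. div_piece w T x * piece q T x)"
proof (rule element_integral_cong[OF T])
  show "AE x in lebesgue_on T. div_piece w T x * q x = div_piece w T x * piece q T x"
    using piece_piecewise(2)[OF q T] by eventually_elim simp
qed (intro T continuous_intros continuous_on_div_piece piece_continuous w q)

lemma form_b_lincomb_left:
  assumes v: "v \<in> piecewise P1 \<T>" and w: "w \<in> piecewise P1 \<T>" and q: "q \<in> piecewise P1 \<T>"
  shows "form_b \<T> Tp Tm (\<lambda>x. a *\<^sub>R v x + b *\<^sub>R w x) q = a * form_b \<T> Tp Tm v q + b * form_b \<T> Tp Tm w q"
proof -
  let ?vw = "\<lambda>x. a *\<^sub>R v x + b *\<^sub>R w x"
  have 1: "(LINT x|lebesgue_on T. div_piece ?vw T x * q x) = a * (LINT x|lebesgue_on T. div_piece v T x * q x) + b * (LINT x|lebesgue_on T. div_piece w T x * q x)"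
    if T: "T \<in> \<T>" for T
    unfolding form_b_element_integral[OF piecewise_lincomb[OF v w] q T] form_b_element_integral[OF v q T] form_b_element_integral[OF w q T]
    unfolding div_piece_lincomb[OF v w T] distrib_right mult.assoc
    by (intro element_integral_lincomb T continuous_intros piece_continuous continuous_on_div_piece v w q)
  have 4: "(LINT x|face_measure e. (jump \<T> Tp Tm (piece ?vw) e x \<bullet> outward_normal (Tp e) e) * average \<T> Tp Tm (piece q) e x) =
    a * (LINT x|face_measure e. (jump \<T> Tp Tm (piece v) e x \<bullet> outward_normal (Tp e) e) * average \<T> Tp Tm (piece q) e x) +
    b * (LINT x|face_measure e. (jump \<T> Tp Tm (piece w) e x \<bullet> outward_normal (Tp e) e) * average \<T> Tp Tm (piece q) e x)"
    if e: "e \<in> faces \<T>" for e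
    unfolding jump_lincomb[OF v w e] inner_left_distrib inner_scaleR_left distrib_right mult.assoc
    by (intro face_integral_lincomb e continuous_intros jump_continuous average_continuous v w q)
  show ?thesis
    unfolding form_b_def by (simp only: sum_lincomb[of \<T>, OF 1] sum_lincomb[of "faces \<T>", OF 4], algebra)
qed

lemma form_b_lincomb_right:
  assumes v: "v \<in> piecewise P1 \<T>" and p: "p \<in> piecewise P1 \<T>" and q: "q \<in> piecewise P1 \<T>"
  shows "form_b \<T> Tp Tm v (\<lambda>x. a *\<^sub>R p x + b *\<^sub>R q x) = a * form_b \<T> Tp Tm v p + b * form_b \<T> Tp Tm v q"
proof -
  let ?pq = "\<lambda>x. a *\<^sub>R p x + b *\<^sub>R q x"
  have 1: "(LINT x|lebesgue_on T. div_piece v T x * ?pq x) = a * (LINT x|lebesgue_on T. div_piece v T x * p x) + b * (LINT x|lebesgue_on T. div_piece v T x * q x)"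
    if T: "T \<in> \<T>" for T
    unfolding form_b_element_integral[OF v piecewise_lincomb[OF p q] T] form_b_element_integral[OF v p T] form_b_element_integral[OF v q T]
    unfolding piece_lincomb[OF p q T, unfolded real_scaleR_def] distrib_left real_scaleR_def mult.left_commute[of "div_piece v T _"]
    by (intro element_integral_lincomb T continuous_intros piece_continuous continuous_on_div_piece v p q)
  have 4: "(LINT x|face_measure e. (jump \<T> Tp Tm (piece v) e x \<bullet> outward_normal (Tp e) e) * average \<T> Tp Tm (piece ?pq) e x) =
    a * (LINT x|face_measure e. (jump \<T> Tp Tm (piece v) e x \<bullet> outward_normal (Tp e) e) * average \<T> Tp Tm (piece p) e x) +
    b * (LINT x|face_measure e. (jump \<T> Tp Tm (piece v) e x \<bullet> outward_normal (Tp e) e) * average \<T> Tp Tm (piece q) e x)"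
    if e: "e \<in> faces \<T>" for e
    unfolding average_lincomb[OF p q e, unfolded real_scaleR_def] distrib_left real_scaleR_def mult.left_commute[of "_ \<bullet> _"]
    by (intro face_integral_lincomb e continuous_intros jump_continuous average_continuous v p q)
  show ?thesis
    unfolding form_b_def by (simp only: sum_lincomb[of \<T>, OF 1] sum_lincomb[of "faces \<T>", OF 4], algebra)
qed

end

section \<open>Coercivity\<close>

lemma norm_matrix_vector_le: "norm (A *v x) \<le> norm A * norm (x :: real ^ 'n)" for A :: "real ^ 'n ^ 'm"
proof -
  have "norm ((A *v x) $ i) \<le> norm x * norm (A $ i)" for i
    using Cauchy_Schwarz_ineq2[of "A $ i" x]
    by (simp add: matrix_vector_mult_def inner_vec_def mult.commute)
  then have "L2_set (\<lambda>i. norm ((A *v x) $ i)) UNIV \<le> L2_set (\<lambda>i. norm x * norm (A $ i)) UNIV"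
    by (intro L2_set_mono) auto
  also have "\<dots> = norm x * L2_set (\<lambda>i. norm (A $ i)) UNIV"
    by (simp add: L2_set_right_distrib)
  finally show ?thesis
    by (simp add: norm_vec_def mult.commute)
qed

lemma weighted_Young:
  fixes x y :: "'a::real_inner"
  assumes "t > 0"
  shows "2 * (x \<bullet> y) \<le> t * (x \<bullet> x) + inverse t * (y \<bullet> y)"
proof -
  have "0 \<le> (t *\<^sub>R x - y) \<bullet> (t *\<^sub>R x - y)"
    by simp
  also have "\<dots> = t * (t * (x \<bullet> x)) - t * (2 * (x \<bullet> y)) + y \<bullet> y"
    by (simp add: inner_diff_left inner_diff_right inner_commute)
  finally have "0 \<le> inverse t * (t * (t * (x \<bullet> x)) - t * (2 * (x \<bullet> y)) + y \<bullet> y)"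
    using assms by simp
  also have "\<dots> = t * (x \<bullet> x) - 2 * (x \<bullet> y) + inverse t * (y \<bullet> y)"
    using assms by (simp add: field_simps)
  finally show ?thesis
    by simp
qed

context sided_mesh
begin

lemma adjacent:
  "e \<in> faces \<T> \<Longrightarrow> {T\<in>\<T>. e facet_of T} = (if e \<in> interior_faces \<T> then {Tp e, Tm e} else {Tp e})"
  by (rule face_adjacent_elements[OF mesh sides])

lemma sum_faces_adjacent:
  "(\<Sum>e\<in>faces \<T>. \<Sum>T | T \<in> \<T> \<and> e facet_of T. F e T) = (\<Sum>T\<in>\<T>. \<Sum>e | e facet_of T. F e T)"
proof -
  have "(\<Sum>e\<in>faces \<T>. \<Sum>T | T \<in> \<T> \<and> e facet_of T. F e T) = (\<Sum>T\<in>\<T>. \<Sum>e | e \<in> faces \<T> \<and> e facet_of T. F e T)"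
    by (rule sum.swap_restrict[OF finite_faces fin])
  also have "\<dots> = (\<Sum>T\<in>\<T>. \<Sum>e | e facet_of T. F e T)"
    by (intro sum.cong refl) (auto simp: faces_def)
  finally show ?thesis .
qed

lemma face_size_pos:
  assumes "e \<in> faces \<T>"
  shows "face_size e > 0"
proof -
  have "measure (face_measure e) UNIV > 0"
    by (rule facet_area_pos[OF simplex[OF Tp(1)] Tp(2)]) (rule assms)+
  then show ?thesis
    by (auto simp: face_size_def)
qed

lemma norm_average_grad_le:
  assumes e: "e \<in> faces \<T>"
  shows "(norm (average \<T> Tp Tm (grad_piece v) e 0))\<^sup>2 \<le> (\<Sum>T | T \<in> \<T> \<and> e facet_of T. (norm (grad_piece v T 0))\<^sup>2)"
proof (cases "e \<in> interior_faces \<T>")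
  case True
  let ?G = "\<lambda>T. norm (grad_piece v T 0)"
  have "norm (average \<T> Tp Tm (grad_piece v) e 0) \<le> (?G (Tp e) + ?G (Tm e)) / 2"
    using True norm_triangle_ineq[of "grad_piece v (Tp e) 0" "grad_piece v (Tm e) 0"] by (simp add: average_def)
  then have "(norm (average \<T> Tp Tm (grad_piece v) e 0))\<^sup>2 \<le> ((?G (Tp e) + ?G (Tm e)) / 2)\<^sup>2"
    by (intro power_mono) auto
  also have "\<dots> \<le> (?G (Tp e))\<^sup>2 + (?G (Tm e))\<^sup>2"
  proof -
    have "a\<^sup>2 + b\<^sup>2 - ((a + b) / 2)\<^sup>2 = ((a - b)\<^sup>2 + 2 * a\<^sup>2 + 2 * b\<^sup>2) / 4" for a b :: real
      by (simp add: power2_eq_square field_simps)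
    moreover have "((a - b)\<^sup>2 + 2 * a\<^sup>2 + 2 * b\<^sup>2) / 4 \<ge> 0" for a b :: real
      by simp
    ultimately show ?thesis
      by (metis diff_ge_0_iff_ge)
  qed
  finally show ?thesis
    using True Tm(3)[OF True] adjacent[OF e] by simp
qed (use adjacent[OF e] in \<open>simp add: average_def\<close>)

text \<open>Pointwise Young inequality with the weight \<open>h\<^sub>e / \<rho>\<close>, so that the second term is exactly the penalty.\<close>

lemma face_consistency_le:
  assumes v: "v \<in> piecewise P1 \<T>" and e: "e \<in> faces \<T>" and \<rho>: "\<rho> > 0"
  shows "2 * (LINT x|face_measure e. (average \<T> Tp Tm (grad_piece v) e x *v outward_normal (Tp e) e) \<bullet> jump \<T> Tp Tm (piece v) e x)
    \<le> measure (face_measure e) UNIV * face_size e / \<rho> * (\<Sum>T | T \<in> \<T> \<and> e facet_of T. (norm (grad_piece v T 0))\<^sup>2) +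
      \<rho> * (LINT x|face_measure e. inverse (face_size e) * (jump \<T> Tp Tm (piece v) e x \<bullet> jump \<T> Tp Tm (piece v) e x))"
proof -
  define M where "M = average \<T> Tp Tm (grad_piece v) e 0 *v outward_normal (Tp e) e"
  let ?J = "jump \<T> Tp Tm (piece v) e"
  let ?s = "face_size e"
  let ?m = "measure (face_measure e) UNIV"
  have s: "?s > 0"
    by (rule face_size_pos[OF e])
  have M: "average \<T> Tp Tm (grad_piece v) e x *v outward_normal (Tp e) e = M" for x
    unfolding M_def by (subst average_grad_const[OF v e]) simp
  have cont: "continuous_on UNIV ?J"
    by (rule jump_continuous[OF v e])
  have "norm M \<le> norm (average \<T> Tp Tm (grad_piece v) e 0)"
    using norm_matrix_vector_le[of "average \<T> Tp Tm (grad_piece v) e 0" "outward_normal (Tp e) e"]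
      facet_normal_norm[OF simplex Tp(2)] Tp(1) e by (simp add: M_def)
  then have "(norm M)\<^sup>2 \<le> (norm (average \<T> Tp Tm (grad_piece v) e 0))\<^sup>2"
    by (intro power_mono) auto
  then have MM: "M \<bullet> M \<le> (\<Sum>T | T \<in> \<T> \<and> e facet_of T. (norm (grad_piece v T 0))\<^sup>2)"
    using norm_average_grad_le[OF e, of v] by (simp add: power2_norm_eq_inner)
  have "2 * (LINT x|face_measure e. M \<bullet> ?J x) = (LINT x|face_measure e. 2 * (M \<bullet> ?J x))"
    by simp
  also have "\<dots> \<le> (LINT x|face_measure e. ?s / \<rho> * (M \<bullet> M) + \<rho> * (inverse ?s * (?J x \<bullet> ?J x)))"
  proof (rule integral_mono)
    show "2 * (M \<bullet> ?J x) \<le> ?s / \<rho> * (M \<bullet> M) + \<rho> * (inverse ?s * (?J x \<bullet> ?J x))" for x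
      using weighted_Young[of "?s / \<rho>" M "?J x"] s \<rho> by (simp add: field_simps)
  qed (intro face_integrable e continuous_intros cont)+
  also have "\<dots> = (LINT x|face_measure e. ?s / \<rho> * (M \<bullet> M)) + (LINT x|face_measure e. \<rho> * (inverse ?s * (?J x \<bullet> ?J x)))"
    by (intro Bochner_Integration.integral_add face_integrable e continuous_intros cont)
  also have "(LINT x|face_measure e. ?s / \<rho> * (M \<bullet> M)) = ?m * ?s / \<rho> * (M \<bullet> M)"
    by (simp add: face_measure_def mult_ac)
  also have "\<dots> \<le> ?m * ?s / \<rho> * (\<Sum>T | T \<in> \<T> \<and> e facet_of T. (norm (grad_piece v T 0))\<^sup>2)"
    using MM s \<rho> by (intro mult_left_mono) auto
  finally show ?thesis
    by (simp add: M)
qed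

text \<open>The penalty cancels against its copy in the consistency bound. What is left on the faces is summed over the
  elements: each of the \<open>d + 1\<close> facets of \<open>T\<close> takes at most the fraction \<open>1 / (d + 1)\<close> of the energy on \<open>T\<close>.\<close>

lemma form_a_nonneg:
  assumes d: "CARD('n) \<ge> 2" and reg: "shape_regular \<sigma> \<T>" and v: "v \<in> piecewise P1 \<T>"
    and \<rho>: "\<rho> > 0" "(real CARD('n) + 1) * ((real CARD('n))\<^sup>2 * \<bar>\<sigma>\<bar>) \<le> \<rho>"
  shows "form_a \<T> Tp Tm \<rho> v v \<ge> 0"
proof -
  let ?K = "(real CARD('n))\<^sup>2 * \<bar>\<sigma>\<bar>"
  let ?G = "\<lambda>T. (norm (grad_piece v T 0))\<^sup>2"
  let ?m = "\<lambda>e. measure (face_measure e) UNIV * face_size e / \<rho>"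
  let ?C = "\<lambda>e. LINT x|face_measure e. (average \<T> Tp Tm (grad_piece v) e x *v outward_normal (Tp e) e) \<bullet> jump \<T> Tp Tm (piece v) e x"
  let ?P = "\<lambda>e. LINT x|face_measure e. inverse (face_size e) * (jump \<T> Tp Tm (piece v) e x \<bullet> jump \<T> Tp Tm (piece v) e x)"
  have vol: "(LINT x|lebesgue_on T. grad_piece v T x \<bullet> grad_piece v T x) = measure lebesgue T * ?G T" if T: "T \<in> \<T>" for T
  proof -
    have "(LINT x|lebesgue_on T. grad_piece v T x \<bullet> grad_piece v T x) = (LINT x|lebesgue_on T. ?G T)"
      by (subst (1 2) grad_piece_const[OF v T]) (simp add: power2_norm_eq_inner)
    also have "\<dots> = measure lebesgue T * ?G T"
      using element_sets[OF T] by (simp add: measure_restrict_space)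
    finally show ?thesis .
  qed
  have "2 * (\<Sum>e\<in>faces \<T>. ?C e) - \<rho> * (\<Sum>e\<in>faces \<T>. ?P e) = (\<Sum>e\<in>faces \<T>. 2 * ?C e - \<rho> * ?P e)"
    by (simp only: sum_distrib_left sum_subtractf)
  also have "\<dots> \<le> (\<Sum>e\<in>faces \<T>. ?m e * (\<Sum>T | T \<in> \<T> \<and> e facet_of T. ?G T))"
  proof (rule sum_mono)
    fix e assume "e \<in> faces \<T>"
    from face_consistency_le[OF v this \<rho>(1)]
    show "2 * ?C e - \<rho> * ?P e \<le> ?m e * (\<Sum>T | T \<in> \<T> \<and> e facet_of T. ?G T)"
      by linarith
  qed
  also have "\<dots> = (\<Sum>T\<in>\<T>. \<Sum>e | e facet_of T. ?m e * ?G T)"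
    by (simp only: sum_distrib_left sum_faces_adjacent)
  also have "\<dots> \<le> (\<Sum>T\<in>\<T>. measure lebesgue T * ?G T)"
  proof (rule sum_mono)
    fix T assume T: "T \<in> \<T>"
    have "(\<Sum>e | e facet_of T. ?m e * ?G T) \<le> (\<Sum>e | e facet_of T. ?K * measure lebesgue T / \<rho> * ?G T)"
    proof (intro sum_mono mult_right_mono divide_right_mono)
      fix e assume "e \<in> {e. e facet_of T}"
      then show "measure (face_measure e) UNIV * face_size e \<le> ?K * measure lebesgue T"
        using facet_area_size_le[OF simplex[OF T] _ d] reg T by (auto simp: shape_regular_def)
    qed (use \<rho> in auto)
    also have "\<dots> = ((real CARD('n) + 1) * ?K / \<rho>) * (measure lebesgue T * ?G T)"
      using simplex_facets(2)[OF simplex[OF T]] by simp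
    also have "\<dots> \<le> 1 * (measure lebesgue T * ?G T)"
      using \<rho> by (intro mult_right_mono) auto
    finally show "(\<Sum>e | e facet_of T. ?m e * ?G T) \<le> measure lebesgue T * ?G T"
      by simp
  qed
  finally show ?thesis
    unfolding form_a_def by (simp only: vol cong: sum.cong)
qed

lemma form_c_face_nonneg:
  assumes "e \<in> faces \<T>"
  shows "0 \<le> (LINT x|face_measure e. face_size e * (jump \<T> Tp Tm (piece v) e x \<bullet> jump \<T> Tp Tm (piece v) e x))"
  using face_size_pos[OF assms] by (intro integral_nonneg_AE AE_I2) auto

lemma form_c_definite:
  assumes v: "v \<in> piecewise P1 \<T>" and \<rho>: "\<rho> \<ge> 0" and le: "form_c \<T> Tp Tm \<rho> v v \<le> 0" and T: "T \<in> \<T>"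
  shows "piece v T = (\<lambda>x. 0)"
proof -
  have nonneg: "\<And>T. T \<in> \<T> \<Longrightarrow> 0 \<le> (LINT x|lebesgue_on T. v x \<bullet> v x)"
    by simp
  then have "0 \<le> (\<Sum>T\<in>\<T>. LINT x|lebesgue_on T. v x \<bullet> v x)"
    by (rule sum_nonneg)
  moreover
  have "0 \<le> \<rho> * (\<Sum>e\<in>faces \<T>. LINT x|face_measure e. face_size e * (jump \<T> Tp Tm (piece v) e x \<bullet> jump \<T> Tp Tm (piece v) e x))"
    using \<rho> by (intro mult_nonneg_nonneg sum_nonneg form_c_face_nonneg)
  ultimately have "(\<Sum>T\<in>\<T>. LINT x|lebesgue_on T. v x \<bullet> v x) = 0"
    using le unfolding form_c_def by linarith
  then have "(LINT x|lebesgue_on T. v x \<bullet> v x) = 0"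
    using sum_nonneg_0[OF fin, of "\<lambda>T. LINT x|lebesgue_on T. v x \<bullet> v x" T] nonneg T by blast
  then have "(LINT x|lebesgue_on T. piece v T x \<bullet> piece v T x) = 0"
    by (simp only: element_inner_integral[OF T v v])
  moreover have "integrable (lebesgue_on T) (\<lambda>x. piece v T x \<bullet> piece v T x)"
    by (intro element_integrable T continuous_intros piece_continuous v)
  ultimately have "AE x in lebesgue_on T. piece v T x \<bullet> piece v T x = 0"
    by (subst (asm) integral_nonneg_eq_0_iff_AE) auto
  then have "AE x in lebesgue_on T. piece v T x = 0"
    by simp
  then show ?thesis
    by (intro P1_eq_if_AE[OF simplex[OF T] piece_piecewise(1)[OF v T] P1_const])
qed

section \<open>Injectivity of the pressure coupling\<close>

text \<open>The general element of \<open>Dh\<close>, up to null sets: on the common boundary of several elements their contributions add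
  up.\<close>

definition bubbles :: "((real ^ 'n) set \<Rightarrow> real) \<Rightarrow> real ^ 'n \<Rightarrow> real ^ 'n" where
  "bubbles k x = (\<Sum>T\<in>\<T>. indicator T x *\<^sub>R (k T *\<^sub>R (x - barycenter T)))"

lemma bubbles_restricts_to:
  assumes T: "T \<in> \<T>"
  shows "restricts_to (bubbles k) T (\<lambda>x. k T *\<^sub>R (x - barycenter T))"
proof -
  define N where "N = (\<Union>T'\<in>\<T> - {T}. T \<inter> T')"
  have "negligible N"
    unfolding N_def using fin mesh_Int_negligible[OF mesh T] by (intro negligible_Union) auto
  then have "AE x in lebesgue. x \<notin> N"
    by (simp add: negligible_iff_null_sets AE_not_in)
  then have "AE x in lebesgue_on T. x \<notin> N"
    using element_sets[OF T] by (subst AE_restrict_space_iff) auto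
  then show ?thesis
    unfolding restricts_to_def
  proof (rule AE_mp, intro AE_I2 impI)
    fix x assume x: "x \<in> space (lebesgue_on T)" "x \<notin> N"
    have "bubbles k x = indicator T x *\<^sub>R (k T *\<^sub>R (x - barycenter T)) + (\<Sum>T'\<in>\<T> - {T}. indicator T' x *\<^sub>R (k T' *\<^sub>R (x - barycenter T')))"
      unfolding bubbles_def using fin T by (rule sum.remove)
    also have "(\<Sum>T'\<in>\<T> - {T}. indicator T' x *\<^sub>R (k T' *\<^sub>R (x - barycenter T'))) = 0"
      using x by (intro sum.neutral) (auto simp: indicator_def N_def)
    finally show "bubbles k x = k T *\<^sub>R (x - barycenter T)"
      using x by simp
  qed
qed

lemma bubbles_L2:
  assumes \<Omega>: "open \<Omega>" "bounded \<Omega>"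
  shows "bubbles k \<in> L2 \<Omega>"
proof -
  have meas: "bubbles k \<in> borel_measurable borel"
    unfolding bubbles_def using closed_simplex[OF simplex]
    by (intro borel_measurable_sum borel_measurable_scaleR borel_measurable_indicator) auto
  then have "bubbles k \<in> borel_measurable lebesgue"
    by (simp add: measurable_completion)
  then have meas': "bubbles k \<in> borel_measurable (lebesgue_on \<Omega>)"
    by (rule measurable_restrict_space1)
  have "\<Omega> \<in> lmeasurable"
    using \<Omega> by (intro bounded_set_imp_lmeasurable) auto
  then interpret finite_measure "lebesgue_on \<Omega>"
    by (rule finite_measure_lebesgue_on)
  obtain B where B: "\<forall>x\<in>\<Omega>. norm x \<le> B"
    using \<Omega>(2) by (auto simp: bounded_iff)
  have bound: "norm (bubbles k x) \<le> (\<Sum>T\<in>\<T>. \<bar>k T\<bar> * (B + norm (barycenter T)))" if x: "x \<in> \<Omega>" for x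
    unfolding bubbles_def
  proof (rule sum_norm_le)
    fix T
    have "norm (x - barycenter T) \<le> B + norm (barycenter T)"
      using B x norm_triangle_ineq4[of x "barycenter T"] by fastforce
    then have *: "\<bar>k T\<bar> * norm (x - barycenter T) \<le> \<bar>k T\<bar> * (B + norm (barycenter T))"
      by (rule mult_left_mono) simp
    have "norm (indicator T x *\<^sub>R (k T *\<^sub>R (x - barycenter T))) \<le> \<bar>k T\<bar> * norm (x - barycenter T)"
      by (simp add: indicator_def)
    with * show "norm (indicator T x *\<^sub>R (k T *\<^sub>R (x - barycenter T))) \<le> \<bar>k T\<bar> * (B + norm (barycenter T))"
      by linarith
  qed
  have "integrable (lebesgue_on \<Omega>) (\<lambda>x. (norm (bubbles k x))\<^sup>2)"
  proof (rule integrable_const_bound)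
    show "AE x in lebesgue_on \<Omega>. norm ((norm (bubbles k x))\<^sup>2) \<le> (\<Sum>T\<in>\<T>. \<bar>k T\<bar> * (B + norm (barycenter T)))\<^sup>2"
      using bound by (intro AE_I2) (simp add: power_mono)
    show "(\<lambda>x. (norm (bubbles k x))\<^sup>2) \<in> borel_measurable (lebesgue_on \<Omega>)"
      using meas' by measurable
  qed
  with meas' show ?thesis
    by (simp add: L2_def)
qed

lemma bubbles_Dh: "open \<Omega> \<Longrightarrow> bounded \<Omega> \<Longrightarrow> bubbles k \<in> Dh \<Omega> \<T>"
  using bubbles_L2 bubbles_restricts_to unfolding Dh_def by blast

lemma bubbles_piecewise: "bubbles k \<in> piecewise P1 \<T>"
  using bubbles_restricts_to P1_scaled_shift unfolding piecewise_def by blast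

lemma piece_bubbles: "T \<in> \<T> \<Longrightarrow> piece (bubbles k) T = (\<lambda>x. k T *\<^sub>R (x - barycenter T))"
  by (rule piece_eqI[OF simplex P1_scaled_shift bubbles_restricts_to])

lemma div_piece_bubbles:
  assumes "T \<in> \<T>"
  shows "div_piece (bubbles k) T x = real CARD('n) * k T"
proof -
  have "linear (\<lambda>x :: real ^ 'n. k T *\<^sub>R x)"
    by simp
  then have "grad_piece (bubbles k) T x = matrix (\<lambda>x. k T *\<^sub>R x)"
    using P1_jacobian[of "\<lambda>x. k T *\<^sub>R x" "- (k T *\<^sub>R barycenter T)" x]
    by (simp add: grad_piece_def piece_bubbles[OF assms] algebra_simps)
  then show ?thesis
    by (simp add: div_piece_def trace_def matrix_def)
qed

text \<open>The factor \<open>1 / |T|\<close> makes the flux through a facet of \<open>T\<close> equal to \<open>c\<^sub>T d / (d + 1)\<close>, independently of the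
  facet. The divergence term \<open>d c\<^sub>T\<^sup>2\<close> is distributed evenly over the \<open>d + 1\<close> facets of \<open>T\<close>. Then boundary faces cancel,
  and an interior face leaves \<open>a\<^sup>2 + b\<^sup>2 - (a + b)\<^sup>2 / 2 = (a - b)\<^sup>2 / 2\<close>.\<close>

lemma form_b_bubbles:
  assumes q: "q \<in> piecewise P1 \<T>" and c: "\<And>T. T \<in> \<T> \<Longrightarrow> piece q T = (\<lambda>x. c T)"
  shows "form_b \<T> Tp Tm (bubbles (\<lambda>T. c T / measure lebesgue T)) q =
    (\<Sum>e\<in>interior_faces \<T>. CARD('n) / (CARD('n) + 1) * (c (Tp e) - c (Tm e))\<^sup>2 / 2)"
proof -
  let ?k = "\<lambda>T. c T / measure lebesgue T"
  let ?\<kappa> = "CARD('n) / (CARD('n) + 1)"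
  let ?v = "bubbles ?k"
  have elem: "(LINT x|lebesgue_on T. div_piece ?v T x * q x) = (\<Sum>e | e facet_of T. ?\<kappa> * (c T)\<^sup>2)" if T: "T \<in> \<T>" for T
  proof -
    have "(LINT x|lebesgue_on T. div_piece ?v T x * q x) = (LINT x|lebesgue_on T. div_piece ?v T x * piece q T x)"
      by (rule form_b_element_integral[OF bubbles_piecewise q T])
    also have "(\<lambda>x. div_piece ?v T x * piece q T x) = (\<lambda>x. CARD('n) * ?k T * c T)"
      by (rule ext) (subst div_piece_bubbles[OF T], subst c[OF T], rule refl)
    also have "(LINT x|lebesgue_on T. CARD('n) * ?k T * c T) = measure lebesgue T * (CARD('n) * ?k T * c T)"
      using element_sets[OF T] by (simp add: measure_restrict_space)
    also have "\<dots> = CARD('n) * (c T)\<^sup>2"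
    proof -
      have "measure lebesgue T > 0"
        by (rule simplex_measure_pos[OF simplex[OF T]])
      then show ?thesis
        by (simp add: power2_eq_square)
    qed
    also have "\<dots> = (\<Sum>e | e facet_of T. ?\<kappa> * (c T)\<^sup>2)"
      using simplex_facets(2)[OF simplex[OF T]] by simp
    finally show ?thesis .
  qed
  have flux: "?k T * ((x - barycenter T) \<bullet> outward_normal T e) = ?\<kappa> * c T / measure (face_measure e) UNIV"
    if "T \<in> \<T>" "e facet_of T" "x \<in> e" for T e x
  proof -
    let ?D = "(x - barycenter T) \<bullet> outward_normal T e" and ?m = "measure (face_measure e) UNIV"
    note pos = simplex_measure_pos[OF simplex[OF that(1)]] facet_area_pos[OF simplex[OF that(1)] that(2)]
    have "?m * ?D = ?\<kappa> * measure lebesgue T"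
      by (rule facet_flux[OF simplex[OF that(1)] that(2,3)])
    then have "?D = ?\<kappa> * measure lebesgue T / ?m"
      using pos by (metis nonzero_mult_div_cancel_left less_irrefl)
    then show ?thesis
      using pos by simp
  qed
  have face: "(LINT x|face_measure e. (jump \<T> Tp Tm (piece ?v) e x \<bullet> outward_normal (Tp e) e) * average \<T> Tp Tm (piece q) e x) =
    (if e \<in> interior_faces \<T> then ?\<kappa> * (c (Tp e) + c (Tm e))\<^sup>2 / 2 else ?\<kappa> * (c (Tp e))\<^sup>2)" (is "?I = ?F")
    if e: "e \<in> faces \<T>" for e
  proof -
    let ?m = "measure (face_measure e) UNIV"
    note T = Tp[OF e]
    have m: "?m > 0"
      by (rule facet_area_pos[OF simplex[OF T(1)] T(2)])
    have "(jump \<T> Tp Tm (piece ?v) e x \<bullet> outward_normal (Tp e) e) * average \<T> Tp Tm (piece q) e x = ?F / ?m" if x: "x \<in> e" for x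
    proof (cases "e \<in> interior_faces \<T>")
      case True
      note T' = Tm[OF True]
      have opp: "outward_normal (Tp e) e = - outward_normal (Tm e) e"
        using mesh_facts[OF mesh] T T' simplex by (intro opposite_normals) auto
      have "jump \<T> Tp Tm (piece ?v) e x \<bullet> outward_normal (Tp e) e =
        ?k (Tp e) * ((x - barycenter (Tp e)) \<bullet> outward_normal (Tp e) e) +
        ?k (Tm e) * ((x - barycenter (Tm e)) \<bullet> outward_normal (Tm e) e)"
        using True T T' by (simp add: jump_def piece_bubbles inner_diff_left[of "_ *\<^sub>R _"] opp)
      also have "\<dots> = ?\<kappa> * c (Tp e) / ?m + ?\<kappa> * c (Tm e) / ?m"
        using flux T T' x by simp
      also have "\<dots> = ?\<kappa> * (c (Tp e) + c (Tm e)) / ?m"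
        by (simp add: distrib_left add_divide_distrib)
      finally have A: "jump \<T> Tp Tm (piece ?v) e x \<bullet> outward_normal (Tp e) e = ?\<kappa> * (c (Tp e) + c (Tm e)) / ?m" .
      have B: "average \<T> Tp Tm (piece q) e x = (c (Tp e) + c (Tm e)) / 2"
        using True T T' by (simp add: average_def c)
      show ?thesis
        unfolding A B using True by (simp add: power2_eq_square mult_ac)
    next
      case False
      have A: "jump \<T> Tp Tm (piece ?v) e x \<bullet> outward_normal (Tp e) e = ?\<kappa> * c (Tp e) / ?m"
        using False T flux[OF T x] by (simp add: jump_def piece_bubbles)
      have B: "average \<T> Tp Tm (piece q) e x = c (Tp e)"
        using False T by (simp add: average_def c)
      show ?thesis
        unfolding A B using False by (simp add: power2_eq_square mult_ac)
    qed
    then have "AE x in face_measure e. (jump \<T> Tp Tm (piece ?v) e x \<bullet> outward_normal (Tp e) e) * average \<T> Tp Tm (piece q) e x = ?F / ?m"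
      using facet_AE[OF simplex[OF T(1)] T(2)] by auto
    then have "?I = (LINT x|face_measure e. ?F / ?m)"
      by (intro integral_cong_AE borel_measurable_integrable face_integrable e continuous_intros jump_continuous average_continuous
        bubbles_piecewise q) auto
    also have "\<dots> = ?F"
      using m by (simp add: face_measure_def)
    finally show ?thesis .
  qed
  have "(\<Sum>T\<in>\<T>. LINT x|lebesgue_on T. div_piece ?v T x * q x) = (\<Sum>e\<in>faces \<T>. \<Sum>T | T \<in> \<T> \<and> e facet_of T. ?\<kappa> * (c T)\<^sup>2)"
    unfolding sum_faces_adjacent by (intro sum.cong refl elem)
  then have "form_b \<T> Tp Tm ?v q = (\<Sum>e\<in>faces \<T>. (\<Sum>T | T \<in> \<T> \<and> e facet_of T. ?\<kappa> * (c T)\<^sup>2) -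
    (if e \<in> interior_faces \<T> then ?\<kappa> * (c (Tp e) + c (Tm e))\<^sup>2 / 2 else ?\<kappa> * (c (Tp e))\<^sup>2))"
    unfolding form_b_def sum_subtractf by (simp only: face cong: sum.cong)
  also have "\<dots> = (\<Sum>e\<in>faces \<T>. if e \<in> interior_faces \<T> then ?\<kappa> * (c (Tp e) - c (Tm e))\<^sup>2 / 2 else 0)"
  proof (rule sum.cong[OF refl])
    fix e assume e: "e \<in> faces \<T>"
    show "(\<Sum>T | T \<in> \<T> \<and> e facet_of T. ?\<kappa> * (c T)\<^sup>2) -
      (if e \<in> interior_faces \<T> then ?\<kappa> * (c (Tp e) + c (Tm e))\<^sup>2 / 2 else ?\<kappa> * (c (Tp e))\<^sup>2) =
      (if e \<in> interior_faces \<T> then ?\<kappa> * (c (Tp e) - c (Tm e))\<^sup>2 / 2 else 0)"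
    proof (cases "e \<in> interior_faces \<T>")
      case True
      define \<kappa> where "\<kappa> = ?\<kappa>"
      have "\<kappa> * a\<^sup>2 + \<kappa> * b\<^sup>2 - \<kappa> * (a + b)\<^sup>2 / 2 = \<kappa> * (a - b)\<^sup>2 / 2" for a b
        by (simp add: power2_eq_square field_simps)
      then show ?thesis
        using True Tm(3)[OF True] unfolding adjacent[OF e] \<kappa>_def[symmetric] by simp
    qed (simp add: adjacent[OF e])
  qed
  also have "\<dots> = (\<Sum>e\<in>interior_faces \<T>. ?\<kappa> * (c (Tp e) - c (Tm e))\<^sup>2 / 2)"
    using finite_faces by (subst sum.inter_restrict[symmetric]) (auto simp: interior_faces_def faces_def intro!: sum.cong)
  finally show ?thesis .
qed

lemma form_b_injective:
  assumes \<Omega>: "open \<Omega>" "connected \<Omega>" "bounded \<Omega>" and q: "q \<in> piecewise P0 \<T>"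
    and b: "\<And>v. v \<in> Dh \<Omega> \<T> \<Longrightarrow> form_b \<T> Tp Tm v q = 0"
  shows "\<exists>c. \<forall>T\<in>\<T>. piece q T = (\<lambda>x. c)"
proof -
  have q1: "q \<in> piecewise P1 \<T>"
    using q P0_subset_P1 unfolding piecewise_def by blast
  define c where "c T = piece q T 0" for T
  have c: "piece q T = (\<lambda>x. c T)" if T: "T \<in> \<T>" for T
  proof -
    obtain g where g: "g \<in> P0" "restricts_to q T g"
      using q T by (auto simp: piecewise_def)
    then have "piece q T = g"
      using P0_subset_P1 by (intro piece_eqI[OF simplex[OF T]]) auto
    then show ?thesis
      using g(1) by (auto simp: P0_def c_def)
  qed
  have fin_int: "finite (interior_faces \<T>)"
    by (rule finite_subset[OF _ finite_faces]) (auto simp: interior_faces_def faces_def)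
  have "(\<Sum>e\<in>interior_faces \<T>. CARD('n) / (CARD('n) + 1) * (c (Tp e) - c (Tm e))\<^sup>2 / 2) = 0"
    using form_b_bubbles[OF q1 c] b[OF bubbles_Dh[OF \<Omega>(1,3)]] by simp
  then have "\<forall>e\<in>interior_faces \<T>. CARD('n) / (CARD('n) + 1) * (c (Tp e) - c (Tm e))\<^sup>2 / 2 = 0"
    by (subst (asm) sum_nonneg_eq_0_iff[OF fin_int]) auto
  then have eq: "c (Tp e) = c (Tm e)" if "e \<in> interior_faces \<T>" for e
    using that by simp
  have step: "c T = c T'" if "T \<in> \<T>" "T' \<in> \<T>" "e facet_of T" "e facet_of T'" for T T' e
  proof (cases "T = T'")
    case False
    then have e: "e \<in> interior_faces \<T>" "e \<in> faces \<T>"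
      using that by (auto simp: interior_faces_def faces_def)
    have "T \<in> {Tp e, Tm e}" "T' \<in> {Tp e, Tm e}"
      using adjacent[OF e(2)] that e(1) by auto
    then show ?thesis
      using eq[OF e(1)] by auto
  qed simp
  have "c T = c T'" if "T \<in> \<T>" "T' \<in> \<T>" for T T'
    by (rule mesh_facet_connected[where Q=c, OF mesh \<Omega>(1,2) step]) (assumption | rule that)+
  then have "\<exists>d. \<forall>T\<in>\<T>. c T = d"
    by blast
  then show ?thesis
    using c by auto
qed

end

section \<open>Linear combinations in the function spaces\<close>

lemma norm_lincomb_power2_le:
  fixes u v :: "'a::real_normed_vector"
  shows "(norm (a *\<^sub>R u + b *\<^sub>R v))\<^sup>2 \<le> 2 * a\<^sup>2 * (norm u)\<^sup>2 + 2 * b\<^sup>2 * (norm v)\<^sup>2"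
proof -
  have "(norm (a *\<^sub>R u + b *\<^sub>R v))\<^sup>2 \<le> (\<bar>a\<bar> * norm u + \<bar>b\<bar> * norm v)\<^sup>2"
    using norm_triangle_ineq[of "a *\<^sub>R u" "b *\<^sub>R v"] by (intro power_mono) auto
  also have "\<dots> \<le> 2 * (\<bar>a\<bar> * norm u)\<^sup>2 + 2 * (\<bar>b\<bar> * norm v)\<^sup>2"
    using sum_squares_bound[of "\<bar>a\<bar> * norm u" "\<bar>b\<bar> * norm v"] by (simp add: power2_sum)
  finally show ?thesis
    by (simp add: power_mult_distrib)
qed

lemma L2_lincomb:
  fixes u v :: "real ^ 'n \<Rightarrow> 'b::euclidean_space"
  assumes "u \<in> L2 \<Omega>" "v \<in> L2 \<Omega>"
  shows "(\<lambda>x. a *\<^sub>R u x + b *\<^sub>R v x) \<in> L2 \<Omega>"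
    and "(LINT x|lebesgue_on \<Omega>. (norm (a *\<^sub>R u x + b *\<^sub>R v x))\<^sup>2) \<le>
      2 * a\<^sup>2 * (LINT x|lebesgue_on \<Omega>. (norm (u x))\<^sup>2) + 2 * b\<^sup>2 * (LINT x|lebesgue_on \<Omega>. (norm (v x))\<^sup>2)"
proof -
  have [measurable]: "u \<in> borel_measurable (lebesgue_on \<Omega>)" "v \<in> borel_measurable (lebesgue_on \<Omega>)"
    and int: "integrable (lebesgue_on \<Omega>) (\<lambda>x. (norm (u x))\<^sup>2)" "integrable (lebesgue_on \<Omega>) (\<lambda>x. (norm (v x))\<^sup>2)"
    using assms by (auto simp: L2_def)
  have int2: "integrable (lebesgue_on \<Omega>) (\<lambda>x. 2 * a\<^sup>2 * (norm (u x))\<^sup>2 + 2 * b\<^sup>2 * (norm (v x))\<^sup>2)"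
    using int by simp
  have int3: "integrable (lebesgue_on \<Omega>) (\<lambda>x. (norm (a *\<^sub>R u x + b *\<^sub>R v x))\<^sup>2)"
    by (rule Bochner_Integration.integrable_bound[OF int2]) (auto intro!: AE_I2 norm_lincomb_power2_le)
  then show "(\<lambda>x. a *\<^sub>R u x + b *\<^sub>R v x) \<in> L2 \<Omega>"
    by (simp add: L2_def)
  have "(LINT x|lebesgue_on \<Omega>. (norm (a *\<^sub>R u x + b *\<^sub>R v x))\<^sup>2) \<le>
    (LINT x|lebesgue_on \<Omega>. 2 * a\<^sup>2 * (norm (u x))\<^sup>2 + 2 * b\<^sup>2 * (norm (v x))\<^sup>2)"
    by (intro integral_mono int2 int3 norm_lincomb_power2_le)
  also have "\<dots> = 2 * a\<^sup>2 * (LINT x|lebesgue_on \<Omega>. (norm (u x))\<^sup>2) + 2 * b\<^sup>2 * (LINT x|lebesgue_on \<Omega>. (norm (v x))\<^sup>2)"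
    using int by simp
  finally show "(LINT x|lebesgue_on \<Omega>. (norm (a *\<^sub>R u x + b *\<^sub>R v x))\<^sup>2) \<le>
      2 * a\<^sup>2 * (LINT x|lebesgue_on \<Omega>. (norm (u x))\<^sup>2) + 2 * b\<^sup>2 * (LINT x|lebesgue_on \<Omega>. (norm (v x))\<^sup>2)" .
qed

lemma L2_inner_integrable:
  fixes u v :: "real ^ 'n \<Rightarrow> 'b::euclidean_space"
  assumes "u \<in> L2 \<Omega>" "v \<in> L2 \<Omega>"
  shows "integrable (lebesgue_on \<Omega>) (\<lambda>x. u x \<bullet> v x)"
proof -
  have [measurable]: "u \<in> borel_measurable (lebesgue_on \<Omega>)" "v \<in> borel_measurable (lebesgue_on \<Omega>)"
    and int: "integrable (lebesgue_on \<Omega>) (\<lambda>x. (norm (u x))\<^sup>2)" "integrable (lebesgue_on \<Omega>) (\<lambda>x. (norm (v x))\<^sup>2)"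
    using assms by (auto simp: L2_def)
  have bound: "\<bar>u x \<bullet> v x\<bar> \<le> (norm (u x))\<^sup>2 + (norm (v x))\<^sup>2" for x
  proof -
    have "\<bar>u x \<bullet> v x\<bar> \<le> norm (u x) * norm (v x)"
      by (rule Cauchy_Schwarz_ineq2)
    moreover have "0 \<le> norm (u x) * norm (v x)"
      by simp
    ultimately show ?thesis
      using sum_squares_bound[of "norm (u x)" "norm (v x)"] by linarith
  qed
  show ?thesis
    by (rule Bochner_Integration.integrable_bound[of _ "\<lambda>x. (norm (u x))\<^sup>2 + (norm (v x))\<^sup>2"])
      (use int bound in auto)
qed

text \<open>Continuous functions are bounded on the compact closure of \<open>\<Omega>\<close>.\<close>

lemma L2_continuous:
  fixes g :: "real ^ 'n \<Rightarrow> 'b::euclidean_space"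
  assumes \<Omega>: "open \<Omega>" "bounded \<Omega>" and g: "continuous_on UNIV g"
  shows "g \<in> L2 \<Omega>"
proof -
  have "g \<in> borel_measurable lebesgue"
    using borel_measurable_continuous_onI[OF g] by (simp add: measurable_completion)
  then have meas [measurable]: "g \<in> borel_measurable (lebesgue_on \<Omega>)"
    by (rule measurable_restrict_space1)
  have "\<Omega> \<in> lmeasurable"
    using \<Omega> by (intro bounded_set_imp_lmeasurable) auto
  then interpret finite_measure "lebesgue_on \<Omega>"
    by (rule finite_measure_lebesgue_on)
  have "compact (closure \<Omega>)"
    using \<Omega>(2) by simp
  then have "bounded (g ` closure \<Omega>)"
    using g continuous_on_subset by (intro compact_imp_bounded compact_continuous_image) blast
  then obtain B where B: "\<forall>x\<in>closure \<Omega>. norm (g x) \<le> B"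
    by (auto simp: bounded_iff)
  have "integrable (lebesgue_on \<Omega>) (\<lambda>x. (norm (g x))\<^sup>2)"
  proof (rule integrable_const_bound)
    show "AE x in lebesgue_on \<Omega>. norm ((norm (g x))\<^sup>2) \<le> B\<^sup>2"
      using B closure_subset[of \<Omega>] by (intro AE_I2) (auto intro!: power_mono)
  qed measurable
  then show ?thesis
    using meas by (simp add: L2_def)
qed

lemma partial_lincomb:
  assumes "\<forall>x. \<phi> differentiable (at x)" "\<forall>x. \<psi> differentiable (at x)"
  shows "partial i (\<lambda>x. a * \<phi> x + b * \<psi> x) = (\<lambda>x. a * partial i \<phi> x + b * partial i \<psi> x)"
proof
  fix x
  have "(\<phi> has_derivative frechet_derivative \<phi> (at x)) (at x)" "(\<psi> has_derivative frechet_derivative \<psi> (at x)) (at x)"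
    using assms frechet_derivative_works by blast+
  then have "((\<lambda>x. a * \<phi> x + b * \<psi> x) has_derivative
    (\<lambda>h. a * frechet_derivative \<phi> (at x) h + b * frechet_derivative \<psi> (at x) h)) (at x)"
    by (intro has_derivative_add has_derivative_mult_right)
  then show "partial i (\<lambda>x. a * \<phi> x + b * \<psi> x) x = a * partial i \<phi> x + b * partial i \<psi> x"
    by (simp add: partial_def frechet_derivative_at[symmetric])
qed

lemma C_diff_lincomb:
  assumes "C_diff k \<phi>" "C_diff k \<psi>"
  shows "C_diff k (\<lambda>x. a * \<phi> x + b * \<psi> x)"
  using assms
proof (induction k arbitrary: \<phi> \<psi>)
  case (Suc k)
  then show ?case
    by (auto simp: partial_lincomb intro!: derivative_intros)
qed (auto intro!: continuous_intros)

lemma C_diff_zero: "C_diff k (\<lambda>x :: real ^ 'n. 0)"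
proof (induction k)
  case (Suc k)
  have "partial i (\<lambda>x. 0 :: real) = (\<lambda>x :: real ^ 'n. 0)" for i
    by (simp add: partial_def fun_eq_iff)
  with Suc show ?case
    by simp
qed simp

lemma test_functions_lincomb:
  assumes "\<phi> \<in> test_functions \<Omega>" "\<psi> \<in> test_functions \<Omega>"
  shows "(\<lambda>x. a * \<phi> x + b * \<psi> x) \<in> test_functions \<Omega>"
proof -
  let ?s = "\<lambda>\<phi> :: real ^ 'n \<Rightarrow> real. closure {x. \<phi> x \<noteq> 0}"
  have "{x. a * \<phi> x + b * \<psi> x \<noteq> 0} \<subseteq> {x. \<phi> x \<noteq> 0} \<union> {x. \<psi> x \<noteq> 0}"
    by auto
  note sub = this
  have "?s (\<lambda>x. a * \<phi> x + b * \<psi> x) \<subseteq> ?s \<phi> \<union> ?s \<psi>"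
    using closure_mono[OF sub] by simp
  moreover have "?s \<phi> \<subseteq> \<Omega>" "?s \<psi> \<subseteq> \<Omega>"
    using assms by (simp_all add: test_functions_def)
  ultimately have "?s (\<lambda>x. a * \<phi> x + b * \<psi> x) \<subseteq> \<Omega>"
    by blast
  moreover have "bounded {x. \<phi> x \<noteq> 0}" "bounded {x. \<psi> x \<noteq> 0}"
    using assms by (simp_all add: test_functions_def)
  then have "bounded {x. a * \<phi> x + b * \<psi> x \<noteq> 0}"
    by (intro bounded_subset[OF _ sub]) simp
  moreover have "\<forall>k. C_diff k (\<lambda>x. a * \<phi> x + b * \<psi> x)"
    using assms by (simp add: test_functions_def C_diff_lincomb)
  ultimately show ?thesis
    by (simp add: test_functions_def)
qed

lemma test_functions_regular:
  assumes "\<phi> \<in> test_functions \<Omega>"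
  shows "continuous_on UNIV \<phi>" "continuous_on UNIV (partial i \<phi>)" "continuous_on UNIV (gradient \<phi>)"
    "\<forall>x. \<phi> differentiable (at x)"
proof -
  have *: "C_diff 0 \<phi>" "C_diff (Suc 0) \<phi>"
    using assms by (auto simp only: test_functions_def)
  then show "continuous_on UNIV \<phi>" "\<forall>x. \<phi> differentiable (at x)" and p: "continuous_on UNIV (partial i \<phi>)" for i
    by simp_all
  show "continuous_on UNIV (gradient \<phi>)"
    unfolding gradient_def using p by (intro continuous_on_vec_lambda)
qed

lemma gradient_lincomb:
  assumes "\<forall>x. \<phi> differentiable (at x)" "\<forall>x. \<psi> differentiable (at x)"
  shows "gradient (\<lambda>x. a * \<phi> x + b * \<psi> x) x = a *\<^sub>R gradient \<phi> x + b *\<^sub>R gradient \<psi> x"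
  by (simp add: gradient_def partial_lincomb[OF assms] vec_eq_iff)

lemma weak_gradient_lincomb:
  assumes \<Omega>: "open \<Omega>" "bounded \<Omega>" and L2: "v \<in> L2 \<Omega>" "w \<in> L2 \<Omega>" "G \<in> L2 \<Omega>" "H \<in> L2 \<Omega>"
    and G: "weak_gradient \<Omega> v G" and H: "weak_gradient \<Omega> w H"
  shows "weak_gradient \<Omega> (\<lambda>x. a * v x + b * w x) (\<lambda>x. a *\<^sub>R G x + b *\<^sub>R H x)"
  unfolding weak_gradient_def
proof (intro ballI allI)
  fix \<phi> i assume \<phi>: "\<phi> \<in> test_functions \<Omega>"
  note reg = test_functions_regular[OF \<phi>]
  have "partial i \<phi> \<in> L2 \<Omega>"
    by (rule L2_continuous[OF \<Omega> reg(2)])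
  then have int: "integrable (lebesgue_on \<Omega>) (\<lambda>x. v x * partial i \<phi> x)" "integrable (lebesgue_on \<Omega>) (\<lambda>x. w x * partial i \<phi> x)"
    using L2_inner_integrable[OF L2(1)] L2_inner_integrable[OF L2(2)] by auto
  have "(\<lambda>x. \<phi> x *\<^sub>R axis i 1) \<in> (L2 \<Omega> :: (real ^ 'a \<Rightarrow> real ^ 'a) set)"
    by (intro L2_continuous[OF \<Omega>] continuous_intros reg(1))
  then have int': "integrable (lebesgue_on \<Omega>) (\<lambda>x. G x $ i * \<phi> x)" "integrable (lebesgue_on \<Omega>) (\<lambda>x. H x $ i * \<phi> x)"
    using L2_inner_integrable[OF L2(3)] L2_inner_integrable[OF L2(4)] by (fastforce simp: inner_axis mult.commute)+
  have "(LINT x|lebesgue_on \<Omega>. (a * v x + b * w x) * partial i \<phi> x) =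
    a * (LINT x|lebesgue_on \<Omega>. v x * partial i \<phi> x) + b * (LINT x|lebesgue_on \<Omega>. w x * partial i \<phi> x)"
    using int by (simp add: distrib_right mult.assoc)
  also have "\<dots> = - (a * (LINT x|lebesgue_on \<Omega>. G x $ i * \<phi> x) + b * (LINT x|lebesgue_on \<Omega>. H x $ i * \<phi> x))"
    using G H \<phi> unfolding weak_gradient_def by simp
  also have "\<dots> = - (LINT x|lebesgue_on \<Omega>. (a *\<^sub>R G x + b *\<^sub>R H x) $ i * \<phi> x)"
    using int' by (simp add: distrib_right mult.assoc)
  finally show "(LINT x|lebesgue_on \<Omega>. (a * v x + b * w x) * partial i \<phi> x) =
    - (LINT x|lebesgue_on \<Omega>. (a *\<^sub>R G x + b *\<^sub>R H x) $ i * \<phi> x)" .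
qed

text \<open>The same linear combinations of the approximating test functions converge, because
  \<open>|a f + b g|\<^sup>2 \<le> 2 a\<^sup>2 |f|\<^sup>2 + 2 b\<^sup>2 |g|\<^sup>2\<close>.\<close>

lemma H10_lincomb:
  assumes \<Omega>: "open \<Omega>" "bounded \<Omega>" and v: "v \<in> H10 \<Omega>" and w: "w \<in> H10 \<Omega>"
  shows "(\<lambda>x. a * v x + b * w x) \<in> H10 \<Omega>"
proof -
  obtain G \<phi> where G: "G \<in> L2 \<Omega>" "weak_gradient \<Omega> v G" and \<phi>: "\<And>k. \<phi> k \<in> test_functions \<Omega>"
    "(\<lambda>k::nat. (LINT x|lebesgue_on \<Omega>. (\<phi> k x - v x)\<^sup>2)
              + (LINT x|lebesgue_on \<Omega>. (norm (gradient (\<phi> k) x - G x))\<^sup>2)) \<longlonglongrightarrow> 0" (is "?A \<longlonglongrightarrow> 0")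
    and L2v: "v \<in> L2 \<Omega>"
    using v unfolding H10_def by blast
  obtain H \<psi> where H: "H \<in> L2 \<Omega>" "weak_gradient \<Omega> w H" and \<psi>: "\<And>k. \<psi> k \<in> test_functions \<Omega>"
    "(\<lambda>k::nat. (LINT x|lebesgue_on \<Omega>. (\<psi> k x - w x)\<^sup>2)
              + (LINT x|lebesgue_on \<Omega>. (norm (gradient (\<psi> k) x - H x))\<^sup>2)) \<longlonglongrightarrow> 0" (is "?B \<longlonglongrightarrow> 0")
    and L2w: "w \<in> L2 \<Omega>"
    using w unfolding H10_def by blast
  let ?vw = "\<lambda>x. a * v x + b * w x" and ?GH = "\<lambda>x. a *\<^sub>R G x + b *\<^sub>R H x"
  let ?\<chi> = "\<lambda>k x. a * \<phi> k x + b * \<psi> k x"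
  let ?C = "\<lambda>k. (LINT x|lebesgue_on \<Omega>. (?\<chi> k x - ?vw x)\<^sup>2) + (LINT x|lebesgue_on \<Omega>. (norm (gradient (?\<chi> k) x - ?GH x))\<^sup>2)"
  have bound: "?C k \<le> 2 * a\<^sup>2 * ?A k + 2 * b\<^sup>2 * ?B k" for k
  proof -
    note r\<phi> = test_functions_regular[OF \<phi>(1)[of k]] and r\<psi> = test_functions_regular[OF \<psi>(1)[of k]]
    have diff: "(\<lambda>x. f x - g x) \<in> L2 \<Omega>" if "continuous_on UNIV f" "g \<in> L2 \<Omega>" for f g :: "real ^ 'a \<Rightarrow> 'c::euclidean_space"
      using L2_lincomb(1)[OF L2_continuous[OF \<Omega> that(1)] that(2), of 1 "-1"] by simp
    have "(LINT x|lebesgue_on \<Omega>. (?\<chi> k x - ?vw x)\<^sup>2) \<le>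
      2 * a\<^sup>2 * (LINT x|lebesgue_on \<Omega>. (\<phi> k x - v x)\<^sup>2) + 2 * b\<^sup>2 * (LINT x|lebesgue_on \<Omega>. (\<psi> k x - w x)\<^sup>2)"
      using L2_lincomb(2)[OF diff[OF r\<phi>(1) L2v] diff[OF r\<psi>(1) L2w], of a b] by (simp add: algebra_simps)
    moreover have "(LINT x|lebesgue_on \<Omega>. (norm (gradient (?\<chi> k) x - ?GH x))\<^sup>2) \<le>
      2 * a\<^sup>2 * (LINT x|lebesgue_on \<Omega>. (norm (gradient (\<phi> k) x - G x))\<^sup>2) + 2 * b\<^sup>2 * (LINT x|lebesgue_on \<Omega>. (norm (gradient (\<psi> k) x - H x))\<^sup>2)"
      using L2_lincomb(2)[OF diff[OF r\<phi>(3) G(1)] diff[OF r\<psi>(3) H(1)], of a b]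
      by (simp add: gradient_lincomb[OF r\<phi>(4) r\<psi>(4)] scaleR_diff_right add_diff_add)
    ultimately show ?thesis
      by (simp only: distrib_left)
  qed
  have "?C \<longlonglongrightarrow> 0"
  proof (rule tendsto_sandwich[OF _ _ tendsto_const])
    show "(\<lambda>k. 2 * a\<^sup>2 * ?A k + 2 * b\<^sup>2 * ?B k) \<longlonglongrightarrow> 0"
      using tendsto_add[OF tendsto_mult_left[OF \<phi>(2), of "2 * a\<^sup>2"] tendsto_mult_left[OF \<psi>(2), of "2 * b\<^sup>2"]] by simp
  qed (use bound in \<open>auto intro!: always_eventually add_nonneg_nonneg\<close>)
  moreover have vw: "?vw \<in> L2 \<Omega>" and GH: "?GH \<in> L2 \<Omega>"
    using L2_lincomb(1)[OF L2v L2w, of a b] L2_lincomb(1)[OF G(1) H(1)] by auto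
  moreover have "weak_gradient \<Omega> ?vw ?GH"
    by (rule weak_gradient_lincomb[OF \<Omega> L2v L2w G(1) H(1) G(2) H(2)])
  moreover have "\<forall>k. ?\<chi> k \<in> test_functions \<Omega>"
    using test_functions_lincomb[OF \<phi>(1) \<psi>(1)] by blast
  ultimately show ?thesis
    unfolding H10_def by (intro CollectI conjI bexI[OF _ GH] exI[of _ ?\<chi>])
qed

lemma H10_zero: "(\<lambda>x. 0) \<in> H10 \<Omega>"
proof -
  have zero: "(\<lambda>x. 0) \<in> L2 \<Omega>" "(\<lambda>x. 0 :: real ^ 'a) \<in> L2 \<Omega>"
    by (simp_all add: L2_def)
  have "(\<lambda>x. 0) \<in> test_functions \<Omega>"
    by (simp add: test_functions_def C_diff_zero)
  moreover have "weak_gradient \<Omega> (\<lambda>x. 0) (\<lambda>x. 0)"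
    by (simp add: weak_gradient_def)
  moreover have "gradient (\<lambda>x. 0) = (\<lambda>x. 0 :: real ^ 'a)"
    by (simp add: gradient_def partial_def fun_eq_iff vec_eq_iff)
  ultimately show ?thesis
    unfolding H10_def using zero
    by (auto intro!: bexI[of _ "\<lambda>x. 0 :: real ^ 'a"] exI[of _ "\<lambda>k x. 0"])
qed

lemma L2_components:
  fixes v :: "real ^ 'n \<Rightarrow> real ^ 'n"
  assumes "\<And>i. (\<lambda>x. v x $ i) \<in> L2 \<Omega>"
  shows "v \<in> L2 \<Omega>"
proof -
  have "(\<lambda>x. \<Sum>i\<in>UNIV. v x $ i *\<^sub>R axis i (1::real)) \<in> borel_measurable (lebesgue_on \<Omega>)"
    using assms by (intro borel_measurable_sum borel_measurable_scaleR) (auto simp: L2_def)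
  moreover have "(\<Sum>i\<in>UNIV. v x $ i *\<^sub>R axis i (1::real)) = v x" for x
    using basis_expansion[of "v x"] by (simp add: scalar_mult_eq_scaleR)
  moreover have "integrable (lebesgue_on \<Omega>) (\<lambda>x. \<Sum>i\<in>UNIV. (v x $ i)\<^sup>2)"
    using assms by (intro Bochner_Integration.integrable_sum) (auto simp: L2_def)
  moreover have "(norm (v x))\<^sup>2 = (\<Sum>i\<in>UNIV. (v x $ i)\<^sup>2)" for x
    unfolding power2_norm_eq_inner inner_vec_def by (simp add: power2_eq_square)
  ultimately show ?thesis
    by (simp add: L2_def)
qed

context sided_mesh
begin

lemma Ch_iff: "v \<in> Ch \<Omega> \<T> \<longleftrightarrow> (\<forall>i. (\<lambda>x. v x $ i) \<in> H10 \<Omega>) \<and> v \<in> piecewise P1 \<T>"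
  by (simp add: Ch_def piecewise_def)

lemma Ch_lincomb:
  assumes \<Omega>: "open \<Omega>" "bounded \<Omega>" and v: "v \<in> Ch \<Omega> \<T>" and w: "w \<in> Ch \<Omega> \<T>"
  shows "(\<lambda>x. a *\<^sub>R v x + b *\<^sub>R w x) \<in> Ch \<Omega> \<T>"
  unfolding Ch_iff
proof (intro conjI allI)
  fix i
  have "(\<lambda>x. v x $ i) \<in> H10 \<Omega>" "(\<lambda>x. w x $ i) \<in> H10 \<Omega>"
    using v w by (simp_all add: Ch_iff)
  from H10_lincomb[OF \<Omega> this, of a b] show "(\<lambda>x. (a *\<^sub>R v x + b *\<^sub>R w x) $ i) \<in> H10 \<Omega>"
    by simp
  show "(\<lambda>x. a *\<^sub>R v x + b *\<^sub>R w x) \<in> piecewise P1 \<T>"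
    by (rule piecewise_lincomb) (use v w in \<open>simp_all add: Ch_iff\<close>)
qed

lemma Dh_lincomb:
  assumes "v \<in> Dh \<Omega> \<T>" "w \<in> Dh \<Omega> \<T>"
  shows "(\<lambda>x. a *\<^sub>R v x + b *\<^sub>R w x) \<in> Dh \<Omega> \<T>"
proof -
  have "\<exists>c. restricts_to (\<lambda>x. a *\<^sub>R v x + b *\<^sub>R w x) T (\<lambda>x. c *\<^sub>R (x - barycenter T))" if "T \<in> \<T>" for T
  proof -
    have "\<exists>c. restricts_to v T (\<lambda>x. c *\<^sub>R (x - barycenter T))" "\<exists>c. restricts_to w T (\<lambda>x. c *\<^sub>R (x - barycenter T))"
      using assms that by (simp_all add: Dh_def)
    then obtain c c' where c: "restricts_to v T (\<lambda>x. c *\<^sub>R (x - barycenter T))"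
      and c': "restricts_to w T (\<lambda>x. c' *\<^sub>R (x - barycenter T))"
      by (elim exE)
    from restricts_to_lincomb[OF c c', of a b]
    have "restricts_to (\<lambda>x. a *\<^sub>R v x + b *\<^sub>R w x) T (\<lambda>x. (a * c + b * c') *\<^sub>R (x - barycenter T))"
      by (simp add: scaleR_add_left)
    then show ?thesis
      by (rule exI)
  qed
  moreover have "(\<lambda>x. a *\<^sub>R v x + b *\<^sub>R w x) \<in> L2 \<Omega>"
    by (rule L2_lincomb(1)) (use assms in \<open>simp_all add: Dh_def\<close>)
  ultimately show ?thesis
    by (simp add: Dh_def)
qed

lemma VhI: "v \<in> Ch \<Omega> \<T> \<Longrightarrow> w \<in> Dh \<Omega> \<T> \<Longrightarrow> u = (\<lambda>x. v x + w x) \<Longrightarrow> u \<in> Vh \<Omega> \<T>"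
  by (auto simp: Vh_def)

lemma Vh_lincomb:
  assumes \<Omega>: "open \<Omega>" "bounded \<Omega>" and v: "v \<in> Vh \<Omega> \<T>" and w: "w \<in> Vh \<Omega> \<T>"
  shows "(\<lambda>x. a *\<^sub>R v x + b *\<^sub>R w x) \<in> Vh \<Omega> \<T>"
proof -
  obtain v1 v2 w1 w2 where *: "v = (\<lambda>x. v1 x + v2 x)" "w = (\<lambda>x. w1 x + w2 x)" "v1 \<in> Ch \<Omega> \<T>" "w1 \<in> Ch \<Omega> \<T>"
    "v2 \<in> Dh \<Omega> \<T>" "w2 \<in> Dh \<Omega> \<T>"
    using v w by (auto simp: Vh_def)
  have "(\<lambda>x. a *\<^sub>R v x + b *\<^sub>R w x) = (\<lambda>x. (a *\<^sub>R v1 x + b *\<^sub>R w1 x) + (a *\<^sub>R v2 x + b *\<^sub>R w2 x))"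
    by (simp add: * algebra_simps)
  then show ?thesis
    by (rule VhI[OF Ch_lincomb[OF \<Omega> *(3,4)] Dh_lincomb[OF *(5,6)]])
qed

lemma Qh_lincomb:
  assumes p: "p \<in> Qh \<Omega> \<T>" and q: "q \<in> Qh \<Omega> \<T>" and \<Omega>: "open \<Omega>" "bounded \<Omega>"
  shows "(\<lambda>x. a *\<^sub>R p x + b *\<^sub>R q x) \<in> Qh \<Omega> \<T>"
proof -
  have L2: "p \<in> L2 \<Omega>" "q \<in> L2 \<Omega>" and mean: "(LINT x|lebesgue_on \<Omega>. p x) = 0" "(LINT x|lebesgue_on \<Omega>. q x) = 0"
    using assms by (auto simp: Qh_def L20_def)
  have one: "(\<lambda>x. 1 :: real) \<in> L2 \<Omega>"
    by (intro L2_continuous \<Omega> continuous_intros)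
  have "integrable (lebesgue_on \<Omega>) p" "integrable (lebesgue_on \<Omega>) q"
    using L2_inner_integrable[OF L2(1) one] L2_inner_integrable[OF L2(2) one] by auto
  then have "(LINT x|lebesgue_on \<Omega>. a *\<^sub>R p x + b *\<^sub>R q x) = 0"
    using mean by simp
  moreover have "(\<lambda>x. a *\<^sub>R p x + b *\<^sub>R q x) \<in> L2 \<Omega>"
    by (rule L2_lincomb(1)[OF L2])
  moreover have "\<exists>g\<in>P0. restricts_to (\<lambda>x. a *\<^sub>R p x + b *\<^sub>R q x) T g" if "T \<in> \<T>" for T
  proof -
    have "\<exists>g\<in>P0. restricts_to p T g" "\<exists>g\<in>P0. restricts_to q T g"
      using p q that by (simp_all add: Qh_def)
    then obtain c c' where c: "restricts_to p T (\<lambda>x. c)" and c': "restricts_to q T (\<lambda>x. c')"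
      by (auto simp: P0_def)
    have "(\<lambda>x. a *\<^sub>R c + b *\<^sub>R c') \<in> P0"
      by (auto simp: P0_def)
    moreover have "restricts_to (\<lambda>x. a *\<^sub>R p x + b *\<^sub>R q x) T (\<lambda>x. a *\<^sub>R c + b *\<^sub>R c')"
      by (rule restricts_to_lincomb[OF c c'])
    ultimately show ?thesis
      by (intro bexI[of _ "\<lambda>x. a *\<^sub>R c + b *\<^sub>R c'"])
  qed
  ultimately show ?thesis
    by (simp add: Qh_def L20_def)
qed

lemma Dh_subset_Vh: "Dh \<Omega> \<T> \<subseteq> Vh \<Omega> \<T>"
proof
  fix w assume w: "w \<in> Dh \<Omega> \<T>"
  have "(\<lambda>x. 0) \<in> Ch \<Omega> \<T>"
    using P1_const[of 0] by (auto simp: Ch_iff piecewise_def H10_zero restricts_to_def)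
  then show "w \<in> Vh \<Omega> \<T>"
    by (rule VhI[OF _ w]) simp
qed

lemma zero_Vh: "(\<lambda>x. 0) \<in> Vh \<Omega> \<T>"
proof -
  have "(\<lambda>x. 0) \<in> Dh \<Omega> \<T>"
    by (auto simp: Dh_def L2_def restricts_to_def intro!: exI[of _ 0])
  then show ?thesis
    using Dh_subset_Vh by blast
qed

lemma zero_Qh: "(\<lambda>x. 0) \<in> Qh \<Omega> \<T>"
  by (auto simp: Qh_def L20_def L2_def P0_def restricts_to_def)

lemma Ch_piecewise: "Ch \<Omega> \<T> \<subseteq> piecewise P1 \<T>"
  by (auto simp: Ch_iff)

lemma Dh_piecewise: "Dh \<Omega> \<T> \<subseteq> piecewise P1 \<T>"
  unfolding Dh_def piecewise_def using P1_scaled_shift by blast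

lemma Vh_piecewise: "Vh \<Omega> \<T> \<subseteq> piecewise P1 \<T>"
proof
  fix v assume "v \<in> Vh \<Omega> \<T>"
  then obtain v1 v2 where *: "v = (\<lambda>x. v1 x + v2 x)" "v1 \<in> Ch \<Omega> \<T>" "v2 \<in> Dh \<Omega> \<T>"
    by (auto simp: Vh_def)
  then show "v \<in> piecewise P1 \<T>"
    using piecewise_lincomb[of v1 v2 1 1] Ch_piecewise Dh_piecewise by auto
qed

lemma Vh_L2: "Vh \<Omega> \<T> \<subseteq> L2 \<Omega>"
proof
  fix v assume "v \<in> Vh \<Omega> \<T>"
  then obtain v1 v2 where *: "v = (\<lambda>x. v1 x + v2 x)" "v1 \<in> Ch \<Omega> \<T>" "v2 \<in> Dh \<Omega> \<T>"
    by (auto simp: Vh_def)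
  have "v1 \<in> L2 \<Omega>"
    using *(2) by (intro L2_components) (auto simp: Ch_def H10_def)
  moreover have "v2 \<in> L2 \<Omega>"
    using *(3) by (simp add: Dh_def)
  ultimately show "v \<in> L2 \<Omega>"
    using L2_lincomb(1)[of v1 \<Omega> v2 1 1] by (simp add: *(1))
qed

lemma Qh_piecewise: "Qh \<Omega> \<T> \<subseteq> piecewise P0 \<T>"
  by (auto simp: Qh_def piecewise_def)

lemma piecewise_P0_P1: "piecewise P0 \<T> \<subseteq> piecewise P1 \<T>"
  using P0_subset_P1 unfolding piecewise_def by blast

lemma piece_zero: "T \<in> \<T> \<Longrightarrow> piece (\<lambda>x. 0) T = (\<lambda>x. 0)"
  by (rule piece_eqI[OF simplex P1_const]) (auto simp: restricts_to_def)

lemma AE_domainI: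
  assumes \<Omega>: "open \<Omega>" and AE: "\<And>T. T \<in> \<T> \<Longrightarrow> AE x in lebesgue_on T. P x"
  shows "AE x in lebesgue_on \<Omega>. P x"
proof -
  have "AE x in lebesgue. \<forall>T\<in>\<T>. x \<in> T \<longrightarrow> P x"
    using AE element_sets fin by (intro AE_ball_countable') (auto simp: AE_restrict_space_iff countable_finite)
  moreover have "\<Omega> \<subseteq> \<Union>\<T>"
    using mesh_facts(3)[OF mesh] closure_subset by simp
  ultimately have "AE x in lebesgue. x \<in> \<Omega> \<longrightarrow> P x"
    by (auto elim!: eventually_mono)
  then show ?thesis
    using \<Omega> by (subst AE_restrict_space_iff) auto
qed

end

section \<open>Square linear systems on spaces of functions\<close>

text \<open>Vectors are functions and the operations pointwise; the spaces have infinite dimension as long as functions that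
  agree almost everywhere are not identified. Finite dimension enters through a finite family of functionals instead,
  the coordinates, whose common kernel is the set of negligible vectors.\<close>

definition lincomb_closed :: "('x \<Rightarrow> 'v::real_vector) set \<Rightarrow> bool" where
  "lincomb_closed X \<longleftrightarrow> (\<lambda>x. 0) \<in> X \<and> (\<forall>u\<in>X. \<forall>v\<in>X. \<forall>a b. (\<lambda>x. a *\<^sub>R u x + b *\<^sub>R v x) \<in> X)"

definition functional_on :: "('x \<Rightarrow> 'v::real_vector) set \<Rightarrow> (('x \<Rightarrow> 'v) \<Rightarrow> real) \<Rightarrow> bool" where
  "functional_on X l \<longleftrightarrow> (\<forall>u\<in>X. \<forall>v\<in>X. \<forall>a b. l (\<lambda>x. a *\<^sub>R u x + b *\<^sub>R v x) = a * l u + b * l v)"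

lemma lincomb_closedD: "lincomb_closed X \<Longrightarrow> u \<in> X \<Longrightarrow> v \<in> X \<Longrightarrow> (\<lambda>x. a *\<^sub>R u x + b *\<^sub>R v x) \<in> X"
  by (simp add: lincomb_closed_def)

lemma functional_onD: "functional_on X l \<Longrightarrow> u \<in> X \<Longrightarrow> v \<in> X \<Longrightarrow> l (\<lambda>x. a *\<^sub>R u x + b *\<^sub>R v x) = a * l u + b * l v"
  by (simp add: functional_on_def)

lemma functional_on_subset: "functional_on X l \<Longrightarrow> Y \<subseteq> X \<Longrightarrow> functional_on Y l"
  by (auto simp: functional_on_def)

lemma lincomb_closed_kernel:
  assumes X: "lincomb_closed X" and l: "functional_on X l"
  shows "lincomb_closed {x\<in>X. l x = 0}"
proof -
  have "(\<lambda>x. 0) \<in> X"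
    using X by (simp add: lincomb_closed_def)
  with functional_onD[OF l this this, of 0 0] have "l (\<lambda>x. 0) = 0"
    by simp
  then show ?thesis
    using X l by (simp add: lincomb_closed_def functional_on_def)
qed

lemma kernel_projection:
  assumes X: "lincomb_closed X" and l: "functional_on X l" and x0: "x0 \<in> X" "l x0 \<noteq> 0" and x: "x \<in> X"
  shows "(\<lambda>t. 1 *\<^sub>R x t + (- (l x / l x0)) *\<^sub>R x0 t) \<in> {x\<in>X. l x = 0}"
  using lincomb_closedD[OF X x x0(1), of 1 "- (l x / l x0)"] functional_onD[OF l x x0(1), of 1 "- (l x / l x0)"] x0(2) by simp

text \<open>By induction on the number of functionals: on the kernel of one of them the others suffice, and a vector outside
  that kernel determines the remaining coefficient.\<close>

lemma functional_in_span:
  fixes X :: "('x \<Rightarrow> 'v::real_vector) set"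
  assumes "finite J" "lincomb_closed X" "\<And>j. j \<in> J \<Longrightarrow> functional_on X (g j)" "functional_on X F"
    and "\<And>x. x \<in> X \<Longrightarrow> (\<forall>j\<in>J. g j x = 0) \<Longrightarrow> F x = 0"
  shows "\<exists>c. \<forall>x\<in>X. F x = (\<Sum>j\<in>J. c j * g j x)"
  using assms
proof (induction J arbitrary: X rule: finite_induct)
  case (insert i J)
  note X = insert.prems(1) and F = insert.prems(3)
  have gi: "functional_on X (g i)"
    using insert.prems by blast
  let ?Y = "{x\<in>X. g i x = 0}"
  have "\<exists>c. \<forall>x\<in>?Y. F x = (\<Sum>j\<in>J. c j * g j x)"
  proof (rule insert.IH)
    show "lincomb_closed ?Y"
      by (rule lincomb_closed_kernel[OF X gi])
    show "functional_on ?Y F" "\<And>j. j \<in> J \<Longrightarrow> functional_on ?Y (g j)"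
      using insert.prems functional_on_subset[of X _ ?Y] by auto
  qed (use insert.prems in auto)
  then obtain c where c: "\<And>x. x \<in> ?Y \<Longrightarrow> F x = (\<Sum>j\<in>J. c j * g j x)"
    by blast
  let ?S = "\<lambda>x. \<Sum>j\<in>J. c j * g j x"
  have S: "functional_on X ?S"
    unfolding functional_on_def
  proof (intro ballI allI)
    fix u v a b assume uv: "u \<in> X" "v \<in> X"
    have "g j (\<lambda>x. a *\<^sub>R u x + b *\<^sub>R v x) = a * g j u + b * g j v" if "j \<in> J" for j
      by (rule functional_onD[OF insert.prems(2) uv]) (use that in simp)
    then have "?S (\<lambda>x. a *\<^sub>R u x + b *\<^sub>R v x) = (\<Sum>j\<in>J. c j * (a * g j u + b * g j v))"
      by simp
    also have "\<dots> = a * ?S u + b * ?S v"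
      by (simp add: algebra_simps sum.distrib sum_distrib_left)
    finally show "?S (\<lambda>x. a *\<^sub>R u x + b *\<^sub>R v x) = a * ?S u + b * ?S v" .
  qed
  show ?case
  proof (cases "\<exists>x0\<in>X. g i x0 \<noteq> 0")
    case True
    then obtain x0 where x0: "x0 \<in> X" "g i x0 \<noteq> 0"
      by blast
    define d where "d = (F x0 - ?S x0) / g i x0"
    have "F x = (\<Sum>j\<in>insert i J. (c(i := d)) j * g j x)" if x: "x \<in> X" for x
    proof -
      let ?t = "- (g i x / g i x0)"
      from c[OF kernel_projection[OF X gi x0 x]]
      have "F x + ?t * F x0 = ?S x + ?t * ?S x0"
        by (simp only: functional_onD[OF F x x0(1)] functional_onD[OF S x x0(1)] mult_1)
      then have "F x = ?S x + g i x / g i x0 * (F x0 - ?S x0)"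
        by (simp add: algebra_simps)
      also have "\<dots> = ?S x + d * g i x"
        by (simp add: d_def)
      also have "?S x = (\<Sum>j\<in>J. (c(i := d)) j * g j x)"
        using insert.hyps by (intro sum.cong) auto
      finally show ?thesis
        using insert.hyps by simp
    qed
    then show ?thesis
      by blast
  next
    case False
    then have "F x = ?S x" if "x \<in> X" for x
      using c that by blast
    moreover have "(\<Sum>j\<in>insert i J. c j * g j x) = ?S x" if "x \<in> X" for x
      using False that insert.hyps by simp
    ultimately show ?thesis
      by (intro exI[of _ c]) simp
  qed
qed simp

text \<open>The set \<open>B\<close> is a basis modulo negligible vectors. It is built by taking, for each coordinate that does not vanish on
  the common kernel of those treated before, a vector of that kernel on which it does not vanish.\<close>

lemma finite_test_set:
  fixes X :: "('x \<Rightarrow> 'v::real_vector) set"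
  assumes "finite I" "lincomb_closed X" "\<And>i. i \<in> I \<Longrightarrow> functional_on X (\<phi> i)"
  shows "\<exists>B. finite B \<and> B \<subseteq> X \<and> (\<forall>l. functional_on X l \<longrightarrow> (\<forall>b\<in>B. l b = 0) \<longrightarrow>
    (\<forall>x\<in>X. (\<forall>i\<in>I. \<phi> i x = 0) \<longrightarrow> l x = 0) \<longrightarrow> (\<forall>x\<in>X. l x = 0))"
  using assms
proof (induction I arbitrary: X rule: finite_induct)
  case empty
  then show ?case
    by (intro exI[of _ "{}"]) auto
next
  case (insert i I)
  note X = insert.prems(1)
  have \<phi>i: "functional_on X (\<phi> i)"
    using insert.prems by blast
  let ?Y = "{x\<in>X. \<phi> i x = 0}"
  have "\<exists>B. finite B \<and> B \<subseteq> ?Y \<and> (\<forall>l. functional_on ?Y l \<longrightarrow> (\<forall>b\<in>B. l b = 0) \<longrightarrow>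
    (\<forall>x\<in>?Y. (\<forall>i\<in>I. \<phi> i x = 0) \<longrightarrow> l x = 0) \<longrightarrow> (\<forall>x\<in>?Y. l x = 0))"
  proof (rule insert.IH)
    show "lincomb_closed ?Y"
      by (rule lincomb_closed_kernel[OF X \<phi>i])
    show "\<And>j. j \<in> I \<Longrightarrow> functional_on ?Y (\<phi> j)"
      using insert.prems functional_on_subset[of X _ ?Y] by auto
  qed
  then obtain B where B: "finite B" "B \<subseteq> ?Y" and test: "\<And>l. functional_on ?Y l \<Longrightarrow> (\<forall>b\<in>B. l b = 0) \<Longrightarrow>
    (\<forall>x\<in>?Y. (\<forall>i\<in>I. \<phi> i x = 0) \<longrightarrow> l x = 0) \<Longrightarrow> (\<forall>x\<in>?Y. l x = 0)"
    by blast
  have Y0: "\<forall>x\<in>?Y. l x = 0" if l: "functional_on X l" and "\<forall>b\<in>B. l b = 0"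
    and "\<forall>x\<in>X. (\<forall>i\<in>insert i I. \<phi> i x = 0) \<longrightarrow> l x = 0" for l
  proof (rule test)
    show "functional_on ?Y l"
      by (rule functional_on_subset[OF l]) blast
  qed (use that in auto)
  show ?case
  proof (cases "\<exists>x0\<in>X. \<phi> i x0 \<noteq> 0")
    case True
    then obtain x0 where x0: "x0 \<in> X" "\<phi> i x0 \<noteq> 0"
      by blast
    have key: "l x = 0" if l: "functional_on X l" and b: "\<forall>b\<in>insert x0 B. l b = 0"
      and v: "\<forall>x\<in>X. (\<forall>i\<in>insert i I. \<phi> i x = 0) \<longrightarrow> l x = 0" and x: "x \<in> X" for l x
    proof -
      have "\<forall>x\<in>?Y. l x = 0"
        using b by (intro Y0[OF l _ v]) simp
      from bspec[OF this kernel_projection[OF X \<phi>i x0 x]] show "l x = 0"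
        using b by (simp only: functional_onD[OF l x x0(1)]) simp
    qed
    show ?thesis
    proof (intro exI[of _ "insert x0 B"] conjI allI impI ballI)
      show "finite (insert x0 B)" "insert x0 B \<subseteq> X"
        using B x0 by auto
    qed (rule key)
  next
    case False
    then have Y: "?Y = X"
      by blast
    show ?thesis
    proof (intro exI[of _ B] conjI allI impI)
      show "finite B" "B \<subseteq> X"
        using B by auto
    qed (rule Y0[unfolded Y])
  qed
qed

text \<open>The functionals \<open>B b\<close> with \<open>b\<close> in a finite test set have only negligible vectors in their common kernel, by
  symmetry and nondegeneracy. As \<open>F\<close> vanishes there, it is a combination of them, that is, \<open>B x\<close> for a combination
  \<open>x\<close> of test vectors.\<close>

lemma symmetric_form_Riesz:
  fixes X :: "('x \<Rightarrow> 'v::real_vector) set"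
  assumes I: "finite I" and X: "lincomb_closed X" and \<phi>: "\<And>i. i \<in> I \<Longrightarrow> functional_on X (\<phi> i)"
    and B: "\<And>y. y \<in> X \<Longrightarrow> functional_on X (\<lambda>x. B x y)" and sym: "\<And>x y. x \<in> X \<Longrightarrow> y \<in> X \<Longrightarrow> B x y = B y x"
    and F: "functional_on X F"
    and negligible_B: "\<And>x y. x \<in> X \<Longrightarrow> y \<in> X \<Longrightarrow> \<forall>i\<in>I. \<phi> i x = 0 \<Longrightarrow> B x y = 0"
    and negligible_F: "\<And>x. x \<in> X \<Longrightarrow> \<forall>i\<in>I. \<phi> i x = 0 \<Longrightarrow> F x = 0"
    and nondegenerate: "\<And>x i. x \<in> X \<Longrightarrow> \<forall>y\<in>X. B x y = 0 \<Longrightarrow> i \<in> I \<Longrightarrow> \<phi> i x = 0"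
  shows "\<exists>x\<in>X. \<forall>y\<in>X. B x y = F y"
proof -
  have "\<exists>D. finite D \<and> D \<subseteq> X \<and> (\<forall>l. functional_on X l \<longrightarrow> (\<forall>b\<in>D. l b = 0) \<longrightarrow>
    (\<forall>x\<in>X. (\<forall>i\<in>I. \<phi> i x = 0) \<longrightarrow> l x = 0) \<longrightarrow> (\<forall>x\<in>X. l x = 0))"
    by (rule finite_test_set[OF I X \<phi>])
  then obtain D where D: "finite D" "D \<subseteq> X" and test: "\<forall>l. functional_on X l \<longrightarrow> (\<forall>b\<in>D. l b = 0) \<longrightarrow>
    (\<forall>x\<in>X. (\<forall>i\<in>I. \<phi> i x = 0) \<longrightarrow> l x = 0) \<longrightarrow> (\<forall>x\<in>X. l x = 0)"
    by (elim exE conjE)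
  have "\<exists>c. \<forall>y\<in>X. F y = (\<Sum>b\<in>D. c b * B b y)"
  proof (rule functional_in_span[OF D(1) X _ F])
    fix b assume "b \<in> D"
    then have b: "b \<in> X"
      using D by blast
    show "functional_on X (B b)"
      unfolding functional_on_def
    proof (intro ballI allI)
      fix u v s t assume uv: "u \<in> X" "v \<in> X"
      show "B b (\<lambda>x. s *\<^sub>R u x + t *\<^sub>R v x) = s * B b u + t * B b v"
        using functional_onD[OF B[OF b] uv, of s t] sym[OF b] uv lincomb_closedD[OF X uv, of s t] by simp
    qed
  next
    fix y assume y: "y \<in> X" "\<forall>b\<in>D. B b y = 0"
    have "\<forall>x\<in>X. B x y = 0"
      using test[THEN spec, THEN mp, OF B[OF y(1)], THEN mp, OF y(2)] negligible_B[OF _ y(1)] by simp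
    then have "\<forall>x\<in>X. B y x = 0"
      using sym y by simp
    then show "F y = 0"
      using nondegenerate[OF y(1)] negligible_F[OF y(1)] by blast
  qed
  then obtain c where c: "\<And>y. y \<in> X \<Longrightarrow> F y = (\<Sum>b\<in>D. c b * B b y)"
    by blast
  have "\<exists>x\<in>X. \<forall>y\<in>X. B x y = (\<Sum>b\<in>E. c b * B b y)" if "finite E" "E \<subseteq> X" for E
    using that
  proof (induction rule: finite_induct)
    case empty
    have z: "(\<lambda>x. 0) \<in> X"
      using X by (simp add: lincomb_closed_def)
    have "B (\<lambda>x. 0) y = 0" if "y \<in> X" for y
      using functional_onD[OF B[OF that] z z, of 0 0] by simp
    with z show ?case
      by auto
  next
    case (insert b E)
    then obtain x where x: "x \<in> X" "\<forall>y\<in>X. B x y = (\<Sum>b\<in>E. c b * B b y)"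
      by blast
    have b: "b \<in> X"
      using insert by blast
    have "B (\<lambda>t. c b *\<^sub>R b t + 1 *\<^sub>R x t) y = (\<Sum>b\<in>insert b E. c b * B b y)" if "y \<in> X" for y
      using functional_onD[OF B[OF that] b x(1), of "c b" 1] x(2) that insert.hyps by simp
    then show ?case
      using lincomb_closedD[OF X b x(1), of "c b" 1] by blast
  qed
  from this[OF D] show ?thesis
    using c by auto
qed

section \<open>The discrete problem\<close>

context sided_mesh
begin

lemma form_a_cong:
  assumes "\<And>T. T \<in> \<T> \<Longrightarrow> piece u T = piece u' T"
  shows "form_a \<T> Tp Tm \<rho> u v = form_a \<T> Tp Tm \<rho> u' v"
proof -
  have 1: "grad_piece u T = grad_piece u' T" if "T \<in> \<T>" for T
    by (rule ext) (simp add: grad_piece_def assms[OF that])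
  have 2: "jump \<T> Tp Tm (piece u) e = jump \<T> Tp Tm (piece u') e" if "e \<in> faces \<T>" for e
    using assms Tp[OF that] Tm[of e] by (simp add: jump_def fun_eq_iff)
  have 3: "average \<T> Tp Tm (grad_piece u) e = average \<T> Tp Tm (grad_piece u') e" if "e \<in> faces \<T>" for e
    using 1 Tp[OF that] Tm[of e] by (simp add: average_def fun_eq_iff)
  show ?thesis
    unfolding form_a_def by (simp only: 1 2 3 cong: sum.cong)
qed

lemma form_c_cong:
  assumes u: "u \<in> piecewise P1 \<T>" "u' \<in> piecewise P1 \<T>" and eq: "\<And>T. T \<in> \<T> \<Longrightarrow> piece u T = piece u' T"
    and v: "v \<in> piecewise P1 \<T>"
  shows "form_c \<T> Tp Tm \<rho> u v = form_c \<T> Tp Tm \<rho> u' v"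
proof -
  have 1: "(LINT x|lebesgue_on T. u x \<bullet> v x) = (LINT x|lebesgue_on T. u' x \<bullet> v x)" if T: "T \<in> \<T>" for T
    unfolding element_inner_integral[OF T u(1) v] element_inner_integral[OF T u(2) v] eq[OF T] ..
  have 2: "jump \<T> Tp Tm (piece u) e = jump \<T> Tp Tm (piece u') e" if "e \<in> faces \<T>" for e
    using eq Tp[OF that] Tm[of e] by (simp add: jump_def fun_eq_iff)
  show ?thesis
    unfolding form_c_def by (simp only: 1 2 cong: sum.cong)
qed

lemma form_b_cong:
  assumes q: "q \<in> piecewise P1 \<T>" "q' \<in> piecewise P1 \<T>" and v: "v \<in> piecewise P1 \<T>" "v' \<in> piecewise P1 \<T>"
    and eq: "\<And>T. T \<in> \<T> \<Longrightarrow> piece v T = piece v' T" "\<And>T. T \<in> \<T> \<Longrightarrow> piece q T = piece q' T"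
  shows "form_b \<T> Tp Tm v q = form_b \<T> Tp Tm v' q'"
proof -
  have div: "div_piece v T = div_piece v' T" if "T \<in> \<T>" for T
    by (rule ext) (simp add: div_piece_def grad_piece_def eq(1)[OF that])
  have 1: "(LINT x|lebesgue_on T. div_piece v T x * q x) = (LINT x|lebesgue_on T. div_piece v' T x * q' x)" if T: "T \<in> \<T>" for T
    unfolding form_b_element_integral[OF v(1) q(1) T] form_b_element_integral[OF v(2) q(2) T]
    unfolding eq(2)[OF T] div[OF T] ..
  have 2: "jump \<T> Tp Tm (piece v) e = jump \<T> Tp Tm (piece v') e" if "e \<in> faces \<T>" for e
    using eq(1) Tp[OF that] Tm[of e] by (simp add: jump_def fun_eq_iff)
  have 3: "average \<T> Tp Tm (piece q) e = average \<T> Tp Tm (piece q') e" if "e \<in> faces \<T>" for e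
    using eq(2) Tp[OF that] Tm[of e] by (simp add: average_def fun_eq_iff)
  show ?thesis
    unfolding form_b_def by (simp only: 1 2 3 cong: sum.cong)
qed

lemma zero_piecewise: "(\<lambda>x. 0) \<in> piecewise P1 \<T>"
  unfolding piecewise_def by (auto simp: restricts_to_def intro!: bexI[OF _ P1_const[of 0]])

lemma forms_negligible:
  assumes u: "u \<in> piecewise P1 \<T>" and u0: "\<And>T. T \<in> \<T> \<Longrightarrow> piece u T = (\<lambda>x. 0)" and v: "v \<in> piecewise P1 \<T>"
  shows "form_a \<T> Tp Tm \<rho> u v = 0" "form_c \<T> Tp Tm \<rho> u v = 0"
    "q \<in> piecewise P1 \<T> \<Longrightarrow> form_b \<T> Tp Tm u q = 0"
proof -
  note z = zero_piecewise
  have eq: "\<And>T. T \<in> \<T> \<Longrightarrow> piece u T = piece (\<lambda>x. 0) T"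
    by (simp add: u0 piece_zero)
  show "form_a \<T> Tp Tm \<rho> u v = 0"
    using form_a_cong[OF eq, of \<rho> v] form_a_lincomb[OF z z v, of \<rho> 0 0] by simp
  show "form_c \<T> Tp Tm \<rho> u v = 0"
    using form_c_cong[OF u z eq v, of \<rho>] form_c_lincomb[OF z z v, of \<rho> 0 0] by simp
  show "form_b \<T> Tp Tm u q = 0" if q: "q \<in> piecewise P1 \<T>"
    using form_b_cong[OF q q u z eq refl] form_b_lincomb_left[OF z z q, of 0 0] by simp
qed

lemma form_b_negligible_right:
  assumes v: "v \<in> piecewise P1 \<T>" and q: "q \<in> piecewise P1 \<T>" and q0: "\<And>T. T \<in> \<T> \<Longrightarrow> piece q T = (\<lambda>x. 0)"
  shows "form_b \<T> Tp Tm v q = 0"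
proof -
  note z = zero_piecewise
  have eq: "\<And>T. T \<in> \<T> \<Longrightarrow> piece q T = piece (\<lambda>x. 0) T"
    by (simp add: q0 piece_zero)
  show ?thesis
    using form_b_cong[OF q z v v refl eq] form_b_lincomb_right[OF v z z, of 0 0] by simp
qed

lemma piece_zero_imp_AE:
  assumes \<Omega>: "open \<Omega>" and v: "v \<in> piecewise P1 \<T>" and v0: "\<And>T. T \<in> \<T> \<Longrightarrow> piece v T = (\<lambda>x. 0)"
  shows "AE x in lebesgue_on \<Omega>. v x = 0"
proof (rule AE_domainI[OF \<Omega>])
  fix T assume T: "T \<in> \<T>"
  show "AE x in lebesgue_on T. v x = 0"
    using piece_piecewise(2)[OF v T] by (simp add: v0[OF T])
qed

lemma Qh_constant_zero:
  assumes \<Omega>: "open \<Omega>" "bounded \<Omega>" "\<Omega> \<noteq> {}" and q: "q \<in> Qh \<Omega> \<T>" and c: "\<forall>T\<in>\<T>. piece q T = (\<lambda>x. c)"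
  shows "c = 0"
proof -
  have q1: "q \<in> piecewise P1 \<T>"
    using q Qh_piecewise piecewise_P0_P1 by blast
  have "AE x in lebesgue_on \<Omega>. q x = c"
  proof (rule AE_domainI[OF \<Omega>(1)])
    fix T assume T: "T \<in> \<T>"
    show "AE x in lebesgue_on T. q x = c"
      using piece_piecewise(2)[OF q1 T] c T by simp
  qed
  then have "(LINT x|lebesgue_on \<Omega>. q x) = (LINT x|lebesgue_on \<Omega>. c)"
    using q by (intro integral_cong_AE) (auto simp: Qh_def L20_def L2_def)
  moreover have "(LINT x|lebesgue_on \<Omega>. q x) = 0"
    using q by (simp add: Qh_def L20_def)
  ultimately have "measure lebesgue \<Omega> * c = 0"
    using \<Omega> by (simp add: measure_restrict_space)
  moreover have "\<Omega> \<in> lmeasurable"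
    using \<Omega> by (intro bounded_set_imp_lmeasurable) auto
  then have "measure lebesgue \<Omega> \<noteq> 0"
    using open_not_negligible[OF \<Omega>(1,3)] negligible_iff_measure by blast
  ultimately show ?thesis
    by simp
qed

text \<open>Testing with \<open>u\<close> and \<open>p\<close> themselves removes the pressure and leaves an energy that controls \<open>u\<close>. Once \<open>u\<close> is
  gone, the first equation says that the pressure coupling with \<open>p\<close> vanishes.\<close>

lemma saddle_point_injective:
  assumes \<Omega>: "open \<Omega>" "connected \<Omega>" "bounded \<Omega>" "\<Omega> \<noteq> {}" and d: "CARD('n) \<ge> 2" and reg: "shape_regular \<sigma> \<T>"
    and \<rho>: "\<rho>\<^sub>1 > 0" "(real CARD('n) + 1) * ((real CARD('n))\<^sup>2 * \<bar>\<sigma>\<bar>) \<le> \<rho>\<^sub>1" "\<rho>\<^sub>2 \<ge> 0" and \<nu>: "\<nu> \<ge> 0"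
    and u: "u \<in> Vh \<Omega> \<T>" and p: "p \<in> Qh \<Omega> \<T>"
    and eq1: "\<And>v. v \<in> Vh \<Omega> \<T> \<Longrightarrow> form_A \<rho>\<^sub>1 \<rho>\<^sub>2 \<nu> u v - form_b \<T> Tp Tm v p = 0"
    and eq2: "\<And>q. q \<in> Qh \<Omega> \<T> \<Longrightarrow> form_b \<T> Tp Tm u q = 0"
    and T: "T \<in> \<T>"
  shows "piece u T = (\<lambda>x. 0)" "piece p T = (\<lambda>x. 0)"
proof -
  have u1: "u \<in> piecewise P1 \<T>"
    using u Vh_piecewise by blast
  have "form_A \<rho>\<^sub>1 \<rho>\<^sub>2 \<nu> u u = 0"
    using eq1[OF u] eq2[OF p] by simp
  moreover have "\<nu> * form_a \<T> Tp Tm \<rho>\<^sub>1 u u \<ge> 0"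
    using form_a_nonneg[OF d reg u1 \<rho>(1,2)] \<nu> by simp
  ultimately have "form_c \<T> Tp Tm \<rho>\<^sub>2 u u \<le> 0"
    by linarith
  then have u0: "piece u T = (\<lambda>x. 0)" if "T \<in> \<T>" for T
    using form_c_definite[OF u1 \<rho>(3) _ that] by blast
  then show "piece u T = (\<lambda>x. 0)"
    using T by blast
  have "form_b \<T> Tp Tm v p = 0" if "v \<in> Dh \<Omega> \<T>" for v
  proof -
    have v: "v \<in> Vh \<Omega> \<T>" "v \<in> piecewise P1 \<T>"
      using that Dh_subset_Vh Dh_piecewise by blast+
    show ?thesis
      using eq1[OF v(1)] forms_negligible(1,2)[OF u1 u0 v(2)] by simp
  qed
  then obtain c where c: "\<forall>T\<in>\<T>. piece p T = (\<lambda>x. c)"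
    using form_b_injective[OF \<Omega>(1-3), of p] p Qh_piecewise by blast
  moreover have "c = 0"
    by (rule Qh_constant_zero[OF \<Omega>(1,3,4) p c])
  ultimately show "piece p T = (\<lambda>x. 0)"
    using T by simp
qed

lemma steg_well_posed:
  assumes \<Omega>: "open \<Omega>" "connected \<Omega>" "bounded \<Omega>" "\<Omega> \<noteq> {}" and d: "CARD('n) \<ge> 2" and reg: "shape_regular \<sigma> \<T>"
    and \<rho>: "\<rho>\<^sub>1 > 0" "(real CARD('n) + 1) * ((real CARD('n))\<^sup>2 * \<bar>\<sigma>\<bar>) \<le> \<rho>\<^sub>1" "\<rho>\<^sub>2 \<ge> 0" and \<nu>: "\<nu> \<ge> 0"
    and f: "f \<in> L2 \<Omega>"
  shows "\<exists>u p. steg_solution \<Omega> \<T> Tp Tm \<rho>\<^sub>1 \<rho>\<^sub>2 \<nu> f u p \<and>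
    (\<forall>u' p'. steg_solution \<Omega> \<T> Tp Tm \<rho>\<^sub>1 \<rho>\<^sub>2 \<nu> f u' p' \<longrightarrow>
      (AE x in lebesgue_on \<Omega>. u' x = u x) \<and> (AE x in lebesgue_on \<Omega>. p' x = p x))"
proof -
  note injective = saddle_point_injective[OF \<Omega> d reg \<rho> \<nu>]
  let ?A = "form_A \<rho>\<^sub>1 \<rho>\<^sub>2 \<nu>" and ?b = "form_b \<T> Tp Tm"
  \<comment> \<open>A velocity and a pressure together are one function with values in a product.\<close>
  define vel :: "(real ^ 'n \<Rightarrow> (real ^ 'n) \<times> real) \<Rightarrow> real ^ 'n \<Rightarrow> real ^ 'n" where "vel z = (\<lambda>x. fst (z x))" for z
  define pre :: "(real ^ 'n \<Rightarrow> (real ^ 'n) \<times> real) \<Rightarrow> real ^ 'n \<Rightarrow> real" where "pre z = (\<lambda>x. snd (z x))" for z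
  define X where "X = {z. vel z \<in> Vh \<Omega> \<T> \<and> pre z \<in> Qh \<Omega> \<T>}"
  have vel_lincomb: "vel (\<lambda>x. a *\<^sub>R z x + b *\<^sub>R w x) = (\<lambda>x. a *\<^sub>R vel z x + b *\<^sub>R vel w x)"
    and pre_lincomb: "pre (\<lambda>x. a *\<^sub>R z x + b *\<^sub>R w x) = (\<lambda>x. a *\<^sub>R pre z x + b *\<^sub>R pre w x)" for a b z w
    by (simp_all add: vel_def pre_def)
  have XD: "vel z \<in> Vh \<Omega> \<T>" "pre z \<in> Qh \<Omega> \<T>" "vel z \<in> piecewise P1 \<T>" "pre z \<in> piecewise P1 \<T>" if "z \<in> X" for z
    using that Vh_piecewise Qh_piecewise piecewise_P0_P1 by (auto simp: X_def)
  have pairX: "(\<lambda>x. (v x, q x)) \<in> X" "vel (\<lambda>x. (v x, q x)) = v" "pre (\<lambda>x. (v x, q x)) = q"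
    if "v \<in> Vh \<Omega> \<T>" "q \<in> Qh \<Omega> \<T>" for v q
    using that by (simp_all add: X_def vel_def pre_def)
  have X: "lincomb_closed X"
    unfolding lincomb_closed_def
  proof (intro conjI ballI allI)
    show "(\<lambda>x. 0) \<in> X"
      using zero_Vh zero_Qh by (simp add: X_def vel_def pre_def)
    fix z w a b assume "z \<in> X" "w \<in> X"
    then show "(\<lambda>x. a *\<^sub>R z x + b *\<^sub>R w x) \<in> X"
      unfolding X_def mem_Collect_eq vel_lincomb pre_lincomb
      by (intro conjI Vh_lincomb Qh_lincomb \<Omega>) simp_all
  qed
  \<comment> \<open>The sign of the second equation is chosen so that the form is symmetric.\<close>
  define B where "B z w = ?A (vel z) (vel w) - ?b (vel w) (pre z) - ?b (vel z) (pre w)" for z w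
  define F where "F z = (LINT x|lebesgue_on \<Omega>. f x \<bullet> vel z x)" for z
  \<comment> \<open>Coordinates: an affine function is determined by its values at the origin and at the unit vectors.\<close>
  define \<phi> where "\<phi> = (\<lambda>(T, y, i) z. case i of Some i \<Rightarrow> piece (vel z) T y $ i | None \<Rightarrow> piece (pre z) T y)"
  define I where "I = \<T> \<times> (insert 0 (range (\<lambda>j :: 'n. axis j (1::real)))) \<times> (UNIV :: 'n option set)"
  have \<phi>_zero: "piece (vel z) T = (\<lambda>x. 0)" "piece (pre z) T = (\<lambda>x. 0)" if z: "z \<in> X" "\<forall>i\<in>I. \<phi> i z = 0" and T: "T \<in> \<T>" for z T
  proof -
    have at: "piece (vel z) T y $ i = 0" "piece (pre z) T y = 0" if "y = 0 \<or> y \<in> range (\<lambda>j. axis j 1)" for y i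
      using bspec[OF z(2), of "(T, y, Some i)"] bspec[OF z(2), of "(T, y, None)"] T that by (auto simp: I_def \<phi>_def)
    show "piece (vel z) T = (\<lambda>x. 0)"
    proof (rule P1_eq_0I[OF piece_piecewise(1)[OF XD(3)[OF z(1)] T]])
      show "piece (vel z) T 0 = 0" "piece (vel z) T (axis j 1) = 0" for j
        using at(1)[of 0] at(1)[of "axis j 1"] unfolding vec_eq_iff by simp_all
    qed
    show "piece (pre z) T = (\<lambda>x. 0)"
      by (rule P1_eq_0I[OF piece_piecewise(1)[OF XD(4)[OF z(1)] T]]) (simp_all add: at(2))
  qed
  have F_integrable: "integrable (lebesgue_on \<Omega>) (\<lambda>x. f x \<bullet> vel z x)" if "z \<in> X" for z
    using L2_inner_integrable[OF f] Vh_L2 XD(1)[OF that] by blast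
  have "\<exists>z\<in>X. \<forall>w\<in>X. B z w = F w"
  proof (rule symmetric_form_Riesz[of I X \<phi>])
    show "finite I"
      unfolding I_def using fin by simp
    show "lincomb_closed X"
      by (rule X)
    show "functional_on X (\<phi> i)" if i: "i \<in> I" for i
      unfolding functional_on_def
    proof (intro ballI allI)
      fix u v a b assume uv: "u \<in> X" "v \<in> X"
      obtain T y k where T: "i = (T, y, k)" "T \<in> \<T>"
        using i by (auto simp: I_def)
      show "\<phi> i (\<lambda>x. a *\<^sub>R u x + b *\<^sub>R v x) = a * \<phi> i u + b * \<phi> i v"
        unfolding \<phi>_def T prod.case
        unfolding vel_lincomb pre_lincomb piece_lincomb[OF XD(3)[OF uv(1)] XD(3)[OF uv(2)] T(2)]
          piece_lincomb[OF XD(4)[OF uv(1)] XD(4)[OF uv(2)] T(2)]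
        by (simp split: option.split)
    qed
    show "functional_on X (\<lambda>z. B z w)" if w: "w \<in> X" for w
      unfolding functional_on_def
    proof (intro ballI allI)
      fix z z' a b assume z: "z \<in> X" "z' \<in> X"
      show "B (\<lambda>x. a *\<^sub>R z x + b *\<^sub>R z' x) w = a * B z w + b * B z' w"
        unfolding B_def vel_lincomb pre_lincomb form_a_lincomb[OF XD(3)[OF z(1)] XD(3)[OF z(2)] XD(3)[OF w]]
          form_c_lincomb[OF XD(3)[OF z(1)] XD(3)[OF z(2)] XD(3)[OF w]]
          form_b_lincomb_left[OF XD(3)[OF z(1)] XD(3)[OF z(2)] XD(4)[OF w]]
          form_b_lincomb_right[OF XD(3)[OF w] XD(4)[OF z(1)] XD(4)[OF z(2)]]
        by (simp add: algebra_simps)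
    qed
    show "B z w = B w z" for z w
      unfolding B_def by (simp add: form_a_commute[of _ "vel z"] form_c_commute[of _ "vel z"])
    show "functional_on X F"
      unfolding functional_on_def F_def vel_lincomb inner_right_distrib inner_scaleR_right
      using F_integrable by simp
    show "B z w = 0" if z: "z \<in> X" and w: "w \<in> X" and 0: "\<forall>i\<in>I. \<phi> i z = 0" for z w
      unfolding B_def using forms_negligible[OF XD(3)[OF z] \<phi>_zero(1)[OF z 0] XD(3)[OF w]] XD(4)[OF w]
        form_b_negligible_right[OF XD(3)[OF w] XD(4)[OF z] \<phi>_zero(2)[OF z 0]] by simp
    show "F z = 0" if z: "z \<in> X" and 0: "\<forall>i\<in>I. \<phi> i z = 0" for z
    proof -
      have "AE x in lebesgue_on \<Omega>. vel z x = 0"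
        by (rule piece_zero_imp_AE[OF \<Omega>(1) XD(3)[OF z] \<phi>_zero(1)[OF z 0]])
      then have "AE x in lebesgue_on \<Omega>. f x \<bullet> vel z x = 0"
        by eventually_elim simp
      then show ?thesis
        unfolding F_def by (rule integral_eq_zero_AE)
    qed
    show "\<phi> i z = 0" if z: "z \<in> X" and 0: "\<forall>w\<in>X. B z w = 0" and i: "i \<in> I" for z i
    proof -
      have "?A (vel z) v - ?b v (pre z) = 0" if v: "v \<in> Vh \<Omega> \<T>" for v
      proof -
        have "B z (\<lambda>x. (v x, 0)) = 0"
          using 0 pairX(1)[OF v zero_Qh] by blast
        moreover have "?b (vel z) (\<lambda>x. 0) = 0"
          by (rule form_b_negligible_right[OF XD(3)[OF z] zero_piecewise piece_zero])
        ultimately show ?thesis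
          by (simp add: B_def pairX(2,3)[OF v zero_Qh])
      qed
      moreover have "?b (vel z) q = 0" if q: "q \<in> Qh \<Omega> \<T>" for q
      proof -
        have "B z (\<lambda>x. (0, q x)) = 0"
          using 0 pairX(1)[OF zero_Vh q] by blast
        moreover have "?A (vel z) (\<lambda>x. 0) = 0" "?b (\<lambda>x. 0) (pre z) = 0"
          using forms_negligible[OF zero_piecewise piece_zero XD(3)[OF z]] XD(4)[OF z]
          by (simp_all add: form_a_commute[of _ "vel z"] form_c_commute[of _ "vel z"])
        ultimately show ?thesis
          by (simp add: B_def pairX(2,3)[OF zero_Vh q])
      qed
      ultimately have "piece (vel z) T = (\<lambda>x. 0)" "piece (pre z) T = (\<lambda>x. 0)" if "T \<in> \<T>" for T
        using injective[OF XD(1,2)[OF z] _ _ that] by blast+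
      then show ?thesis
        using i by (auto simp: I_def \<phi>_def split: option.split)
    qed
  qed
  then obtain z where z: "z \<in> X" "\<And>w. w \<in> X \<Longrightarrow> B z w = F w"
    by blast
  have solves: "steg_solution \<Omega> \<T> Tp Tm \<rho>\<^sub>1 \<rho>\<^sub>2 \<nu> f (vel z) (pre z)"
    unfolding steg_solution_def
  proof (intro conjI ballI XD z)
    fix v assume v: "v \<in> Vh \<Omega> \<T>"
    have "?b (vel z) (\<lambda>x. 0) = 0"
      by (rule form_b_negligible_right[OF XD(3)[OF z(1)] zero_piecewise piece_zero])
    then show "?A (vel z) v - ?b v (pre z) = (LINT x|lebesgue_on \<Omega>. f x \<bullet> v x)"
      using z(2)[OF pairX(1)[OF v zero_Qh]] by (simp add: B_def F_def pairX(2,3)[OF v zero_Qh])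
  next
    fix q assume q: "q \<in> Qh \<Omega> \<T>"
    have "?A (vel z) (\<lambda>x. 0) = 0" "?b (\<lambda>x. 0) (pre z) = 0"
      using forms_negligible[OF zero_piecewise piece_zero XD(3)[OF z(1)]] XD(4)[OF z(1)]
      by (simp_all add: form_a_commute[of _ "vel z"] form_c_commute[of _ "vel z"])
    then show "?b (vel z) q = 0"
      using z(2)[OF pairX(1)[OF zero_Vh q]] by (simp add: B_def F_def pairX(2,3)[OF zero_Vh q])
  qed
  have unique: "(AE x in lebesgue_on \<Omega>. u' x = vel z x) \<and> (AE x in lebesgue_on \<Omega>. p' x = pre z x)"
    if sol: "steg_solution \<Omega> \<T> Tp Tm \<rho>\<^sub>1 \<rho>\<^sub>2 \<nu> f u' p'" for u' p'
  proof -
    let ?u = "\<lambda>x. 1 *\<^sub>R u' x + (- 1) *\<^sub>R vel z x" and ?p = "\<lambda>x. 1 *\<^sub>R p' x + (- 1) *\<^sub>R pre z x"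
    have up: "u' \<in> Vh \<Omega> \<T>" "p' \<in> Qh \<Omega> \<T>" "u' \<in> piecewise P1 \<T>" "p' \<in> piecewise P1 \<T>"
      using sol Vh_piecewise Qh_piecewise piecewise_P0_P1 by (auto simp: steg_solution_def)
    have u: "?u \<in> Vh \<Omega> \<T>"
      by (rule Vh_lincomb[OF \<Omega>(1,3) up(1) XD(1)[OF z(1)]])
    have p: "?p \<in> Qh \<Omega> \<T>"
      by (rule Qh_lincomb[OF up(2) XD(2)[OF z(1)] \<Omega>(1,3)])
    have eq1: "?A ?u v - ?b v ?p = 0" if v: "v \<in> Vh \<Omega> \<T>" for v
    proof -
      have v1: "v \<in> piecewise P1 \<T>"
        using v Vh_piecewise by blast
      have "?A u' v - ?b v p' = ?A (vel z) v - ?b v (pre z)"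
        using sol solves v unfolding steg_solution_def by simp
      then show ?thesis
        unfolding form_a_lincomb[OF up(3) XD(3)[OF z(1)] v1] form_c_lincomb[OF up(3) XD(3)[OF z(1)] v1]
          form_b_lincomb_right[OF v1 up(4) XD(4)[OF z(1)]] by (simp add: algebra_simps)
    qed
    have eq2: "?b ?u q = 0" if q: "q \<in> Qh \<Omega> \<T>" for q
    proof -
      have q1: "q \<in> piecewise P1 \<T>"
        using q Qh_piecewise piecewise_P0_P1 by blast
      show ?thesis
        unfolding form_b_lincomb_left[OF up(3) XD(3)[OF z(1)] q1] using sol solves q by (simp add: steg_solution_def)
    qed
    have "AE x in lebesgue_on \<Omega>. ?u x = 0"
      by (rule piece_zero_imp_AE[OF \<Omega>(1) subsetD[OF Vh_piecewise u] injective(1)[OF u p eq1 eq2]])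
    moreover have "AE x in lebesgue_on \<Omega>. ?p x = 0"
      by (rule piece_zero_imp_AE[OF \<Omega>(1) subsetD[OF piecewise_P0_P1 subsetD[OF Qh_piecewise p]] injective(2)[OF u p eq1 eq2]])
    ultimately show ?thesis
      by simp
  qed
  show ?thesis
    using solves unique by blast
qed

end

theorem theorem4p5:
  fixes \<Omega> :: "(real ^ 'n) set" and \<sigma> :: real
  assumes "CARD('n) = 2 \<or> CARD('n) = 3"
    and "bounded_lipschitz_domain \<Omega>"
    and "simply_connected \<Omega>"
  shows "\<exists>R\<^sub>1 > 0. \<exists>R\<^sub>2 > 0. \<forall>\<rho>\<^sub>1 > R\<^sub>1. \<forall>\<rho>\<^sub>2 > R\<^sub>2.
           \<forall>\<nu> \<in> {0..1}. \<forall>\<T> Tp Tm. mesh \<Omega> \<T> \<and> shape_regular \<sigma> \<T> \<and> face_sides \<T> Tp Tm \<longrightarrow>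
             (\<forall>f \<in> L2 \<Omega>.
               \<exists>u p. steg_solution \<Omega> \<T> Tp Tm \<rho>\<^sub>1 \<rho>\<^sub>2 \<nu> f u p \<and>
                 (\<forall>u' p'. steg_solution \<Omega> \<T> Tp Tm \<rho>\<^sub>1 \<rho>\<^sub>2 \<nu> f u' p' \<longrightarrow>
                    (AE x in lebesgue_on \<Omega>. u' x = u x) \<and>
                    (AE x in lebesgue_on \<Omega>. p' x = p x)))"
proof -
  \<comment> \<open>The threshold of coercivity, increased to be positive even if \<open>\<sigma> = 0\<close>.\<close>
  define R where "R = (real CARD('n) + 1) * ((real CARD('n))\<^sup>2 * \<bar>\<sigma>\<bar>) + 1"
  have d: "CARD('n) \<ge> 2"
    using assms(1) by auto
  have \<Omega>: "open \<Omega>" "connected \<Omega>" "bounded \<Omega>" "\<Omega> \<noteq> {}"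
    using assms(2) by (auto simp: bounded_lipschitz_domain_def)
  have R: "R > 0" "(real CARD('n) + 1) * ((real CARD('n))\<^sup>2 * \<bar>\<sigma>\<bar>) \<le> R"
    unfolding R_def by (auto intro!: add_nonneg_pos)
  show ?thesis
  proof (intro exI[of _ R] conjI allI impI ballI)
    fix \<rho>\<^sub>1 \<rho>\<^sub>2 \<nu> :: real and \<T> Tp Tm and f :: "real ^ 'n \<Rightarrow> real ^ 'n"
    assume \<rho>: "R < \<rho>\<^sub>1" "R < \<rho>\<^sub>2" and \<nu>: "\<nu> \<in> {0..1}"
      and \<T>: "mesh \<Omega> \<T> \<and> shape_regular \<sigma> \<T> \<and> face_sides \<T> Tp Tm" and f: "f \<in> L2 \<Omega>"
    interpret sided_mesh \<Omega> \<T> Tp Tm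
      using \<T> by unfold_locales auto
    show "\<exists>u p. steg_solution \<Omega> \<T> Tp Tm \<rho>\<^sub>1 \<rho>\<^sub>2 \<nu> f u p \<and>
      (\<forall>u' p'. steg_solution \<Omega> \<T> Tp Tm \<rho>\<^sub>1 \<rho>\<^sub>2 \<nu> f u' p' \<longrightarrow>
        (AE x in lebesgue_on \<Omega>. u' x = u x) \<and> (AE x in lebesgue_on \<Omega>. p' x = p x))"
      by (rule steg_well_posed[where \<sigma>=\<sigma>, OF \<Omega> d _ _ _ _ _ f]) (use \<T> \<rho> \<nu> R in auto)
  qed (use R in auto)
qed

end
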